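(* Let $k$ be an algebraically closed field of characteristic $p \geqslant 0$ with $p \neq 2, 3$. Let $G$ be a finite group acting by automorphisms on a connected finite poset $\mathcal{P}$. Then the transporter category $\mathcal{T} = G \propto \mathcal{P}$ is of finite representation type (over $k$) if and only if one of the following conditions is true: (1) $|G|$ is invertible in $k$ and $\mathcal{P}$ is of finite representation type; (2) $\mathcal{P}$ has only one element and $G$ is of finite representation type.
   Context: A poset $\mathcal{P}$ is viewed as a category with a unique morphism $x \to y$ whenever $x \leqslant y$; it is connected if this category is connected. The transporter category $\mathcal{T} = G \propto \mathcal{P}$ has the same objects as $\mathcal{P}$; its morphisms are the symbols $\alpha g$ with $g \in G$ and $\alpha: x \to y$ a morphism of $\mathcal{P}$, where $\alpha g$ has source $g^{-1}(x)$ and target $y$, and composition is $(\alpha g)(\beta h) = \alpha\, g(\beta)\, gh$. A representation of a finite category is a covariant functor to finite-dimensional $k$-vector spaces (equivalently, a finitely generated module over the category algebra; the category algebra $k\mathcal{T}$ is the skew group algebra of the incidence algebra $k\mathcal{P}$ by $G$). $\mathcal{T}$, $\mathcal{P}$, or $G$ is of finite representation type if $k\mathcal{T}$, the incidence algebra $k\mathcal{P}$, or the group algebra $kG$, respectively, has only finitely many isomorphism classes of indecomposable finitely generated modules. *)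

theory Defs
  imports "HOL-Algebra.Algebra" "HOL-Computational_Algebra.Polynomial"
begin

section \<open>Modules over a not necessarily commutative ring\<close>

text \<open>
  The library locale \<^locale>\<open>module\<close> demands a commutative ring of scalars; the following is the
  same locale over an arbitrary ring. The multiplicative fields of the \<open>module\<close> record
  carry no meaning. The library locale \<^locale>\<open>submodule\<close> does not assume commutativity and is
  reused below.
\<close>

locale left_module = R?: ring R + M?: abelian_group M
  for R :: "('r, 's) ring_scheme" (structure) and M :: "('r, 'm, 't) module_scheme" (structure) +
  assumes smult_closed [simp, intro]:
      "\<lbrakk>a \<in> carrier R; x \<in> carrier M\<rbrakk> \<Longrightarrow> a \<odot>\<^bsub>M\<^esub> x \<in> carrier M"
    and smult_l_distr:
      "\<lbrakk>a \<in> carrier R; b \<in> carrier R; x \<in> carrier M\<rbrakk> \<Longrightarrow>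
        (a \<oplus>\<^bsub>R\<^esub> b) \<odot>\<^bsub>M\<^esub> x = a \<odot>\<^bsub>M\<^esub> x \<oplus>\<^bsub>M\<^esub> b \<odot>\<^bsub>M\<^esub> x"
    and smult_r_distr:
      "\<lbrakk>a \<in> carrier R; x \<in> carrier M; y \<in> carrier M\<rbrakk> \<Longrightarrow>
        a \<odot>\<^bsub>M\<^esub> (x \<oplus>\<^bsub>M\<^esub> y) = a \<odot>\<^bsub>M\<^esub> x \<oplus>\<^bsub>M\<^esub> a \<odot>\<^bsub>M\<^esub> y"
    and smult_assoc1:
      "\<lbrakk>a \<in> carrier R; b \<in> carrier R; x \<in> carrier M\<rbrakk> \<Longrightarrow>
        (a \<otimes>\<^bsub>R\<^esub> b) \<odot>\<^bsub>M\<^esub> x = a \<odot>\<^bsub>M\<^esub> (b \<odot>\<^bsub>M\<^esub> x)"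
    and smult_one [simp]:
      "x \<in> carrier M \<Longrightarrow> \<one>\<^bsub>R\<^esub> \<odot>\<^bsub>M\<^esub> x = x"

definition finitely_generated_module ::
    "('r, 's) ring_scheme \<Rightarrow> ('r, 'm, 't) module_scheme \<Rightarrow> bool" where
  "finitely_generated_module R M \<longleftrightarrow> left_module R M \<and>
     (\<exists>A. finite A \<and> A \<subseteq> carrier M \<and>
       (\<forall>x\<in>carrier M. \<exists>c\<in>A \<rightarrow> carrier R. x = (\<Oplus>\<^bsub>M\<^esub>a\<in>A. c a \<odot>\<^bsub>M\<^esub> a)))"

definition indecomposable_module ::
    "('r, 's) ring_scheme \<Rightarrow> ('r, 'm, 't) module_scheme \<Rightarrow> bool" where
  "indecomposable_module R M \<longleftrightarrow> left_module R M \<and> carrier M \<noteq> {\<zero>\<^bsub>M\<^esub>} \<and>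
     (\<forall>A B. submodule A R M \<and> submodule B R M \<and>
        A <+>\<^bsub>M\<^esub> B = carrier M \<and> A \<inter> B = {\<zero>\<^bsub>M\<^esub>} \<longrightarrow>
        A = {\<zero>\<^bsub>M\<^esub>} \<or> B = {\<zero>\<^bsub>M\<^esub>})"

definition module_iso ::
    "('r, 's) ring_scheme \<Rightarrow> ('r, 'm, 't) module_scheme \<Rightarrow> ('r, 'n, 'u) module_scheme
      \<Rightarrow> ('m \<Rightarrow> 'n) set" where
  "module_iso R M N = {f \<in> iso (add_monoid M) (add_monoid N).
     \<forall>r\<in>carrier R. \<forall>x\<in>carrier M. f (r \<odot>\<^bsub>M\<^esub> x) = r \<odot>\<^bsub>N\<^esub> f x}"

text \<open>
  Modules have to be taken with elements in one fixed type. The type \<open>(nat \<Rightarrow> 'r) set\<close> is large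
  enough: a module generated by \<open>n\<close> elements is a quotient of \<open>R\<^sup>n\<close>, so its elements are
  cosets, that is, sets of coefficient sequences. Lemma \<open>finitely_generated_module_copy\<close> below
  confirms that every finitely generated module, of any type, has an isomorphic copy here.
\<close>

definition fg_indecomposables ::
    "('r, 's) ring_scheme \<Rightarrow> ('r, (nat \<Rightarrow> 'r) set) module set" where
  "fg_indecomposables R = {M. finitely_generated_module R M \<and> indecomposable_module R M}"

definition fg_indecomposables_iso_rel ::
    "('r, 's) ring_scheme \<Rightarrow> (('r, (nat \<Rightarrow> 'r) set) module) rel" where
  "fg_indecomposables_iso_rel R =
     {(M, N) \<in> fg_indecomposables R \<times> fg_indecomposables R. module_iso R M N \<noteq> {}}"

definition finite_representation_type :: "('r, 's) ring_scheme \<Rightarrow> bool" where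
  "finite_representation_type R \<longleftrightarrow>
     finite (fg_indecomposables R // fg_indecomposables_iso_rel R)"

lemma left_module_transport:
  fixes M :: "('r, 'm, 't) module_scheme" and h :: "'m \<Rightarrow> 'n"
  assumes M: "left_module R M" and h: "inj_on h (carrier M)"
  shows "\<exists>N :: ('r, 'n) module. left_module R N \<and> h \<in> module_iso R M N"
proof -
  interpret M: left_module R M by (rule M)
  define g where "g = inv_into (carrier M) h"
  have gh [simp]: "g (h x) = x" if "x \<in> carrier M" for x
    using h that by (simp add: g_def)
  define N :: "('r, 'n) module" where
    "N = \<lparr>carrier = h ` carrier M, monoid.mult = undefined, monoid.one = undefined, ring.zero = h \<zero>\<^bsub>M\<^esub>,
          ring.add = (\<lambda>x y. h (g x \<oplus>\<^bsub>M\<^esub> g y)), module.smult = (\<lambda>a x. h (a \<odot>\<^bsub>M\<^esub> g x))\<rparr>"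
  have "abelian_group N"
  proof (rule abelian_groupI)
    show "\<exists>y\<in>carrier N. y \<oplus>\<^bsub>N\<^esub> x = \<zero>\<^bsub>N\<^esub>" if "x \<in> carrier N" for x
    proof -
      obtain u where u: "u \<in> carrier M" "x = h u"
        using \<open>x \<in> carrier N\<close> by (auto simp: N_def)
      then show ?thesis
        by (intro bexI[of _ "h (\<ominus>\<^bsub>M\<^esub> u)"]) (auto simp: N_def M.l_neg)
    qed
  qed (auto simp: N_def M.a_ac)
  then have "left_module R N"
    unfolding left_module_def left_module_axioms_def
    by (intro conjI M.ring_axioms)
       (auto simp: N_def M.smult_l_distr M.smult_r_distr M.smult_assoc1)
  moreover have "h \<in> module_iso R M N"
    using h by (auto simp: module_iso_def iso_def hom_def bij_betw_def N_def)
  ultimately show ?thesis by blast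
qed

lemma finitely_generated_module_copy:
  fixes M :: "('r, 'm, 't) module_scheme"
  assumes "finitely_generated_module R M"
  shows "\<exists>N :: ('r, (nat \<Rightarrow> 'r) set) module. left_module R N \<and> module_iso R M N \<noteq> {}"
proof -
  from assms obtain A where M: "left_module R M" and A: "finite A" "A \<subseteq> carrier M"
    and gen: "\<And>x. x \<in> carrier M \<Longrightarrow>
      \<exists>c\<in>A \<rightarrow> carrier R. x = (\<Oplus>\<^bsub>M\<^esub>a\<in>A. c a \<odot>\<^bsub>M\<^esub> a)"
    unfolding finitely_generated_module_def by blast
  interpret M: left_module R M by (rule M)
  obtain e :: "'m \<Rightarrow> nat" where e: "inj_on e A"
    using finite_imp_inj_to_nat_seg[OF A(1)] by blast
  define h where
    "h x = {c :: nat \<Rightarrow> 'r. x = (\<Oplus>\<^bsub>M\<^esub>a\<in>A. c (e a) \<odot>\<^bsub>M\<^esub> a)}" for x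
  have "inj_on h (carrier M)"
  proof (rule inj_onI)
    fix x y assume x: "x \<in> carrier M" and xy: "h x = h y"
    obtain c where c: "c \<in> A \<rightarrow> carrier R" "x = (\<Oplus>\<^bsub>M\<^esub>a\<in>A. c a \<odot>\<^bsub>M\<^esub> a)"
      using gen[OF x] by blast
    have "(\<Oplus>\<^bsub>M\<^esub>a\<in>A. c a \<odot>\<^bsub>M\<^esub> a)
        = (\<Oplus>\<^bsub>M\<^esub>a\<in>A. c (inv_into A e (e a)) \<odot>\<^bsub>M\<^esub> a)"
      using c(1) A(2) e by (intro M.M.finsum_cong') (auto simp: Pi_iff intro!: M.smult_closed)
    then have "(\<lambda>i. c (inv_into A e i)) \<in> h x"
      using c(2) by (simp add: h_def)
    then have "(\<lambda>i. c (inv_into A e i)) \<in> h x \<inter> h y"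
      using xy by simp
    then show "x = y" by (simp add: h_def)
  qed
  from left_module_transport[OF M this] show ?thesis by blast
qed


section \<open>Finite categories and their category algebras\<close>

record ('o, 'm) cat =
  Obj :: "'o set"
  Arr :: "'m set"
  Dom :: "'m \<Rightarrow> 'o"
  Cod :: "'m \<Rightarrow> 'o"
  Ident :: "'o \<Rightarrow> 'm"
  Comp :: "'m \<Rightarrow> 'm \<Rightarrow> 'm"

text \<open>\<open>Comp C a b\<close> is \<open>a\<close> after \<open>b\<close>, and is only meaningful if \<open>Dom C a = Cod C b\<close>.\<close>

locale finite_category =
  fixes C :: "('o, 'm, 'z) cat_scheme"
  assumes finite_Obj: "finite (Obj C)"
    and finite_Arr: "finite (Arr C)"
    and Dom_Obj: "a \<in> Arr C \<Longrightarrow> Dom C a \<in> Obj C"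
    and Cod_Obj: "a \<in> Arr C \<Longrightarrow> Cod C a \<in> Obj C"
    and Id_Arr: "x \<in> Obj C \<Longrightarrow> Ident C x \<in> Arr C"
    and Dom_Id: "x \<in> Obj C \<Longrightarrow> Dom C (Ident C x) = x"
    and Cod_Id: "x \<in> Obj C \<Longrightarrow> Cod C (Ident C x) = x"
    and Comp_Arr: "\<lbrakk>a \<in> Arr C; b \<in> Arr C; Dom C a = Cod C b\<rbrakk> \<Longrightarrow> Comp C a b \<in> Arr C"
    and Dom_Comp: "\<lbrakk>a \<in> Arr C; b \<in> Arr C; Dom C a = Cod C b\<rbrakk> \<Longrightarrow> Dom C (Comp C a b) = Dom C b"
    and Cod_Comp: "\<lbrakk>a \<in> Arr C; b \<in> Arr C; Dom C a = Cod C b\<rbrakk> \<Longrightarrow> Cod C (Comp C a b) = Cod C a"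
    and Comp_Id_left: "a \<in> Arr C \<Longrightarrow> Comp C (Ident C (Cod C a)) a = a"
    and Comp_Id_right: "a \<in> Arr C \<Longrightarrow> Comp C a (Ident C (Dom C a)) = a"
    and Comp_assoc: "\<lbrakk>a \<in> Arr C; b \<in> Arr C; c \<in> Arr C; Dom C a = Cod C b; Dom C b = Cod C c\<rbrakk>
      \<Longrightarrow> Comp C (Comp C a b) c = Comp C a (Comp C b c)"

definition connected_category :: "('o, 'm, 'z) cat_scheme \<Rightarrow> bool" where
  "connected_category C \<longleftrightarrow> Obj C \<noteq> {} \<and>
     (let E = {(Dom C a, Cod C a) |a. a \<in> Arr C}
      in \<forall>x\<in>Obj C. \<forall>y\<in>Obj C. (x, y) \<in> (E \<union> E\<inverse>)\<^sup>*)"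

text \<open>
  The element \<open>\<Sum>a. f a \<cdot> a\<close> of the category algebra over the field \<open>'k\<close> is represented by its
  coefficient function \<open>f\<close>. On basis elements \<open>a \<otimes> b\<close> is the composite of \<open>a\<close> after \<open>b\<close> if it
  is defined and \<open>0\<close> otherwise, so that left modules correspond to covariant functors. The
  unit \<open>\<Sum>x. 1\<^sub>x\<close> exists, and the sum below is finite, since only finite categories are used.
\<close>

definition category_algebra ::
    "'k::field itself \<Rightarrow> ('o, 'm, 'z) cat_scheme \<Rightarrow> ('m \<Rightarrow> 'k) ring" where
  "category_algebra _ C =
     \<lparr>carrier = {f. \<forall>a. a \<notin> Arr C \<longrightarrow> f a = 0},
      monoid.mult = (\<lambda>f g c. \<Sum>(a, b)\<in>{(a, b). a \<in> Arr C \<and> b \<in> Arr C \<and>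
                 Dom C a = Cod C b \<and> Comp C a b = c}. f a * g b),
      monoid.one = (\<lambda>a. if a \<in> Ident C ` Obj C then 1 else 0),
      ring.zero = (\<lambda>a. 0),
      ring.add = (\<lambda>f g a. f a + g a)\<rparr>"


section \<open>The categories of a poset, of a group, and of a group acting on a poset\<close>

text \<open>The pair \<open>(x, y)\<close> with \<open>x \<le> y\<close>, that is \<open>(x, y) \<in> r\<close>, is the unique morphism \<open>x \<rightarrow> y\<close>.\<close>

definition poset_category :: "'x set \<Rightarrow> 'x rel \<Rightarrow> ('x, 'x \<times> 'x) cat" where
  "poset_category P r =
     \<lparr>Obj = P, Arr = r, Dom = fst, Cod = snd, Ident = (\<lambda>x. (x, x)),
      Comp = (\<lambda>\<alpha> \<beta>. (fst \<beta>, snd \<alpha>))\<rparr>"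

definition incidence_algebra :: "'k::field itself \<Rightarrow> 'x set \<Rightarrow> 'x rel \<Rightarrow> ('x \<times> 'x \<Rightarrow> 'k) ring" where
  "incidence_algebra K P r = category_algebra K (poset_category P r)"

definition group_category :: "('g, 's) monoid_scheme \<Rightarrow> (unit, 'g) cat" where
  "group_category G =
     \<lparr>Obj = {()}, Arr = carrier G, Dom = (\<lambda>_. ()), Cod = (\<lambda>_. ()), Ident = (\<lambda>_. \<one>\<^bsub>G\<^esub>),
      Comp = (\<lambda>g h. g \<otimes>\<^bsub>G\<^esub> h)\<rparr>"

definition group_algebra :: "'k::field itself \<Rightarrow> ('g, 's) monoid_scheme \<Rightarrow> ('g \<Rightarrow> 'k) ring" where
  "group_algebra K G = category_algebra K (group_category G)"

text \<open>
  The morphism \<open>\<alpha>g\<close> is represented by the pair \<open>(\<alpha>, g)\<close>; the group acts on a morphism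
  \<open>\<beta> = (u, v)\<close> of the poset by \<open>g(\<beta>) = (g(u), g(v))\<close>.
\<close>

definition transporter_category ::
    "('g, 's) monoid_scheme \<Rightarrow> 'x set \<Rightarrow> 'x rel \<Rightarrow> ('g \<Rightarrow> 'x \<Rightarrow> 'x) \<Rightarrow> ('x, ('x \<times> 'x) \<times> 'g) cat" where
  "transporter_category G P r \<phi> =
     \<lparr>Obj = P,
      Arr = Arr (poset_category P r) \<times> carrier G,
      Dom = (\<lambda>(\<alpha>, g). \<phi> (inv\<^bsub>G\<^esub> g) (Dom (poset_category P r) \<alpha>)),
      Cod = (\<lambda>(\<alpha>, g). Cod (poset_category P r) \<alpha>),
      Ident = (\<lambda>x. (Ident (poset_category P r) x, \<one>\<^bsub>G\<^esub>)),
      Comp = (\<lambda>(\<alpha>, g) (\<beta>, h).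
        (Comp (poset_category P r) \<alpha> (map_prod (\<phi> g) (\<phi> g) \<beta>), g \<otimes>\<^bsub>G\<^esub> h))\<rparr>"

definition poset_action ::
    "('g, 's) monoid_scheme \<Rightarrow> 'x set \<Rightarrow> 'x rel \<Rightarrow> ('g \<Rightarrow> 'x \<Rightarrow> 'x) \<Rightarrow> bool" where
  "poset_action G P r \<phi> \<longleftrightarrow> group_action G P \<phi> \<and>
     (\<forall>g\<in>carrier G. \<forall>x\<in>P. \<forall>y\<in>P. (x, y) \<in> r \<longleftrightarrow> (\<phi> g x, \<phi> g y) \<in> r)"

lemma finite_category_poset_category:
  assumes "finite P" "partial_order_on P r"
  shows "finite_category (poset_category P r)"
proof -
  note r = partial_order_onD[OF assms(2)]
  have "finite r" using r(4) assms(1) finite_subset by blast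
  then show ?thesis
    using assms(1) r
    by unfold_locales (auto simp: poset_category_def refl_on_def dest: transD)
qed

lemma finite_category_group_category:
  assumes "group G" "finite (carrier G)"
  shows "finite_category (group_category G)"
proof -
  interpret group G by fact
  show ?thesis
    using assms(2) by unfold_locales (auto simp: group_category_def m_assoc)
qed

lemma finite_category_transporter_category:
  assumes act: "poset_action G P r \<phi>" and po: "partial_order_on P r"
    and fin: "finite P" "finite (carrier G)"
  shows "finite_category (transporter_category G P r \<phi>)"
proof -
  from act interpret A: group_action G P \<phi> by (simp add: poset_action_def)
  interpret G: group G using A.group_hom by (simp add: group_hom_def)
  have mono: "\<And>g x y. \<lbrakk>g \<in> carrier G; (x, y) \<in> r\<rbrakk> \<Longrightarrow> (\<phi> g x, \<phi> g y) \<in> r"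
    using act partial_order_onD(4)[OF po] unfolding poset_action_def by blast
  note r = partial_order_onD[OF po]
  have P: "x \<in> P \<and> y \<in> P" if "(x, y) \<in> r" for x y using r(4) that by blast
  have rfin: "finite r" using r(4) fin(1) finite_subset by blast
  have mem: "\<phi> g x \<in> P" if "g \<in> carrier G" "x \<in> P" for g x
    using that A.element_image by blast
  have one: "\<phi> \<one>\<^bsub>G\<^esub> x = x" if "x \<in> P" for x
    using that A.id_eq_one by (metis restrict_apply')
  have comp: "\<phi> (g \<otimes>\<^bsub>G\<^esub> h) x = \<phi> g (\<phi> h x)" if "g \<in> carrier G" "h \<in> carrier G" "x \<in> P" for g h x
    using that A.composition_rule by blast
  have inv1: "\<phi> (inv\<^bsub>G\<^esub> g) (\<phi> g x) = x" and inv2: "\<phi> g (\<phi> (inv\<^bsub>G\<^esub> g) x) = x"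
    if "g \<in> carrier G" "x \<in> P" for g x
    using that comp[of "inv\<^bsub>G\<^esub> g" g x] comp[of g "inv\<^bsub>G\<^esub> g" x] one[of x] by auto
  have inv3: "\<phi> (inv\<^bsub>G\<^esub> (g \<otimes>\<^bsub>G\<^esub> h)) (\<phi> g x) = \<phi> (inv\<^bsub>G\<^esub> h) x"
    if "g \<in> carrier G" "h \<in> carrier G" "x \<in> P" for g h x
    using that by (metis G.inv_mult_group G.inv_closed comp mem inv1)
  have glue: "(\<phi> g u, y) \<in> r"
    if "g \<in> carrier G" "(u, \<phi> (inv\<^bsub>G\<^esub> g) x) \<in> r" "(x, y) \<in> r" for g u x y
    using mono[OF that(1,2)] inv2[of g x] that P r(2) by (metis transD)
  show ?thesis
    by unfold_locales
       (use fin rfin P r(1) in \<open>auto simp: transporter_category_def poset_category_def refl_on_def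
          mem one comp inv1 inv2 inv3 glue G.m_assoc\<close>)
qed

lemma (in finite_category) ring_category_algebra:
  "ring (category_algebra TYPE('k::field) C)"
proof -
  let ?A = "category_algebra TYPE('k) C"
  let ?S = "\<lambda>c. {(a, b). a \<in> Arr C \<and> b \<in> Arr C \<and> Dom C a = Cod C b \<and> Comp C a b = c}"
  have fS: "finite (?S c)" for c
    by (rule finite_subset[of _ "Arr C \<times> Arr C"]) (auto simp: finite_Arr)
  have mult: "(f \<otimes>\<^bsub>?A\<^esub> g) c = (\<Sum>(a, b)\<in>?S c. f a * g b)" for f g c
    by (simp add: category_algebra_def)
  show ?thesis
  proof (rule ringI)
    show "abelian_group ?A"
    proof (rule abelian_groupI)
      show "\<exists>y\<in>carrier ?A. y \<oplus>\<^bsub>?A\<^esub> x = \<zero>\<^bsub>?A\<^esub>" if "x \<in> carrier ?A" for x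
        using that by (intro bexI[of _ "\<lambda>a. - x a"]) (auto simp: category_algebra_def)
    qed (auto simp: category_algebra_def algebra_simps)
    have assoc: "((f \<otimes>\<^bsub>?A\<^esub> g) \<otimes>\<^bsub>?A\<^esub> h) d = (f \<otimes>\<^bsub>?A\<^esub> (g \<otimes>\<^bsub>?A\<^esub> h)) d" for f g h d
    proof -
      have "((f \<otimes>\<^bsub>?A\<^esub> g) \<otimes>\<^bsub>?A\<^esub> h) d
          = (\<Sum>p\<in>?S d. \<Sum>q\<in>?S (fst p). f (fst q) * g (snd q) * h (snd p))"
        unfolding mult by (simp add: case_prod_beta sum_distrib_right)
      also have "\<dots> = (\<Sum>(p, q)\<in>(SIGMA p:?S d. ?S (fst p)). f (fst q) * g (snd q) * h (snd p))"
        by (rule sum.Sigma) (auto intro: fS)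
      also have "\<dots> = (\<Sum>(p, q)\<in>(SIGMA p:?S d. ?S (snd p)). f (fst p) * g (fst q) * h (snd q))"
        by (rule sum.reindex_bij_witness
              [of _ "\<lambda>((a, bc), (b, c)). ((Comp C a b, c), (a, b))"
                    "\<lambda>((ab, c), (a, b)). ((a, Comp C b c), (b, c))"])
           (auto simp: Comp_Arr Dom_Comp Cod_Comp Comp_assoc)
      also have "\<dots> = (\<Sum>p\<in>?S d. \<Sum>q\<in>?S (snd p). f (fst p) * g (fst q) * h (snd q))"
        by (rule sum.Sigma[symmetric]) (auto intro: fS)
      also have "\<dots> = (f \<otimes>\<^bsub>?A\<^esub> (g \<otimes>\<^bsub>?A\<^esub> h)) d"
        unfolding mult by (simp add: case_prod_beta sum_distrib_left mult.assoc)
      finally show ?thesis .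
    qed
    have closed: "f \<otimes>\<^bsub>?A\<^esub> g \<in> carrier ?A" for f g
    proof -
      have "(f \<otimes>\<^bsub>?A\<^esub> g) c = 0" if "c \<notin> Arr C" for c
      proof -
        have S: "?S c = {}" using that Comp_Arr by auto
        show ?thesis unfolding mult S by simp
      qed
      then show ?thesis by (auto simp: category_algebra_def)
    qed
    have Id_mem: "a \<in> Arr C \<and> (\<exists>x\<in>Obj C. a = Ident C x \<and> Dom C a = x \<and> Cod C a = x)"
      if "a \<in> Ident C ` Obj C" for a
      using that Id_Arr Dom_Id Cod_Id by auto
    have one0: "\<one>\<^bsub>?A\<^esub> a = 0" if "a \<notin> Ident C ` Obj C" for a
      using that by (simp add: category_algebra_def)
    have idl: "a = Ident C (Cod C b) \<and> Comp C a b = b"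
      if "a \<in> Ident C ` Obj C" "b \<in> Arr C" "Dom C a = Cod C b" for a b
      using Id_mem[OF that(1)] that Comp_Id_left by metis
    have idr: "b = Ident C (Dom C a) \<and> Comp C a b = a"
      if "b \<in> Ident C ` Obj C" "a \<in> Arr C" "Dom C a = Cod C b" for a b
      using Id_mem[OF that(1)] that Comp_Id_right by metis
    have left: "(\<one>\<^bsub>?A\<^esub> \<otimes>\<^bsub>?A\<^esub> f) c = f c" if f: "f \<in> carrier ?A" for f c
    proof (cases "c \<in> Arr C")
      case True
      have "(\<Sum>(a, b)\<in>?S c. \<one>\<^bsub>?A\<^esub> a * f b) = (\<Sum>(a, b)\<in>{(Ident C (Cod C c), c)}. \<one>\<^bsub>?A\<^esub> a * f b)"
      proof (rule sum.mono_neutral_right[OF fS])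
        show "{(Ident C (Cod C c), c)} \<subseteq> ?S c"
          using True by (auto simp: Id_Arr Cod_Obj Dom_Id Comp_Id_left)
        show "\<forall>p\<in>?S c - {(Ident C (Cod C c), c)}. (case p of (a, b) \<Rightarrow> \<one>\<^bsub>?A\<^esub> a * f b) = 0"
          using idl one0 by (auto; metis)
      qed
      then show ?thesis
        using True Cod_Obj unfolding mult by (simp add: category_algebra_def)
    next
      case False
      then show ?thesis using closed[of "\<one>\<^bsub>?A\<^esub>" f] f by (simp add: category_algebra_def)
    qed
    have right: "(f \<otimes>\<^bsub>?A\<^esub> \<one>\<^bsub>?A\<^esub>) c = f c" if f: "f \<in> carrier ?A" for f c
    proof (cases "c \<in> Arr C")
      case True
      have "(\<Sum>(a, b)\<in>?S c. f a * \<one>\<^bsub>?A\<^esub> b) = (\<Sum>(a, b)\<in>{(c, Ident C (Dom C c))}. f a * \<one>\<^bsub>?A\<^esub> b)"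
      proof (rule sum.mono_neutral_right[OF fS])
        show "{(c, Ident C (Dom C c))} \<subseteq> ?S c"
          using True by (auto simp: Id_Arr Dom_Obj Cod_Id Comp_Id_right)
        show "\<forall>p\<in>?S c - {(c, Ident C (Dom C c))}. (case p of (a, b) \<Rightarrow> f a * \<one>\<^bsub>?A\<^esub> b) = 0"
          using idr one0 by (auto; metis)
      qed
      then show ?thesis
        using True Dom_Obj unfolding mult by (simp add: category_algebra_def)
    next
      case False
      then show ?thesis using closed[of f "\<one>\<^bsub>?A\<^esub>"] f by (simp add: category_algebra_def)
    qed
    have "\<one>\<^bsub>?A\<^esub> \<in> carrier ?A"
      using Id_Arr by (auto simp: category_algebra_def)
    then show "Group.monoid ?A"
      by (intro monoidI closed ext assoc left right)
    show "(x \<oplus>\<^bsub>?A\<^esub> y) \<otimes>\<^bsub>?A\<^esub> z = x \<otimes>\<^bsub>?A\<^esub> z \<oplus>\<^bsub>?A\<^esub> y \<otimes>\<^bsub>?A\<^esub> z" for x y z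
      by (rule ext) (simp add: category_algebra_def case_prod_beta distrib_right sum.distrib)
    show "z \<otimes>\<^bsub>?A\<^esub> (x \<oplus>\<^bsub>?A\<^esub> y) = z \<otimes>\<^bsub>?A\<^esub> x \<oplus>\<^bsub>?A\<^esub> z \<otimes>\<^bsub>?A\<^esub> y" for x y z
      by (rule ext) (simp add: category_algebra_def case_prod_beta distrib_left sum.distrib)
  qed
qed

end

theory Submission
  imports Defs "HOL-Library.Function_Algebras"
begin

text \<open>
  Why the theorem is true. Let \<open>T\<close> be the transporter category and call a category of
  finite type if it has finitely many indecomposable finite-dimensional representations up to
  isomorphism. Representations of a finite category are the same as finitely generated modules
  over its category algebra (\<open>fin_type_if_finite_representation_type\<close>,
  \<open>finite_representation_type_if_fin_type\<close>), so the theorem is about representations.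

  Sufficiency. If the order of \<open>G\<close> is invertible, averaging over \<open>G\<close> makes every representation
  of \<open>T\<close> a direct summand of the one coinduced from its own restriction to the poset
  (\<open>maschke\<close>). By Krull and Schmidt each indecomposable of \<open>T\<close> is then a summand of one of
  the finitely many representations coinduced from indecomposables of the poset
  (\<open>fin_type_transporter\<close>). If the poset is a point, \<open>T\<close> is the group \<open>G\<close>
  (\<open>fin_type_group_iff\<close>).

  Necessity. For every subgroup \<open>H\<close>, a representation of the subcategory of all \<open>\<alpha>h\<close> with \<open>h \<in> H\<close>
  is a direct summand of the restriction of its coinduced representation. Hence finite type
  passes from \<open>T\<close> to this subcategory (\<open>fin_type_subgroup\<close>), in particular to the poset, which is
  the case of the trivial subgroup. It remains to see that \<open>T\<close> is of infinite type if the
  poset has at least two elements and the characteristic \<open>p\<close> divides the order of \<open>G\<close>. Then \<open>p \<ge> 5\<close>,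
  and some \<open>g \<in> G\<close> has order \<open>p\<close>. There are three cases (\<open>infinite_type_modular\<close>).

  \<^item> \<open>g\<close> fixes \<open>x\<close> and moves a neighbour \<open>z\<close> of \<open>x\<close> in the Hasse diagram. The orbit of \<open>z\<close> consists
  of \<open>p\<close> neighbours of \<open>x\<close>, all above or all below \<open>x\<close>. Four of them carry the problem of four
  lines in a plane, whose cross-ratio is a parameter (\<open>infinite_type_star\<close>).

  \<^item> \<open>g\<close> fixes \<open>x\<close> and a neighbour \<open>z\<close> of \<open>x\<close>. With \<open>t = g - 1\<close> one needs infinitely many
  homomorphisms between two modules over \<open>k[t]/(t\<^sup>p)\<close>, up to automorphisms of both; such a
  family exists as soon as \<open>p \<ge> 4\<close> (\<open>infinite_type_pair\<close>).

  \<^item> \<open>g\<close> has no fixed point. In the graph formed by the minimal and the maximal elements with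
  their comparabilities, \<open>p\<close> divides the number of vertices and the number of edges. These
  numbers therefore do not differ by one, so the connected graph is not a tree, and the weight
  of an edge outside a spanning tree is a parameter (\<open>infinite_type_free\<close>).

  The members of each family live on one fixed space and are pairwise non-isomorphic, while
  finite type leaves only finitely many isomorphism classes of representations on that space,
  decomposable ones included (\<open>fin_type_family\<close>).
\<close>

section \<open>Operators on function spaces\<close>

text \<open>
  Vector spaces are realised as subspaces of spaces of functions \<open>'i \<Rightarrow> 'k\<close>, and finite dimension
  as finite support. Summands of a representation are then subsets with the same
  operators, and statements can quantify over all representations inside one type.
\<close>

definition fscale :: "'k::field \<Rightarrow> ('i \<Rightarrow> 'k) \<Rightarrow> 'i \<Rightarrow> 'k" where
  "fscale c v = (\<lambda>i. c * v i)"

lemma fscale_apply: "fscale c v i = c * v i"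
  by (simp add: fscale_def)

interpretation fs: vector_space fscale
  by unfold_locales (auto simp: fscale_def algebra_simps fun_eq_iff)

lemma sum_fun_apply: "(\<Sum>x\<in>A. f x) i = (\<Sum>x\<in>A. f x i)"
  by (induction A rule: infinite_finite_induct) auto

definition fin_support :: "('i \<Rightarrow> 'k::field) set \<Rightarrow> bool" where
  "fin_support V \<longleftrightarrow> (\<exists>I. finite I \<and> (\<forall>v\<in>V. \<forall>i. i \<notin> I \<longrightarrow> v i = 0))"

lemma fin_support_mono: "fin_support V \<Longrightarrow> U \<subseteq> V \<Longrightarrow> fin_support U"
  unfolding fin_support_def by blast

lemma supported_subset_span:
  fixes V :: "('i \<Rightarrow> 'k::field) set"
  assumes "finite I" "\<forall>v\<in>V. \<forall>i. i \<notin> I \<longrightarrow> v i = 0"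
  shows "V \<subseteq> fs.span ((\<lambda>i j. if j = i then 1 else 0) ` I)"
proof
  fix v assume "v \<in> V"
  have "v = (\<Sum>i\<in>I. fscale (v i) (\<lambda>j. if j = i then 1 else 0))"
  proof
    fix j
    show "v j = (\<Sum>i\<in>I. fscale (v i) (\<lambda>j. if j = i then 1 else 0)) j"
      using assms \<open>v \<in> V\<close> by (cases "j \<in> I") (auto simp: sum_fun_apply fscale_apply if_distrib cong: if_cong)
  qed
  also have "\<dots> \<in> fs.span ((\<lambda>i j. if j = i then 1 else 0) ` I)"
    by (intro fs.span_sum fs.span_scale fs.span_base) auto
  finally show "v \<in> fs.span ((\<lambda>i j. if j = i then 1 else 0) ` I)" .
qed

lemma fin_support_span: "fin_support V \<Longrightarrow> \<exists>T. finite T \<and> V \<subseteq> fs.span T"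
  unfolding fin_support_def using supported_subset_span by blast

lemma dim_less:
  assumes U: "fs.subspace U" and V: "fin_support V" and UV: "U \<subset> V"
  shows "fs.dim U < fs.dim V"
proof -
  obtain T where T: "finite T" "V \<subseteq> fs.span T" using fin_support_span[OF V] by blast
  obtain B where B: "B \<subseteq> U" "fs.independent B" "U \<subseteq> fs.span B" "card B = fs.dim U"
    using fs.basis_exists by blast
  have fin: "finite C \<and> card C \<le> card T" if "fs.independent C" "C \<subseteq> V" for C
    using fs.independent_span_bound[OF T(1) that(1)] that(2) T(2) by blast
  obtain v where v: "v \<in> V" "v \<notin> U" using UV by blast
  have sB: "fs.span B \<subseteq> U" using B(1) U by (rule fs.span_minimal)
  have ind: "fs.independent (insert v B)"
    using B(2) v(2) sB by (intro fs.independent_insertI) auto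
  have sub: "insert v B \<subseteq> V" using v B(1) UV by auto
  obtain C where C: "insert v B \<subseteq> C" "C \<subseteq> V" "fs.independent C" "V \<subseteq> fs.span C"
    using fs.maximal_independent_subset_extend[OF sub ind] by blast
  have "card (insert v B) \<le> card C" using C(1) fin[OF C(3,2)] by (simp add: card_mono)
  moreover have "card (insert v B) = Suc (card B)"
    using v sB fs.span_base fin[of B] B UV by (subst card_insert_disjoint) (auto dest: fs.span_base)
  moreover have "card C = fs.dim V" using C by (intro fs.basis_card_eq_dim) auto
  ultimately show ?thesis using B(4) by simp
qed

lemma dim_mono: "fs.subspace U \<Longrightarrow> fin_support V \<Longrightarrow> U \<subseteq> V \<Longrightarrow> fs.dim U \<le> fs.dim V"
  by (metis dim_less less_imp_le psubsetI order_refl)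

lemma subspace_eqI: "fs.subspace U \<Longrightarrow> fin_support V \<Longrightarrow> U \<subseteq> V \<Longrightarrow> fs.dim V \<le> fs.dim U \<Longrightarrow> U = V"
  by (metis dim_less not_le psubsetI)


definition lin_on :: "('i \<Rightarrow> 'k::field) set \<Rightarrow> (('i \<Rightarrow> 'k) \<Rightarrow> ('j \<Rightarrow> 'k)) \<Rightarrow> bool" where
  "lin_on V f \<longleftrightarrow> (\<forall>u\<in>V. \<forall>v\<in>V. f (u + v) = f u + f v) \<and> (\<forall>c. \<forall>v\<in>V. f (fscale c v) = fscale c (f v))"

text \<open>
  A family of operators indexed by \<open>A\<close>, without relations between them: the relations of a
  category pass to invariant subspaces, so decompositions can be studied without them.
\<close>

definition op_rep :: "'a set \<Rightarrow> ('i \<Rightarrow> 'k::field) set \<Rightarrow> ('a \<Rightarrow> ('i \<Rightarrow> 'k) \<Rightarrow> ('i \<Rightarrow> 'k)) \<Rightarrow> bool" where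
  "op_rep A V \<rho> \<longleftrightarrow> fs.subspace V \<and> (\<forall>a\<in>A. \<rho> a ` V \<subseteq> V \<and> lin_on V (\<rho> a))"

definition op_hom :: "'a set \<Rightarrow> ('i \<Rightarrow> 'k::field) set \<Rightarrow> ('a \<Rightarrow> ('i \<Rightarrow> 'k) \<Rightarrow> ('i \<Rightarrow> 'k)) \<Rightarrow>
    ('j \<Rightarrow> 'k) set \<Rightarrow> ('a \<Rightarrow> ('j \<Rightarrow> 'k) \<Rightarrow> ('j \<Rightarrow> 'k)) \<Rightarrow> (('i \<Rightarrow> 'k) \<Rightarrow> ('j \<Rightarrow> 'k)) \<Rightarrow> bool" where
  "op_hom A V \<rho> W \<sigma> f \<longleftrightarrow> lin_on V f \<and> f ` V \<subseteq> W \<and> (\<forall>a\<in>A. \<forall>v\<in>V. f (\<rho> a v) = \<sigma> a (f v))"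

definition op_iso :: "'a set \<Rightarrow> ('i \<Rightarrow> 'k::field) set \<Rightarrow> ('a \<Rightarrow> ('i \<Rightarrow> 'k) \<Rightarrow> ('i \<Rightarrow> 'k)) \<Rightarrow>
    ('j \<Rightarrow> 'k) set \<Rightarrow> ('a \<Rightarrow> ('j \<Rightarrow> 'k) \<Rightarrow> ('j \<Rightarrow> 'k)) \<Rightarrow> bool" where
  "op_iso A V \<rho> W \<sigma> \<longleftrightarrow> (\<exists>f. op_hom A V \<rho> W \<sigma> f \<and> bij_betw f V W)"

text \<open>
  Being isomorphic to a direct summand, expressed by maps; in this form the notion composes
  and is preserved by functors such as coinduction.
\<close>

definition retract :: "'a set \<Rightarrow> ('i \<Rightarrow> 'k::field) set \<Rightarrow> ('a \<Rightarrow> ('i \<Rightarrow> 'k) \<Rightarrow> ('i \<Rightarrow> 'k)) \<Rightarrow>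
    ('j \<Rightarrow> 'k) set \<Rightarrow> ('a \<Rightarrow> ('j \<Rightarrow> 'k) \<Rightarrow> ('j \<Rightarrow> 'k)) \<Rightarrow> bool" where
  "retract A M \<mu> V \<rho> \<longleftrightarrow> (\<exists>f g. op_hom A M \<mu> V \<rho> f \<and> op_hom A V \<rho> M \<mu> g \<and> (\<forall>x\<in>M. g (f x) = x))"

definition indec :: "'a set \<Rightarrow> ('i \<Rightarrow> 'k::field) set \<Rightarrow> ('a \<Rightarrow> ('i \<Rightarrow> 'k) \<Rightarrow> ('i \<Rightarrow> 'k)) \<Rightarrow> bool" where
  "indec A V \<rho> \<longleftrightarrow> V \<noteq> {0} \<and> (\<forall>U W. op_rep A U \<rho> \<and> op_rep A W \<rho> \<and> U \<subseteq> V \<and> W \<subseteq> V \<and> U \<inter> W = {0} \<and>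
     (\<forall>v\<in>V. \<exists>u\<in>U. \<exists>w\<in>W. v = u + w) \<longrightarrow> U = {0} \<or> W = {0})"

lemma lin_onD:
  assumes "lin_on V f"
  shows "u \<in> V \<Longrightarrow> v \<in> V \<Longrightarrow> f (u + v) = f u + f v" "v \<in> V \<Longrightarrow> f (fscale c v) = fscale c (f v)"
  using assms by (auto simp: lin_on_def)

lemma lin_on_zero: "lin_on V f \<Longrightarrow> fs.subspace V \<Longrightarrow> f 0 = 0"
  using lin_onD(2)[of V f 0 0] by (auto simp: fs.subspace_0)

lemma lin_on_diff:
  assumes "lin_on V f" "fs.subspace V" "u \<in> V" "v \<in> V"
  shows "f (u - v) = f u - f v"
proof -
  have "f u = f ((u - v) + v)" by simp
  also have "\<dots> = f (u - v) + f v"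
    by (rule lin_onD(1)[OF assms(1)]) (use assms in \<open>auto intro: fs.subspace_diff\<close>)
  finally show ?thesis by simp
qed

lemma lin_on_sum:
  assumes "lin_on V f" "fs.subspace V" "\<And>j. j \<in> J \<Longrightarrow> g j \<in> V"
  shows "f (\<Sum>j\<in>J. g j) = (\<Sum>j\<in>J. f (g j))"
  using assms(3)
proof (induction J rule: infinite_finite_induct)
  case (insert x F)
  have "f (g x + sum g F) = f (g x) + f (sum g F)"
    using insert by (intro lin_onD(1)[OF assms(1)] fs.subspace_sum assms(2)) auto
  moreover have "f (sum g F) = (\<Sum>j\<in>F. f (g j))"
    using insert by blast
  ultimately show ?case
    unfolding sum.insert[OF insert(1,2)] by metis
qed (use lin_on_zero[OF assms(1,2)] in auto)

lemma lin_on_subset: "lin_on V f \<Longrightarrow> U \<subseteq> V \<Longrightarrow> lin_on U f"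
  unfolding lin_on_def by blast

lemma op_repD:
  assumes "op_rep A V \<rho>"
  shows "fs.subspace V" "a \<in> A \<Longrightarrow> v \<in> V \<Longrightarrow> \<rho> a v \<in> V" "a \<in> A \<Longrightarrow> lin_on V (\<rho> a)"
  using assms by (auto simp: op_rep_def)

lemma op_homD:
  assumes "op_hom A V \<rho> W \<sigma> f"
  shows "lin_on V f" "v \<in> V \<Longrightarrow> f v \<in> W" "a \<in> A \<Longrightarrow> v \<in> V \<Longrightarrow> f (\<rho> a v) = \<sigma> a (f v)"
  using assms by (auto simp: op_hom_def)

lemma op_hom_id: "op_hom A V \<rho> V \<rho> (\<lambda>x. x)"
  by (auto simp: op_hom_def lin_on_def)

lemma op_hom_comp: "op_hom A V \<rho> W \<sigma> f \<Longrightarrow> op_hom A W \<sigma> Y \<tau> g \<Longrightarrow> op_hom A V \<rho> Y \<tau> (\<lambda>x. g (f x))"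
  by (auto simp: op_hom_def lin_on_def image_subset_iff)

lemma op_hom_subset: "op_hom A V \<rho> W \<sigma> f \<Longrightarrow> U \<subseteq> V \<Longrightarrow> W \<subseteq> W' \<Longrightarrow> op_hom A U \<rho> W' \<sigma> f"
  unfolding op_hom_def using lin_on_subset by blast

lemma op_hom_sub_arrows: "op_hom A V \<rho> W \<sigma> f \<Longrightarrow> B \<subseteq> A \<Longrightarrow> op_hom B V \<rho> W \<sigma> f"
  by (auto simp: op_hom_def)

lemma op_hom_funpow: "op_hom A V \<rho> V \<rho> f \<Longrightarrow> op_hom A V \<rho> V \<rho> (f ^^ n)"
proof (induction n)
  case 0
  then show ?case by (simp add: id_def op_hom_id)
next
  case (Suc n)
  then show ?case using op_hom_comp[of A V \<rho> V \<rho> "f ^^ n" V \<rho> f] by (simp add: o_def)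
qed

lemma op_hom_add:
  assumes "op_hom A V \<rho> W \<sigma> f" "op_hom A V \<rho> W \<sigma> g" "op_rep A W \<sigma>"
  shows "op_hom A V \<rho> W \<sigma> (\<lambda>x. f x + g x)"
  using assms op_repD[OF assms(3)]
  by (auto simp: op_hom_def lin_on_def image_subset_iff fs.subspace_add fs.scale_right_distrib algebra_simps)

lemma op_hom_const_zero:
  assumes "op_rep A W \<sigma>" shows "op_hom A V \<rho> W \<sigma> (\<lambda>x. 0)"
  using op_repD(1)[OF assms] lin_on_zero[OF op_repD(3)[OF assms] op_repD(1)[OF assms]]
  by (auto simp: op_hom_def lin_on_def fs.subspace_0)

lemma op_hom_sum:
  assumes "op_rep A W \<sigma>" "\<And>j. j \<in> J \<Longrightarrow> op_hom A V \<rho> W \<sigma> (f j)"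
  shows "op_hom A V \<rho> W \<sigma> (\<lambda>x. \<Sum>j\<in>J. f j x)"
  using assms(2)
  by (induction J rule: infinite_finite_induct) (auto simp: op_hom_const_zero[OF assms(1)] intro!: op_hom_add assms(1))

lemma op_hom_inv:
  assumes "op_hom A V \<rho> W \<sigma> f" "bij_betw f V W" "op_rep A V \<rho>"
  shows "op_hom A W \<sigma> V \<rho> (inv_into V f)"
proof -
  have *: "f (inv_into V f w) = w" "inv_into V f w \<in> V" if "w \<in> W" for w
    using assms(2) that by (auto simp: bij_betw_inv_into_right bij_betw_imp_surj_on inv_into_into)
  have **: "inv_into V f w = v" if "v \<in> V" "f v = w" for v w
    using assms(2) that by (auto simp: bij_betw_inv_into_left)
  show ?thesis
    unfolding op_hom_def lin_on_def
    using op_homD[OF assms(1)] op_repD[OF assms(3)] *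
    by (auto intro!: ** simp: lin_onD[OF op_homD(1)[OF assms(1)]] fs.subspace_add fs.subspace_scale)
qed

lemma op_iso_sym: "op_iso A V \<rho> W \<sigma> \<Longrightarrow> op_rep A V \<rho> \<Longrightarrow> op_iso A W \<sigma> V \<rho>"
  unfolding op_iso_def using op_hom_inv bij_betw_inv_into by blast

lemma op_iso_trans: "op_iso A V \<rho> W \<sigma> \<Longrightarrow> op_iso A W \<sigma> Y \<tau> \<Longrightarrow> op_iso A V \<rho> Y \<tau>"
  unfolding op_iso_def using op_hom_comp bij_betw_trans by (metis (no_types, lifting) bij_betw_cong comp_apply)

lemma retract_trans: "retract A M \<mu> V \<rho> \<Longrightarrow> retract A V \<rho> W \<sigma> \<Longrightarrow> retract A M \<mu> W \<sigma>"
proof -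
  assume "retract A M \<mu> V \<rho>" "retract A V \<rho> W \<sigma>"
  then obtain f g f' g' where
    "op_hom A M \<mu> V \<rho> f" "op_hom A V \<rho> M \<mu> g" "\<forall>x\<in>M. g (f x) = x"
    "op_hom A V \<rho> W \<sigma> f'" "op_hom A W \<sigma> V \<rho> g'" "\<forall>x\<in>V. g' (f' x) = x"
    unfolding retract_def by blast
  then have "op_hom A M \<mu> W \<sigma> (\<lambda>x. f' (f x)) \<and> op_hom A W \<sigma> M \<mu> (\<lambda>x. g (g' x)) \<and> (\<forall>x\<in>M. g (g' (f' (f x))) = x)"
    by (auto intro: op_hom_comp dest: op_homD(2))
  then show ?thesis unfolding retract_def by blast
qed

lemma op_iso_retr: "op_iso A M \<mu> V \<rho> \<Longrightarrow> op_rep A M \<mu> \<Longrightarrow> retract A M \<mu> V \<rho>"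
  unfolding op_iso_def retract_def using op_hom_inv by (metis bij_betw_inv_into_left)

lemma op_rep_image:
  assumes "op_hom A V \<rho> W \<sigma> f" "op_rep A V \<rho>" "op_rep A W \<sigma>"
  shows "op_rep A (f ` V) \<sigma>"
proof -
  note f = op_homD[OF assms(1)] and V = op_repD[OF assms(2)] and W = op_repD[OF assms(3)]
  have "fs.subspace (f ` V)"
  proof (rule fs.subspaceI)
    show "0 \<in> f ` V" using lin_on_zero[OF f(1) V(1)] fs.subspace_0[OF V(1)] by force
    show "x + y \<in> f ` V" if "x \<in> f ` V" "y \<in> f ` V" for x y
    proof -
      from that obtain u v where "u \<in> V" "v \<in> V" "x = f u" "y = f v" by blast
      then show ?thesis using lin_onD(1)[OF f(1)] fs.subspace_add[OF V(1)] by (metis imageI)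
    qed
    show "fscale c x \<in> f ` V" if "x \<in> f ` V" for x c
    proof -
      from that obtain u where "u \<in> V" "x = f u" by blast
      then show ?thesis using lin_onD(2)[OF f(1)] fs.subspace_scale[OF V(1)] by (metis imageI)
    qed
  qed
  moreover have "\<sigma> a ` f ` V \<subseteq> f ` V" if "a \<in> A" for a
    using f(3)[OF that] V(2)[OF that] by (auto simp flip: f(3)[OF that])
  ultimately show ?thesis
    using W(3) f(2) unfolding op_rep_def by (blast intro: lin_on_subset[where V = W])
qed

lemma op_rep_kernel:
  assumes "op_hom A V \<rho> W \<sigma> f" "op_rep A V \<rho>" "op_rep A W \<sigma>"
  shows "op_rep A {v \<in> V. f v = 0} \<rho>"
proof -
  note f = op_homD[OF assms(1)] and V = op_repD[OF assms(2)] and W = op_repD[OF assms(3)]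
  have "fs.subspace {v \<in> V. f v = 0}"
    by (rule fs.subspaceI)
      (use V(1) lin_on_zero[OF f(1) V(1)] lin_onD[OF f(1)] in
        \<open>auto simp: fs.subspace_add fs.subspace_scale fs.subspace_0\<close>)
  moreover have "\<rho> a ` {v \<in> V. f v = 0} \<subseteq> {v \<in> V. f v = 0}" if "a \<in> A" for a
    using f(3)[OF that] V(2)[OF that] lin_on_zero[OF W(3)[OF that] W(1)] by auto
  ultimately show ?thesis
    using V(3) unfolding op_rep_def by (blast intro: lin_on_subset[where V = V])
qed

lemma indecD:
  assumes "indec A V \<rho>" "op_rep A U \<rho>" "op_rep A W \<rho>" "U \<subseteq> V" "W \<subseteq> V" "U \<inter> W = {0}"
    and "\<And>v. v \<in> V \<Longrightarrow> \<exists>u\<in>U. \<exists>w\<in>W. v = u + w"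
  shows "U = {0} \<or> W = {0}"
proof -
  note assms(1)[unfolded indec_def, THEN conjunct2, THEN spec, THEN spec, of U W]
  then show ?thesis
    by (rule mp) (intro conjI ballI assms(2-))
qed

lemma not_indecE:
  assumes "\<not> indec A V \<rho>" "V \<noteq> {0}"
  obtains U W where "op_rep A U \<rho>" "op_rep A W \<rho>" "U \<subseteq> V" "W \<subseteq> V" "U \<inter> W = {0}"
    "\<And>v. v \<in> V \<Longrightarrow> \<exists>u\<in>U. \<exists>w\<in>W. v = u + w" "U \<noteq> {0}" "W \<noteq> {0}"
proof -
  from assms have "\<exists>U W. (op_rep A U \<rho> \<and> op_rep A W \<rho> \<and> U \<subseteq> V \<and> W \<subseteq> V \<and> U \<inter> W = {0} \<and>
      (\<forall>v\<in>V. \<exists>u\<in>U. \<exists>w\<in>W. v = u + w)) \<and> U \<noteq> {0} \<and> W \<noteq> {0}"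
    unfolding indec_def by (simp only: not_all de_Morgan_conj de_Morgan_disj not_imp simp_thms)
  then show ?thesis
    by (elim exE conjE) (rule that, assumption+, erule bspec)
qed

lemma op_hom_inj_onI:
  assumes "op_hom A V \<rho> W \<sigma> f" "op_rep A V \<rho>" "\<And>v. v \<in> V \<Longrightarrow> f v = 0 \<Longrightarrow> v = 0"
  shows "inj_on f V"
proof (rule inj_onI)
  fix x y assume xy: "x \<in> V" "y \<in> V" "f x = f y"
  have "f (x - y) = 0"
    using lin_on_diff[OF op_homD(1)[OF assms(1)] op_repD(1)[OF assms(2)] xy(1,2)] xy(3) by simp
  then show "x = y"
    using assms(3)[of "x - y"] fs.subspace_diff[OF op_repD(1)[OF assms(2)] xy(1,2)] by simp
qed

section \<open>Krull-Schmidt decompositions\<close>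

text \<open>
  Fitting's lemma: images and kernels of the powers of \<open>f\<close> stabilise at some \<open>n\<close>, and from there
  on the space is the direct sum of the image and the kernel of \<open>f ^^ n\<close>. An indecomposable
  space allows only one of them to be nonzero.
\<close>

lemma fitting:
  assumes V: "op_rep A V \<rho>" "fin_support V" "indec A V \<rho>" and f: "op_hom A V \<rho> V \<rho> f"
  shows "bij_betw f V V \<or> (\<exists>n. \<forall>v\<in>V. (f ^^ n) v = 0)"
proof -
  define I where "I n = (f ^^ n) ` V" for n
  define K where "K n = {v \<in> V. (f ^^ n) v = 0}" for n
  note hom = op_hom_funpow[OF f]
  have I: "op_rep A (I n) \<rho>" and K: "op_rep A (K n) \<rho>" for n
    unfolding I_def K_def using op_rep_image[OF hom V(1,1)] op_rep_kernel[OF hom V(1,1)] by auto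
  have mem: "(f ^^ n) v \<in> V" if "v \<in> V" for n v using op_homD(2)[OF hom that] .
  have zero: "(f ^^ n) 0 = 0" for n using lin_on_zero[OF op_homD(1)[OF hom] op_repD(1)[OF V(1)]] .
  have IV: "I n \<subseteq> V" for n using mem by (auto simp: I_def)
  have KV: "K n \<subseteq> V" for n by (auto simp: K_def)
  have Imono: "I n \<subseteq> I m" if "m \<le> n" for m n
  proof
    fix w assume "w \<in> I n"
    then obtain v where v: "v \<in> V" "w = (f ^^ n) v" by (auto simp: I_def)
    moreover have "(f ^^ n) v = (f ^^ (m + (n - m))) v" using that by simp
    ultimately have "w = (f ^^ m) ((f ^^ (n - m)) v)" by (simp only: funpow_add o_apply)
    then show "w \<in> I m" using mem[OF v(1)] by (auto simp: I_def)
  qed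
  have Kmono: "K m \<subseteq> K n" if "m \<le> n" for m n
  proof
    fix v assume "v \<in> K m"
    then have "(f ^^ ((n - m) + m)) v = (f ^^ (n - m)) 0"
      unfolding funpow_add by (simp add: K_def)
    then show "v \<in> K n" using \<open>v \<in> K m\<close> that zero by (simp add: K_def)
  qed
  obtain n1 where n1: "fs.dim (I n1) \<le> fs.dim (I m)" for m
    using ex_has_least_nat[of "\<lambda>_. True" 0 "\<lambda>n. fs.dim (I n)"] by auto
  have "fs.dim (K n) \<le> fs.dim V" for n
    using dim_mono[OF op_repD(1)[OF K] V(2) KV] .
  then obtain n2 where n2: "fs.dim (K m) \<le> fs.dim (K n2)" for m
    using ex_has_greatest_nat[of "\<lambda>_. True" 0 "\<lambda>n. fs.dim (K n)" "Suc (fs.dim V)"] by (auto simp: less_Suc_eq_le)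
  \<comment> \<open>positive, so that the powers compared below include the first\<close>
  define n where "n = Suc (max n1 n2)"
  have eqI: "I m = I n1" if "n1 \<le> m" for m
    using subspace_eqI[OF op_repD(1)[OF I] fin_support_mono[OF V(2) IV] Imono[OF that] n1] .
  have eqK: "K m = K n2" if "n2 \<le> m" for m
    using subspace_eqI[OF op_repD(1)[OF K] fin_support_mono[OF V(2) KV] Kmono[OF that] n2] by simp
  have In: "I (n + n) = I n" using eqI[of n] eqI[of "n + n"] by (simp add: n_def)
  have Kn: "K (n + n) = K n" using eqK[of n] eqK[of "n + n"] by (simp add: n_def)
  have int: "I n \<inter> K n = {0}"
  proof (intro equalityI subsetI)
    fix w assume "w \<in> I n \<inter> K n"
    then obtain v where v: "v \<in> V" "w = (f ^^ n) v" "(f ^^ n) w = 0" by (auto simp: I_def K_def)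
    then have "v \<in> K (n + n)" by (simp add: K_def funpow_add)
    then have "v \<in> K n" using Kn by simp
    then show "w \<in> {0}" using v by (simp add: K_def)
  next
    fix w :: "'b \<Rightarrow> 'c" assume "w \<in> {0}"
    then show "w \<in> I n \<inter> K n"
      using fs.subspace_0[OF op_repD(1)[OF I]] fs.subspace_0[OF op_repD(1)[OF K]] by simp
  qed
  have sum: "\<exists>u\<in>I n. \<exists>w\<in>K n. v = u + w" if v: "v \<in> V" for v
  proof -
    have "(f ^^ n) v \<in> I (n + n)" using v In by (auto simp: I_def)
    then obtain w where w: "w \<in> V" "(f ^^ n) v = (f ^^ n) ((f ^^ n) w)"
      by (auto simp: I_def funpow_add)
    have "(f ^^ n) (v - (f ^^ n) w) = 0"
      using lin_on_diff[OF op_homD(1)[OF hom] op_repD(1)[OF V(1)] v mem[OF w(1)]] w(2) by simp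
    then have "v - (f ^^ n) w \<in> K n"
      using fs.subspace_diff[OF op_repD(1)[OF V(1)] v mem[OF w(1)]] by (simp add: K_def)
    moreover have "(f ^^ n) w \<in> I n" using w(1) by (auto simp: I_def)
    moreover have "v = (f ^^ n) w + (v - (f ^^ n) w)" by simp
    ultimately show ?thesis by blast
  qed
  have "I n = {0} \<or> K n = {0}"
    by (rule indecD[OF V(3) I K IV KV int sum])
  then show ?thesis
  proof
    assume "I n = {0}"
    then have "\<forall>v\<in>V. (f ^^ n) v = 0" by (auto simp: I_def)
    then show ?thesis by blast
  next
    assume Kn0: "K n = {0}"
    have "K 1 \<subseteq> K n" by (rule Kmono) (simp add: n_def)
    then have "inj_on f V"
      using Kn0 by (intro op_hom_inj_onI[OF f V(1)]) (auto simp: K_def)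
    moreover have "V \<subseteq> I n" using sum Kn0 by auto
    then have "V \<subseteq> I 1" using Imono[of 1 n] by (auto simp: n_def)
    then have "f ` V = V" using IV[of 1] by (auto simp: I_def)
    ultimately show ?thesis by (simp add: bij_betw_def)
  qed
qed

lemma inj_funpow_zero:
  assumes "inj_on f V" "f ` V \<subseteq> V" "f 0 = 0" "0 \<in> V" "v \<in> V" "(f ^^ n) v = 0"
  shows "v = 0"
  using assms(5,6)
proof (induction n arbitrary: v)
  case (Suc n)
  then have "(f ^^ n) (f v) = 0" by (simp add: funpow_swap1)
  then have "f v = 0" using Suc assms(2) by auto
  then show ?case using assms(1,3,4) Suc.prems(1) by (metis inj_onD)
qed simp

text \<open>
  The endomorphism ring of an indecomposable is local: after division by the automorphism
  \<open>f + g\<close> the two maps add up to the identity, and if both were nilpotent, then \<open>h \<circ> g\<close>, which is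
  the identity minus a nilpotent map, would be injective and nilpotent.
\<close>

lemma local_endomorphisms:
  assumes V: "op_rep A V \<rho>" "fin_support V" "indec A V \<rho>"
    and f: "op_hom A V \<rho> V \<rho> f" and g: "op_hom A V \<rho> V \<rho> g"
    and bij: "bij_betw (\<lambda>v. f v + g v) V V"
  shows "bij_betw f V V \<or> bij_betw g V V"
proof -
  define h where "h = inv_into V (\<lambda>v. f v + g v)"
  have h: "op_hom A V \<rho> V \<rho> h"
    unfolding h_def by (rule op_hom_inv[OF op_hom_add[OF f g V(1)] bij V(1)])
  have hl: "h (f v + g v) = v" if "v \<in> V" for v
    using bij_betw_inv_into_left[OF bij that] by (simp add: h_def)
  have hr: "f (h v) + g (h v) = v" if "v \<in> V" for v
    using bij_betw_inv_into_right[OF bij that] by (simp add: h_def)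
  have hbij: "bij_betw h V V" unfolding h_def by (rule bij_betw_inv_into[OF bij])
  have cancel: "bij_betw k V V"
    if kV: "k ` V \<subseteq> V" and hk: "bij_betw (\<lambda>v. h (k v)) V V" for k
  proof -
    have "bij_betw (\<lambda>v. f (h (k v)) + g (h (k v))) V V"
      using bij_betw_trans[OF hk bij] by (simp add: o_def)
    then show ?thesis
      by (rule bij_betw_cong[THEN iffD1, rotated]) (use kV hr in auto)
  qed
  note hf = op_hom_comp[OF f h] and hg = op_hom_comp[OF g h]
  have one: "h (f v) + h (g v) = v" if "v \<in> V" for v
    using lin_onD(1)[OF op_homD(1)[OF h], of "f v" "g v"] hl[OF that] op_homD(2)[OF f that] op_homD(2)[OF g that]
    by simp
  have V0: "0 \<in> V" using fs.subspace_0[OF op_repD(1)[OF V(1)]] .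
  from fitting[OF V hf] show ?thesis
  proof
    assume "bij_betw (\<lambda>v. h (f v)) V V"
    then show ?thesis using cancel[of f] f by (auto simp: op_hom_def)
  next
    assume "\<exists>n. \<forall>v\<in>V. ((\<lambda>v. h (f v)) ^^ n) v = 0"
    then obtain n where n: "((\<lambda>v. h (f v)) ^^ n) v = 0" if "v \<in> V" for v by blast
    have inj: "inj_on (\<lambda>v. h (g v)) V"
    proof (rule op_hom_inj_onI[OF hg V(1)])
      fix v assume v: "v \<in> V" "h (g v) = 0"
      then have "h (f v) = v" using one[OF v(1)] by simp
      then have "((\<lambda>v. h (f v)) ^^ m) v = v" for m by (induction m) simp_all
      then show "v = 0" using n[OF v(1)] by metis
    qed
    from fitting[OF V hg] show ?thesis
    proof
      assume "bij_betw (\<lambda>v. h (g v)) V V"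
      then show ?thesis using cancel[of g] g by (auto simp: op_hom_def)
    next
      assume "\<exists>n. \<forall>v\<in>V. ((\<lambda>v. h (g v)) ^^ n) v = 0"
      then obtain m where m: "((\<lambda>v. h (g v)) ^^ m) v = 0" if "v \<in> V" for v by blast
      have "v = 0" if "v \<in> V" for v
        using inj_funpow_zero[OF inj _ _ V0 that m[OF that]] op_homD(2)[OF hg]
          lin_on_zero[OF op_homD(1)[OF hg] op_repD(1)[OF V(1)]] by auto
      then have "V = {0}" using V0 by auto
      then show ?thesis using V(3) by (simp add: indec_def)
    qed
  qed
qed

lemma local_endomorphisms_sum:
  assumes V: "op_rep A V \<rho>" "fin_support V" "indec A V \<rho>"
    and "finite J" "\<And>j. j \<in> J \<Longrightarrow> op_hom A V \<rho> V \<rho> (f j)"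
    and "bij_betw (\<lambda>v. \<Sum>j\<in>J. f j v) V V"
  shows "\<exists>j\<in>J. bij_betw (f j) V V"
  using assms(4-6)
proof (induction J rule: finite_induct)
  case empty
  then have "(\<lambda>v. 0) ` V = V" unfolding bij_betw_def sum.empty by blast
  moreover have "0 \<in> V" using fs.subspace_0[OF op_repD(1)[OF V(1)]] .
  ultimately have "V = {0}" by auto
  then show ?case using V(3) by (simp add: indec_def)
next
  case (insert i J)
  have "op_hom A V \<rho> V \<rho> (\<lambda>v. \<Sum>j\<in>J. f j v)" by (rule op_hom_sum[OF V(1)]) (use insert in auto)
  moreover have "bij_betw (\<lambda>v. f i v + (\<Sum>j\<in>J. f j v)) V V"
    using insert.prems(2) unfolding sum.insert[OF insert.hyps] .
  ultimately have "bij_betw (f i) V V \<or> bij_betw (\<lambda>v. \<Sum>j\<in>J. f j v) V V"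
    using insert.prems(1) by (intro local_endomorphisms[OF V]) auto
  then show ?case using insert by auto
qed

text \<open>
  The exchange step of Krull-Schmidt: the identity of an indecomposable \<open>M\<close> is the sum of the maps
  that factor through the pieces \<open>U j\<close>, so by locality one of these maps is invertible. The pieces
  may be invariant under more operators than the arrows in \<open>A\<close>, which is how the lemma is used
  for restriction to a subcategory.
\<close>

lemma retract_component:
  assumes M: "op_rep A M \<mu>" "fin_support M" "indec A M \<mu>" and "retract A M \<mu> V \<rho>"
    and J: "finite J" and e: "\<And>j. j \<in> J \<Longrightarrow> op_hom A V \<rho> (U j) \<rho> (e j)" "\<And>j. j \<in> J \<Longrightarrow> U j \<subseteq> V"
    and one: "\<And>v. v \<in> V \<Longrightarrow> (\<Sum>j\<in>J. e j v) = v" and V: "op_rep A V \<rho>"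
  shows "\<exists>j\<in>J. retract A M \<mu> (U j) \<rho>"
proof -
  obtain f g where f: "op_hom A M \<mu> V \<rho> f" and g: "op_hom A V \<rho> M \<mu> g" and gf: "\<And>x. x \<in> M \<Longrightarrow> g (f x) = x"
    using assms(4) unfolding retract_def by blast
  have ef: "op_hom A M \<mu> (U j) \<rho> (\<lambda>x. e j (f x))" if "j \<in> J" for j
    using op_hom_comp[OF f e(1)[OF that]] .
  have gU: "op_hom A (U j) \<rho> M \<mu> g" if "j \<in> J" for j
    by (rule op_hom_subset[OF g e(2)[OF that]]) simp
  have "(\<Sum>j\<in>J. g (e j (f x))) = x" if "x \<in> M" for x
  proof -
    have "(\<Sum>j\<in>J. g (e j (f x))) = g (\<Sum>j\<in>J. e j (f x))"
      using op_homD(2)[OF ef] e(2) that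
      by (intro lin_on_sum[OF op_homD(1)[OF g] op_repD(1)[OF V], symmetric]) blast
    then show ?thesis using one[OF op_homD(2)[OF f that]] gf[OF that] by simp
  qed
  then have "bij_betw (\<lambda>x. \<Sum>j\<in>J. g (e j (f x))) M M"
    by (intro bij_betw_byWitness[where f' = "\<lambda>x. x"]) auto
  then obtain j where j: "j \<in> J" "bij_betw (\<lambda>x. g (e j (f x))) M M"
    using local_endomorphisms_sum[OF M J, of "\<lambda>j x. g (e j (f x))"] op_hom_comp[OF ef gU] by blast
  define h where "h = inv_into M (\<lambda>x. g (e j (f x)))"
  have "op_hom A M \<mu> M \<mu> h"
    unfolding h_def by (rule op_hom_inv[OF op_hom_comp[OF ef[OF j(1)] gU[OF j(1)]] j(2) M(1)])
  then have "op_hom A (U j) \<rho> M \<mu> (\<lambda>x. h (g x))" using op_hom_comp[OF gU[OF j(1)]] by blast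
  moreover have "h (g (e j (f x))) = x" if "x \<in> M" for x
    using bij_betw_inv_into_left[OF j(2) that] by (simp add: h_def)
  ultimately show ?thesis unfolding retract_def using ef[OF j(1)] j(1) by blast
qed

text \<open>
  A retract of \<open>V\<close> gives the decomposition of \<open>V\<close> into the image of the section and the kernel of
  the retraction.
\<close>

lemma retract_of_indec:
  assumes M: "op_rep A M \<mu>" "M \<noteq> {0}" and V: "op_rep A V \<rho>" "indec A V \<rho>" and "retract A M \<mu> V \<rho>"
  shows "op_iso A M \<mu> V \<rho>"
proof -
  obtain f g where f: "op_hom A M \<mu> V \<rho> f" and g: "op_hom A V \<rho> M \<mu> g" and gf: "\<And>x. x \<in> M \<Longrightarrow> g (f x) = x"
    using assms(5) unfolding retract_def by blast
  note M0 = fs.subspace_0[OF op_repD(1)[OF M(1)]]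
  have f0: "f 0 = 0" using lin_on_zero[OF op_homD(1)[OF f] op_repD(1)[OF M(1)]] .
  have g0: "g 0 = 0" using lin_on_zero[OF op_homD(1)[OF g] op_repD(1)[OF V(1)]] .
  have "f ` M \<inter> {v \<in> V. g v = 0} = {0}"
    using gf f0 g0 M0 fs.subspace_0[OF op_repD(1)[OF V(1)]] by (auto 4 4)
  moreover have split: "v = f (g v) + (v - f (g v)) \<and> f (g v) \<in> f ` M \<and> v - f (g v) \<in> {v \<in> V. g v = 0}" if v: "v \<in> V" for v
  proof -
    have m: "g v \<in> M" "f (g v) \<in> V" using v op_homD(2)[OF f] op_homD(2)[OF g] by auto
    have "g (v - f (g v)) = 0"
      using lin_on_diff[OF op_homD(1)[OF g] op_repD(1)[OF V(1)] v m(2)] gf[OF m(1)] by simp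
    then show ?thesis using m fs.subspace_diff[OF op_repD(1)[OF V(1)] v m(2)] by simp
  qed
  moreover have "f ` M \<subseteq> V" using op_homD(2)[OF f] by auto
  moreover note op_rep_image[OF f M(1) V(1)] op_rep_kernel[OF g V(1) M(1)]
  ultimately have "f ` M = {0} \<or> {v \<in> V. g v = 0} = {0}"
    by (intro indecD[OF V(2)]) blast+
  moreover have "f ` M \<noteq> {0}"
  proof
    assume *: "f ` M = {0}"
    have "x = 0" if "x \<in> M" for x
    proof -
      have "f x = 0" using * that by blast
      then show ?thesis using gf[OF that] g0 by simp
    qed
    then show False using M(2) M0 by auto
  qed
  ultimately have ker: "{v \<in> V. g v = 0} = {0}" by blast
  have "V \<subseteq> f ` M"
  proof
    fix v assume v: "v \<in> V"
    have "v - f (g v) = 0" using split[OF v] ker by blast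
    then show "v \<in> f ` M" using split[OF v] by simp
  qed
  then have "f ` M = V" using \<open>f ` M \<subseteq> V\<close> by blast
  moreover have "inj_on f M" using gf by (metis inj_onI)
  ultimately show ?thesis unfolding op_iso_def bij_betw_def using f by blast
qed

definition decomp :: "'a set \<Rightarrow> ('i \<Rightarrow> 'k::field) set \<Rightarrow> ('a \<Rightarrow> ('i \<Rightarrow> 'k) \<Rightarrow> ('i \<Rightarrow> 'k)) \<Rightarrow> nat \<Rightarrow>
    (nat \<Rightarrow> ('i \<Rightarrow> 'k) set) \<Rightarrow> (nat \<Rightarrow> ('i \<Rightarrow> 'k) \<Rightarrow> ('i \<Rightarrow> 'k)) \<Rightarrow> bool" where
  "decomp A V \<rho> m U e \<longleftrightarrow>
     (\<forall>j<m. op_rep A (U j) \<rho> \<and> U j \<subseteq> V \<and> indec A (U j) \<rho> \<and> op_hom A V \<rho> (U j) \<rho> (e j)) \<and>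
     (\<forall>v\<in>V. (\<Sum>j<m. e j v) = v) \<and>
     (\<forall>i<m. \<forall>j<m. \<forall>u\<in>U i. e j u = (if i = j then u else 0))"

lemma decompD:
  assumes "decomp A V \<rho> m U e"
  shows "j < m \<Longrightarrow> op_rep A (U j) \<rho> \<and> U j \<subseteq> V \<and> indec A (U j) \<rho> \<and> op_hom A V \<rho> (U j) \<rho> (e j)"
    "v \<in> V \<Longrightarrow> (\<Sum>j<m. e j v) = v"
    "i < m \<Longrightarrow> j < m \<Longrightarrow> u \<in> U i \<Longrightarrow> e j u = (if i = j then u else 0)"
  using assms unfolding decomp_def by blast+

lemma complement_projections:
  assumes V: "op_rep A V \<rho>" and U: "op_rep A U \<rho>" "U \<subseteq> V" and W: "op_rep A W \<rho>" "W \<subseteq> V"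
    and int: "U \<inter> W = {0}" and sum: "\<And>v. v \<in> V \<Longrightarrow> \<exists>u\<in>U. \<exists>w\<in>W. v = u + w"
  shows "\<exists>p q. op_hom A V \<rho> U \<rho> p \<and> op_hom A V \<rho> W \<rho> q \<and> (\<forall>v\<in>V. p v + q v = v) \<and>
     (\<forall>u\<in>U. p u = u \<and> q u = 0) \<and> (\<forall>w\<in>W. p w = 0 \<and> q w = w)"
proof -
  from sum have "\<forall>v\<in>V. \<exists>u. u \<in> U \<and> v - u \<in> W" by fastforce
  then obtain p where p: "\<And>v. v \<in> V \<Longrightarrow> p v \<in> U" "\<And>v. v \<in> V \<Longrightarrow> v - p v \<in> W" by metis
  note sU = op_repD(1)[OF U(1)] and sW = op_repD(1)[OF W(1)]
  define q where "q v = v - p v" for v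
  have uniq: "p v = u \<and> q v = w" if "v = u + w" "u \<in> U" "w \<in> W" for u v w
  proof -
    have v: "v \<in> V" using that U(2) W(2) fs.subspace_add[OF op_repD(1)[OF V]] by auto
    have eq: "p v - u = w - (v - p v)" unfolding that(1) by (simp add: algebra_simps)
    have "w - (v - p v) \<in> U" using fs.subspace_diff[OF sU p(1)[OF v] that(2)] unfolding eq .
    moreover have "w - (v - p v) \<in> W" using fs.subspace_diff[OF sW that(3) p(2)[OF v]] .
    ultimately have "p v - u \<in> U \<inter> W" unfolding eq by blast
    then have "p v - u = 0" using int by blast
    then show ?thesis using that(1) by (simp add: q_def)
  qed
  have pq: "p v + q v = v" for v by (simp add: q_def)
  have add: "p (u + v) = p u + p v \<and> q (u + v) = q u + q v" if "u \<in> V" "v \<in> V" for u v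
  proof (rule uniq)
    show "u + v = (p u + p v) + (q u + q v)" by (simp add: q_def)
  qed (use that p fs.subspace_add[OF sU] fs.subspace_add[OF sW] in \<open>auto simp: q_def\<close>)
  have scale: "p (fscale c v) = fscale c (p v) \<and> q (fscale c v) = fscale c (q v)" if "v \<in> V" for c v
  proof (rule uniq)
    show "fscale c v = fscale c (p v) + fscale c (q v)"
      by (metis pq fs.scale_right_distrib)
  qed (use that p fs.subspace_scale[OF sU] fs.subspace_scale[OF sW] in \<open>auto simp: q_def\<close>)
  have act: "p (\<rho> a v) = \<rho> a (p v) \<and> q (\<rho> a v) = \<rho> a (q v)" if "a \<in> A" "v \<in> V" for a v
  proof (rule uniq)
    have "\<rho> a (p v + q v) = \<rho> a (p v) + \<rho> a (q v)"
      using that p U(2) W(2) by (intro lin_onD(1)[OF op_repD(3)[OF V]]) (auto simp: q_def)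
    then show "\<rho> a v = \<rho> a (p v) + \<rho> a (q v)" using pq by simp
  qed (use that p op_repD(2)[OF U(1)] op_repD(2)[OF W(1)] in \<open>auto simp: q_def\<close>)
  have "op_hom A V \<rho> U \<rho> p" "op_hom A V \<rho> W \<rho> q"
    unfolding op_hom_def lin_on_def
    using p(1) p(2)[folded q_def] add scale act by auto
  moreover have "p u = u \<and> q u = 0" if "u \<in> U" for u
    using uniq[of u u 0] that fs.subspace_0[OF sW] by simp
  moreover have "p w = 0 \<and> q w = w" if "w \<in> W" for w
    using uniq[of w 0 w] that fs.subspace_0[OF sU] by simp
  ultimately show ?thesis using pq by blast
qed

lemma decomp_exists:
  assumes "op_rep A V \<rho>" "fin_support V"
  shows "\<exists>m U e. decomp A V \<rho> m U e"
  using assms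
proof (induction "fs.dim V" arbitrary: V rule: less_induct)
  case less
  note V = less.prems
  consider "V = {0}" | "indec A V \<rho>" | "V \<noteq> {0}" "\<not> indec A V \<rho>" by blast
  then show ?case
  proof cases
    case 1
    then have "decomp A V \<rho> 0 (\<lambda>_. V) (\<lambda>_ v. v)" by (simp add: decomp_def)
    then show ?thesis by blast
  next
    case 2
    then have "decomp A V \<rho> 1 (\<lambda>_. V) (\<lambda>_ v. v)"
      using V(1) op_hom_id by (auto simp: decomp_def)
    then show ?thesis by blast
  next
    case 3
    obtain U W where UW: "op_rep A U \<rho>" "op_rep A W \<rho>" "U \<subseteq> V" "W \<subseteq> V"
      and int: "U \<inter> W = {0}" and sum: "\<And>v. v \<in> V \<Longrightarrow> \<exists>u\<in>U. \<exists>w\<in>W. v = u + w"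
      and UW0: "U \<noteq> {0}" "W \<noteq> {0}"
      by (rule not_indecE[OF 3(2,1)]) (rule that)
    note U = UW(1,3) UW0(1) and W = UW(2,4) UW0(2)
    have z: "0 \<in> U" "0 \<in> W" using int by auto
    have "U \<noteq> V" "W \<noteq> V" using U W int z by auto
    then have d: "fs.dim U < fs.dim V" "fs.dim W < fs.dim V"
      using dim_less[OF op_repD(1)[OF U(1)] V(2)] dim_less[OF op_repD(1)[OF W(1)] V(2)] U(2) W(2) by auto
    obtain m1 U1 e1 where D1: "decomp A U \<rho> m1 U1 e1"
      using less.hyps[OF d(1) U(1) fin_support_mono[OF V(2) U(2)]] by blast
    obtain m2 U2 e2 where D2: "decomp A W \<rho> m2 U2 e2"
      using less.hyps[OF d(2) W(1) fin_support_mono[OF V(2) W(2)]] by blast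
    note D1 = decompD[OF D1] and D2 = decompD[OF D2]
    obtain p q where p: "op_hom A V \<rho> U \<rho> p" and q: "op_hom A V \<rho> W \<rho> q" and pq: "\<And>v. v \<in> V \<Longrightarrow> p v + q v = v"
      and pU: "\<And>u. u \<in> U \<Longrightarrow> p u = u \<and> q u = 0" and pW: "\<And>w. w \<in> W \<Longrightarrow> p w = 0 \<and> q w = w"
      using complement_projections[OF V(1) U(1,2) W(1,2) int sum] by blast
    define m where "m = m1 + m2"
    define UU where "UU j = (if j < m1 then U1 j else U2 (j - m1))" for j
    define e where "e j v = (if j < m1 then e1 j (p v) else e2 (j - m1) (q v))" for j v
    have e1z: "e1 j 0 = 0" if "j < m1" for j
      using lin_on_zero[OF op_homD(1) op_repD(1)[OF U(1)]] D1(1)[OF that] by blast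
    have e2z: "e2 j 0 = 0" if "j < m2" for j
      using lin_on_zero[OF op_homD(1) op_repD(1)[OF W(1)]] D2(1)[OF that] by blast
    have "op_rep A (UU j) \<rho> \<and> UU j \<subseteq> V \<and> indec A (UU j) \<rho> \<and> op_hom A V \<rho> (UU j) \<rho> (e j)" if "j < m" for j
    proof (cases "j < m1")
      case True
      then have "op_hom A V \<rho> (U1 j) \<rho> (\<lambda>v. e1 j (p v))" using D1(1) by (intro op_hom_comp[OF p]) blast
      then show ?thesis using True D1(1)[OF True] U(2) by (simp add: UU_def e_def [abs_def]) blast
    next
      case False
      then have j: "j - m1 < m2" using that by (simp add: m_def)
      then have "op_hom A V \<rho> (U2 (j - m1)) \<rho> (\<lambda>v. e2 (j - m1) (q v))" using D2(1) by (intro op_hom_comp[OF q]) blast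
      then show ?thesis using False D2(1)[OF j] W(2) by (simp add: UU_def e_def [abs_def]) blast
    qed
    moreover have "(\<Sum>j<m. e j v) = v" if v: "v \<in> V" for v
    proof -
      have "(\<Sum>j<m. e j v) = (\<Sum>j<m1. e j v) + (\<Sum>j\<in>{m1..<m}. e j v)"
        using sum.atLeastLessThan_concat[of 0 m1 m "\<lambda>j. e j v"] by (simp add: m_def atLeast0LessThan)
      also have "(\<Sum>j\<in>{m1..<m}. e j v) = (\<Sum>j<m2. e (j + m1) v)"
        using sum.shift_bounds_nat_ivl[of "\<lambda>j. e j v" 0 m1 m2] by (simp add: m_def atLeast0LessThan add.commute)
      also have "\<dots> = (\<Sum>j<m2. e2 j (q v))" by (simp add: e_def)
      also have "(\<Sum>j<m1. e j v) = (\<Sum>j<m1. e1 j (p v))" by (simp add: e_def)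
      also have "(\<Sum>j<m1. e1 j (p v)) + (\<Sum>j<m2. e2 j (q v)) = p v + q v"
        using D1(2)[OF op_homD(2)[OF p v]] D2(2)[OF op_homD(2)[OF q v]] by simp
      also have "\<dots> = v" by (rule pq[OF v])
      finally show ?thesis .
    qed
    moreover have "e j u = (if i = j then u else 0)" if ij: "i < m" "j < m" "u \<in> UU i" for i j u
    proof (cases "i < m1")
      case True
      then have "u \<in> U1 i" using ij by (simp add: UU_def)
      then have "u \<in> U" using D1(1)[OF True] by blast
      then show ?thesis
        using True ij \<open>u \<in> U1 i\<close> D1(3)[OF True] pU[of u] e2z by (auto simp: e_def m_def)
    next
      case False
      then have u: "u \<in> U2 (i - m1)" "i - m1 < m2" using ij by (auto simp: UU_def m_def)
      then have "u \<in> W" using D2(1)[OF u(2)] by blast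
      then show ?thesis
        using False ij u D2(3)[OF u(2)] pW[of u] e1z by (auto simp: e_def m_def)
    qed
    ultimately have "decomp A V \<rho> m UU e" unfolding decomp_def by blast
    then show ?thesis by blast
  qed
qed

text \<open>
  The sums of the first summands form a strictly increasing chain of subspaces. The bound makes the
  set of possible lists of isomorphism types of summands finite.
\<close>

lemma decomp_le_dim:
  assumes V: "op_rep A V \<rho>" "fin_support V" and D: "decomp A V \<rho> m U e"
  shows "m \<le> fs.dim V"
proof -
  \<comment> \<open>the sum of the first k summands, cut out by the projections to the others\<close>
  define S where "S k = {v \<in> V. \<forall>i<m. k \<le> i \<longrightarrow> e i v = 0}" for k
  note D = decompD[OF D]
  have SV: "S k \<subseteq> V" for k by (auto simp: S_def)
  have sub: "fs.subspace (S k)" for k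
  proof (rule fs.subspaceI)
    have lin: "lin_on V (e i)" if "i < m" for i using D(1)[OF that] by (simp add: op_hom_def)
    note sV = op_repD(1)[OF V(1)]
    show "0 \<in> S k" using lin_on_zero[OF lin sV] fs.subspace_0[OF sV] by (simp add: S_def)
    show "x + y \<in> S k" if "x \<in> S k" "y \<in> S k" for x y
      using that lin_onD(1)[OF lin, of _ x y] fs.subspace_add[OF sV] by (simp add: S_def)
    show "fscale c x \<in> S k" if "x \<in> S k" for c x
      using that lin_onD(2)[OF lin, of _ x c] fs.subspace_scale[OF sV] by (simp add: S_def)
  qed
  have "k \<le> m \<Longrightarrow> k \<le> fs.dim (S k)" for k
  proof (induction k)
    case (Suc k)
    then have k: "k < m" by simp
    have "U k \<noteq> {0}" "fs.subspace (U k)" using D(1)[OF k] by (auto simp: indec_def op_rep_def)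
    then obtain u where u: "u \<in> U k" "u \<noteq> 0" using fs.subspace_0 by blast
    have "u \<in> S (Suc k)" using u D(1)[OF k] D(3)[OF k _ u(1)] by (auto simp: S_def)
    moreover have "u \<notin> S k" using u D(3)[OF k k u(1)] k by (auto simp: S_def)
    moreover have "S k \<subseteq> S (Suc k)" by (auto simp: S_def)
    ultimately have "fs.dim (S k) < fs.dim (S (Suc k))"
      by (intro dim_less sub fin_support_mono[OF V(2) SV]) auto
    then show ?case using Suc by simp
  qed simp
  then have "m \<le> fs.dim (S m)" by simp
  also have "\<dots> \<le> fs.dim V" by (rule dim_mono[OF sub V(2) SV])
  finally show ?thesis .
qed

lemma finitely_many_indec_retracts:
  assumes V: "op_rep A V \<rho>" "fin_support V"
  shows "\<exists>D. finite D \<and> (\<forall>U\<in>D. op_rep A U \<rho> \<and> U \<subseteq> V) \<and>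
    (\<forall>(M :: ('j \<Rightarrow> 'k::field) set) \<mu>. op_rep A M \<mu> \<and> fin_support M \<and> indec A M \<mu> \<and> retract A M \<mu> V \<rho> \<longrightarrow> (\<exists>U\<in>D. op_iso A M \<mu> U \<rho>))"
proof -
  obtain m U e where "decomp A V \<rho> m U e" using decomp_exists[OF V] by blast
  note D = decompD[OF this]
  have "\<exists>W\<in>U ` {..<m}. op_iso A M \<mu> W \<rho>"
    if M: "op_rep A M \<mu>" "fin_support M" "indec A M \<mu>" "retract A M \<mu> V \<rho>" for M :: "('j \<Rightarrow> 'k) set" and \<mu>
  proof -
    have "\<exists>j\<in>{..<m}. retract A M \<mu> (U j) \<rho>"
      by (rule retract_component[OF M, of _ U e]) (use D V in auto)
    then obtain j where j: "j < m" "retract A M \<mu> (U j) \<rho>" by blast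
    then have "op_iso A M \<mu> (U j) \<rho>"
      using D(1)[OF j(1)] M by (intro retract_of_indec) (auto simp: indec_def)
    then show ?thesis using j(1) by blast
  qed
  then show ?thesis using D(1) by (intro exI[of _ "U ` {..<m}"]) auto
qed

lemma op_iso_from_decomp:
  assumes V: "op_rep A V \<rho>" and W: "op_rep A W \<sigma>"
    and D: "decomp A V \<rho> m U e" and D': "decomp A W \<sigma> m U' e'"
    and iso: "\<And>j. j < m \<Longrightarrow> op_iso A (U j) \<rho> (U' j) \<sigma>"
  shows "op_iso A V \<rho> W \<sigma>"
proof -
  note D = decompD[OF D] and D' = decompD[OF D']
  obtain f where f: "\<And>j. j < m \<Longrightarrow> op_hom A (U j) \<rho> (U' j) \<sigma> (f j)" "\<And>j. j < m \<Longrightarrow> bij_betw (f j) (U j) (U' j)"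
    using iso unfolding op_iso_def by metis
  define g where "g j = inv_into (U j) (f j)" for j
  have g: "op_hom A (U' j) \<sigma> (U j) \<rho> (g j)" "bij_betw (g j) (U' j) (U j)" if "j < m" for j
    unfolding g_def using op_hom_inv[OF f[OF that]] D(1)[OF that] bij_betw_inv_into[OF f(2)[OF that]] by auto
  have gf: "g j (f j x) = x" if "j < m" "x \<in> U j" for j x
    using bij_betw_inv_into_left[OF f(2)] that by (simp add: g_def)
  have fg: "f j (g j x) = x" if "j < m" "x \<in> U' j" for j x
    using bij_betw_inv_into_right[OF f(2)] that by (simp add: g_def)
  define F where "F v = (\<Sum>j<m. f j (e j v))" for v
  define G where "G w = (\<Sum>j<m. g j (e' j w))" for w
  have F: "op_hom A V \<rho> W \<sigma> F"
    unfolding F_def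
  proof (rule op_hom_sum[OF W])
    fix j assume "j \<in> {..<m}"
    then have j: "j < m" by simp
    have "op_hom A V \<rho> (U' j) \<sigma> (\<lambda>v. f j (e j v))"
      using D(1)[OF j] by (intro op_hom_comp[OF _ f(1)[OF j]]) simp
    then show "op_hom A V \<rho> W \<sigma> (\<lambda>v. f j (e j v))"
      by (rule op_hom_subset) (use D'(1)[OF j] in auto)
  qed
  have G: "op_hom A W \<sigma> V \<rho> G"
    unfolding G_def
  proof (rule op_hom_sum[OF V])
    fix j assume "j \<in> {..<m}"
    then have j: "j < m" by simp
    have "op_hom A W \<sigma> (U j) \<rho> (\<lambda>w. g j (e' j w))"
      using D'(1)[OF j] by (intro op_hom_comp[OF _ g(1)[OF j]]) simp
    then show "op_hom A W \<sigma> V \<rho> (\<lambda>w. g j (e' j w))"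
      by (rule op_hom_subset) (use D(1)[OF j] in auto)
  qed
  have GF: "G (F v) = v" if v: "v \<in> V" for v
  proof -
    have fe: "f j (e j v) \<in> U' j" "e j v \<in> U j" if "j < m" for j
      using D(1)[OF that] op_homD(2)[OF f(1)[OF that]] v by (auto simp: op_hom_def)
    have "e' i (F v) = f i (e i v)" if i: "i < m" for i
    proof -
      have "e' i (F v) = (\<Sum>j<m. e' i (f j (e j v)))"
        unfolding F_def
      proof (rule lin_on_sum[OF _ op_repD(1)[OF W]])
        show "lin_on W (e' i)" using D'(1)[OF i] by (simp add: op_hom_def)
        show "f j (e j v) \<in> W" if "j \<in> {..<m}" for j using that D'(1)[of j] fe(1)[of j] by auto
      qed
      also have "\<dots> = (\<Sum>j<m. if j = i then f j (e j v) else 0)"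
        using D'(3)[OF _ i fe(1)] by (intro sum.cong) auto
      finally show ?thesis using i by simp
    qed
    then have "G (F v) = (\<Sum>j<m. e j v)"
      unfolding G_def using gf fe by (intro sum.cong) auto
    then show ?thesis using D(2)[OF v] by simp
  qed
  have FG: "F (G w) = w" if w: "w \<in> W" for w
  proof -
    have ge: "g j (e' j w) \<in> U j" "e' j w \<in> U' j" if "j < m" for j
      using D'(1)[OF that] op_homD(2)[OF g(1)[OF that]] w by (auto simp: op_hom_def)
    have "e i (G w) = g i (e' i w)" if i: "i < m" for i
    proof -
      have "e i (G w) = (\<Sum>j<m. e i (g j (e' j w)))"
        unfolding G_def
      proof (rule lin_on_sum[OF _ op_repD(1)[OF V]])
        show "lin_on V (e i)" using D(1)[OF i] by (simp add: op_hom_def)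
        show "g j (e' j w) \<in> V" if "j \<in> {..<m}" for j using that D(1)[of j] ge(1)[of j] by auto
      qed
      also have "\<dots> = (\<Sum>j<m. if j = i then g j (e' j w) else 0)"
        using D(3)[OF _ i ge(1)] by (intro sum.cong) auto
      finally show ?thesis using i by simp
    qed
    then have "F (G w) = (\<Sum>j<m. e' j w)"
      unfolding F_def using fg ge by (intro sum.cong) auto
    then show ?thesis using D'(2)[OF w] by simp
  qed
  have "bij_betw F V W"
    by (rule bij_betw_byWitness[of _ G]) (use GF FG op_homD(2)[OF F] op_homD(2)[OF G] in auto)
  then show ?thesis unfolding op_iso_def using F by blast
qed

section \<open>Finite type for representations of a category\<close>

text \<open>
  A functor is encoded by the direct sum of its values. Each arrow acts on the whole sum, as zero
  on the values at objects other than its domain; the value at \<open>x\<close> is the image of the identity of \<open>x\<close>.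
  With this encoding a functor is literally a module over the category algebra.
\<close>

definition cat_rep :: "('o, 'm, 'z) cat_scheme \<Rightarrow> ('i \<Rightarrow> 'k::field) set \<Rightarrow> ('m \<Rightarrow> ('i \<Rightarrow> 'k) \<Rightarrow> ('i \<Rightarrow> 'k)) \<Rightarrow> bool" where
  "cat_rep C V \<rho> \<longleftrightarrow> op_rep (Arr C) V \<rho> \<and>
     (\<forall>a\<in>Arr C. \<forall>b\<in>Arr C. \<forall>v\<in>V. \<rho> a (\<rho> b v) = (if Dom C a = Cod C b then \<rho> (Comp C a b) v else 0)) \<and>
     (\<forall>v\<in>V. (\<Sum>a\<in>Ident C ` Obj C. \<rho> a v) = v)"

lemma cat_repD:
  assumes "cat_rep C V \<rho>"
  shows "op_rep (Arr C) V \<rho>"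
    "a \<in> Arr C \<Longrightarrow> b \<in> Arr C \<Longrightarrow> v \<in> V \<Longrightarrow> \<rho> a (\<rho> b v) = (if Dom C a = Cod C b then \<rho> (Comp C a b) v else 0)"
    "v \<in> V \<Longrightarrow> (\<Sum>a\<in>Ident C ` Obj C. \<rho> a v) = v"
  using assms unfolding cat_rep_def by blast+

lemma cat_rep_sub: "cat_rep C V \<rho> \<Longrightarrow> op_rep (Arr C) U \<rho> \<Longrightarrow> U \<subseteq> V \<Longrightarrow> cat_rep C U \<rho>"
  unfolding cat_rep_def by blast

text \<open>
  The index type is a parameter because coinduction enlarges it; a representation of a finite
  category has copies over any infinite index type.
\<close>

definition fin_type :: "'i itself \<Rightarrow> 'k::field itself \<Rightarrow> ('o, 'm, 'z) cat_scheme \<Rightarrow> bool" where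
  "fin_type _ _ C \<longleftrightarrow> (\<exists>F :: (('i \<Rightarrow> 'k) set \<times> ('m \<Rightarrow> ('i \<Rightarrow> 'k) \<Rightarrow> ('i \<Rightarrow> 'k))) set. finite F \<and>
     (\<forall>(W, \<sigma>)\<in>F. cat_rep C W \<sigma> \<and> fin_support W) \<and>
     (\<forall>(V :: ('i \<Rightarrow> 'k) set) \<rho>. cat_rep C V \<rho> \<and> fin_support V \<and> indec (Arr C) V \<rho> \<longrightarrow> (\<exists>(W, \<sigma>)\<in>F. op_iso (Arr C) V \<rho> W \<sigma>)))"

text \<open>
  Choosing one indecomposable for every label that occurs gives the representatives. The labels
  will be isomorphism classes of modules, or summands of a given finite list of representations.
\<close>

lemma fin_typeI:
  fixes C :: "('o, 'm, 'z) cat_scheme"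
    and R :: "('i \<Rightarrow> 'k::field) set \<Rightarrow> ('m \<Rightarrow> ('i \<Rightarrow> 'k) \<Rightarrow> ('i \<Rightarrow> 'k)) \<Rightarrow> 's \<Rightarrow> bool"
  assumes "finite S"
    and ex: "\<And>V \<rho>. cat_rep C V \<rho> \<Longrightarrow> fin_support V \<Longrightarrow> indec (Arr C) V \<rho> \<Longrightarrow> \<exists>s\<in>S. R V \<rho> s"
    and eq: "\<And>V \<rho> V' \<rho>' s. cat_rep C V \<rho> \<Longrightarrow> cat_rep C V' \<rho>' \<Longrightarrow> s \<in> S \<Longrightarrow> R V \<rho> s \<Longrightarrow> R V' \<rho>' s \<Longrightarrow>
      op_iso (Arr C) V \<rho> V' \<rho>'"
  shows "fin_type TYPE('i) TYPE('k) C"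
proof -
  define P where "P s Y \<longleftrightarrow> cat_rep C (fst Y) (snd Y) \<and> fin_support (fst Y) \<and> R (fst Y) (snd Y) s" for s Y
  define F where "F = (\<lambda>s. SOME Y. P s Y) ` {s \<in> S. \<exists>Y. P s Y}"
  have F: "P s (SOME Y. P s Y)" if "\<exists>Y. P s Y" for s
    using that by (rule someI_ex)
  have F1: "finite F" unfolding F_def using assms(1) by simp
  have "cat_rep C (fst Y) (snd Y) \<and> fin_support (fst Y)" if "Y \<in> F" for Y
  proof -
    from that obtain s where "Y = (SOME Y. P s Y)" "\<exists>Y. P s Y" unfolding F_def by blast
    then have "P s Y" using F by blast
    then show ?thesis by (simp add: P_def)
  qed
  then have F2: "\<forall>(W, \<sigma>)\<in>F. cat_rep C W \<sigma> \<and> fin_support W" by fastforce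
  have F3: "\<exists>(W, \<sigma>)\<in>F. op_iso (Arr C) V \<rho> W \<sigma>"
    if V: "cat_rep C V \<rho>" "fin_support V" "indec (Arr C) V \<rho>" for V :: "('i \<Rightarrow> 'k) set" and \<rho>
  proof -
    obtain s where s: "s \<in> S" "R V \<rho> s" using ex[OF V] by blast
    then have "P s (V, \<rho>)" using V by (simp add: P_def)
    then have e: "\<exists>Y. P s Y" by blast
    obtain W \<sigma> where W: "(SOME Y. P s Y) = (W, \<sigma>)" by (rule prod.exhaust)
    have "P s (W, \<sigma>)" using F[OF e] W by simp
    then have "op_iso (Arr C) V \<rho> W \<sigma>" using eq[OF V(1) _ s(1,2)] by (simp add: P_def)
    moreover have "(W, \<sigma>) \<in> F" unfolding F_def using s(1) e W by (metis (mono_tags, lifting) image_eqI mem_Collect_eq)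
    ultimately show ?thesis by blast
  qed
  show ?thesis
    unfolding fin_type_def by (intro exI[of _ F] conjI allI impI F1 F2) (elim conjE, rule F3)
qed

lemma fin_typeE:
  fixes C :: "('o, 'm, 'z) cat_scheme"
  assumes "fin_type TYPE('i) TYPE('k::field) C"
  obtains F :: "(('i \<Rightarrow> 'k::field) set \<times> ('m \<Rightarrow> ('i \<Rightarrow> 'k::field) \<Rightarrow> ('i \<Rightarrow> 'k::field))) set"
  where "finite F" "\<And>W \<sigma>. (W, \<sigma>) \<in> F \<Longrightarrow> cat_rep C W \<sigma>" "\<And>W \<sigma>. (W, \<sigma>) \<in> F \<Longrightarrow> fin_support W"
    "\<And>(V :: ('i \<Rightarrow> 'k::field) set) \<rho>. cat_rep C V \<rho> \<Longrightarrow> fin_support V \<Longrightarrow> indec (Arr C) V \<rho> \<Longrightarrow> \<exists>W \<sigma>. (W, \<sigma>) \<in> F \<and> op_iso (Arr C) V \<rho> W \<sigma>"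
proof -
  obtain F :: "(('i \<Rightarrow> 'k) set \<times> ('m \<Rightarrow> ('i \<Rightarrow> 'k) \<Rightarrow> ('i \<Rightarrow> 'k))) set" where F: "finite F"
    "\<forall>(W, \<sigma>)\<in>F. cat_rep C W \<sigma> \<and> fin_support W"
    "\<forall>(V :: ('i \<Rightarrow> 'k) set) \<rho>. cat_rep C V \<rho> \<and> fin_support V \<and> indec (Arr C) V \<rho> \<longrightarrow> (\<exists>(W, \<sigma>)\<in>F. op_iso (Arr C) V \<rho> W \<sigma>)"
    using assms unfolding fin_type_def by blast
  show ?thesis
    by (rule that[of F]) (use F in \<open>fastforce+\<close>)
qed

text \<open>
  By Krull-Schmidt a representation is determined by the list of the isomorphism types of its
  summands, and the dimension of \<open>V\<close> bounds the length of that list. Finite type thus leaves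
  finitely many isomorphism classes of representations on \<open>V\<close>, and two members of an infinite family
  must share a list.
\<close>

lemma fin_type_family:
  fixes C :: "('o, 'm, 'z) cat_scheme" and V :: "('i \<Rightarrow> 'k::field) set"
  assumes fin: "fin_type TYPE('i) TYPE('k) C" and L: "infinite L"
    and V: "\<And>l. l \<in> L \<Longrightarrow> cat_rep C V (\<rho> l)" "fin_support V"
  shows "\<exists>l\<in>L. \<exists>l'\<in>L. l \<noteq> l' \<and> op_iso (Arr C) V (\<rho> l) V (\<rho> l')"
proof -
  obtain F :: "(('i \<Rightarrow> 'k) set \<times> ('m \<Rightarrow> ('i \<Rightarrow> 'k) \<Rightarrow> ('i \<Rightarrow> 'k))) set" where F: "finite F"
    "\<And>W \<sigma>. (W, \<sigma>) \<in> F \<Longrightarrow> cat_rep C W \<sigma>"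
    "\<And>(V :: ('i \<Rightarrow> 'k) set) \<rho>. cat_rep C V \<rho> \<Longrightarrow> fin_support V \<Longrightarrow> indec (Arr C) V \<rho> \<Longrightarrow> \<exists>W \<sigma>. (W, \<sigma>) \<in> F \<and> op_iso (Arr C) V \<rho> W \<sigma>"
    using fin by (rule fin_typeE) blast
  let ?X = "{xs. set xs \<subseteq> F \<and> length xs \<le> fs.dim V}"
  define good where "good l xs \<longleftrightarrow> (\<exists>m U e. decomp (Arr C) V (\<rho> l) m U e \<and> length xs = m \<and>
      (\<forall>j<m. op_iso (Arr C) (U j) (\<rho> l) (fst (xs ! j)) (snd (xs ! j))))"
    for l and xs :: "(('i \<Rightarrow> 'k) set \<times> ('m \<Rightarrow> ('i \<Rightarrow> 'k) \<Rightarrow> ('i \<Rightarrow> 'k))) list"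
  have ex: "\<exists>xs\<in>?X. good l xs" if l: "l \<in> L" for l
  proof -
    note rep = cat_repD(1)[OF V(1)[OF l]]
    obtain m U e where D: "decomp (Arr C) V (\<rho> l) m U e" using decomp_exists[OF rep V(2)] by blast
    have "\<exists>Y. Y \<in> F \<and> op_iso (Arr C) (U j) (\<rho> l) (fst Y) (snd Y)" if j: "j < m" for j
    proof -
      have *: "op_rep (Arr C) (U j) (\<rho> l)" "U j \<subseteq> V" "indec (Arr C) (U j) (\<rho> l)"
        using decompD(1)[OF D j] by auto
      obtain W \<sigma> where "(W, \<sigma>) \<in> F" "op_iso (Arr C) (U j) (\<rho> l) W \<sigma>"
        using F(3)[OF cat_rep_sub[OF V(1)[OF l] *(1,2)] fin_support_mono[OF V(2) *(2)] *(3)] by blast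
      then show ?thesis by (intro exI[of _ "(W, \<sigma>)"]) simp
    qed
    then obtain Y where Y: "\<And>j. j < m \<Longrightarrow> Y j \<in> F"
      "\<And>j. j < m \<Longrightarrow> op_iso (Arr C) (U j) (\<rho> l) (fst (Y j)) (snd (Y j))" by metis
    have "map Y [0..<m] \<in> ?X" using Y(1) decomp_le_dim[OF rep V(2) D] by auto
    moreover have "good l (map Y [0..<m])"
      unfolding good_def using D Y(2) by (intro exI[of _ m] exI[of _ U] exI[of _ e]) simp
    ultimately show ?thesis by blast
  qed
  have "\<forall>l\<in>L. \<exists>xs. xs \<in> ?X \<and> good l xs"
    using ex by (simp only: Bex_def) (rule ballI)
  from bchoice[OF this] obtain lab where "\<forall>l\<in>L. lab l \<in> ?X \<and> good l (lab l)" ..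
  then have lab: "lab l \<in> ?X" "good l (lab l)" if "l \<in> L" for l using that by (simp_all only:)
  have "finite ?X" by (rule finite_lists_length_le[OF F(1)])
  then have "finite (lab ` L)" using lab(1) by (meson finite_subset image_subsetI)
  then obtain l0 where l0: "l0 \<in> L" "infinite {l \<in> L. lab l = lab l0}"
    using pigeonhole_infinite[OF L] by blast
  then have "{l \<in> L. lab l = lab l0} - {l0} \<noteq> {}" by (metis finite.emptyI infinite_remove)
  then obtain l where l: "l \<in> L" "lab l = lab l0" "l \<noteq> l0" by blast
  obtain m U e where D: "decomp (Arr C) V (\<rho> l) m U e" "length (lab l) = m"
    "\<And>j. j < m \<Longrightarrow> op_iso (Arr C) (U j) (\<rho> l) (fst (lab l ! j)) (snd (lab l ! j))"
    using lab(2)[OF l(1)] unfolding good_def by blast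
  obtain m' U' e' where D': "decomp (Arr C) V (\<rho> l0) m' U' e'" "length (lab l0) = m'"
    "\<And>j. j < m' \<Longrightarrow> op_iso (Arr C) (U' j) (\<rho> l0) (fst (lab l0 ! j)) (snd (lab l0 ! j))"
    using lab(2)[OF l0(1)] unfolding good_def by blast
  have m: "m' = m" using D(2) D'(2) l(2) by simp
  have "op_iso (Arr C) (U j) (\<rho> l) (U' j) (\<rho> l0)" if j: "j < m" for j
  proof -
    have "op_rep (Arr C) (U' j) (\<rho> l0)" using decompD(1)[OF D'(1)] j m by blast
    then show ?thesis
      using op_iso_trans[OF D(3)[OF j]] op_iso_sym[OF D'(3)[of j]] j m l(2) by simp
  qed
  then have "op_iso (Arr C) V (\<rho> l) V (\<rho> l0)"
    using op_iso_from_decomp[OF cat_repD(1)[OF V(1)[OF l(1)]] cat_repD(1)[OF V(1)[OF l0(1)]] D(1) D'(1)[unfolded m]]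
    by blast
  then show ?thesis using l l0(1) by blast
qed

lemma op_iso_sub_arrows: "op_iso A V \<rho> W \<sigma> \<Longrightarrow> B \<subseteq> A \<Longrightarrow> op_iso B V \<rho> W \<sigma>"
  unfolding op_iso_def using op_hom_sub_arrows by blast

lemma op_rep_sub_arrows: "op_rep A V \<rho> \<Longrightarrow> B \<subseteq> A \<Longrightarrow> op_rep B V \<rho>"
  unfolding op_rep_def by blast

text \<open>
  If every representation of the subcategory \<open>D\<close> is a summand of the restriction of some
  representation of \<open>C\<close>, then an indecomposable of \<open>D\<close> is already a summand of the restriction of an
  indecomposable of \<open>C\<close>, and each of those has finitely many summands.
\<close>

lemma fin_type_restrict:
  fixes C :: "('o, 'm, 'z) cat_scheme" and D :: "('p, 'm, 'y) cat_scheme"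
  assumes fin: "fin_type TYPE('j) TYPE('k::field) C" and sub: "Arr D \<subseteq> Arr C"
    and ind: "\<And>(N :: ('i \<Rightarrow> 'k) set) \<sigma>. cat_rep D N \<sigma> \<Longrightarrow> fin_support N \<Longrightarrow>
      \<exists>(Y :: ('j \<Rightarrow> 'k) set) \<tau>. cat_rep C Y \<tau> \<and> fin_support Y \<and> retract (Arr D) N \<sigma> Y \<tau>"
  shows "fin_type TYPE('i) TYPE('k) D"
proof -
  obtain F :: "(('j \<Rightarrow> 'k) set \<times> ('m \<Rightarrow> ('j \<Rightarrow> 'k) \<Rightarrow> ('j \<Rightarrow> 'k))) set" where F: "finite F"
    "\<And>W \<sigma>. (W, \<sigma>) \<in> F \<Longrightarrow> cat_rep C W \<sigma>" "\<And>W \<sigma>. (W, \<sigma>) \<in> F \<Longrightarrow> fin_support W"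
    "\<And>(V :: ('j \<Rightarrow> 'k) set) \<rho>. cat_rep C V \<rho> \<Longrightarrow> fin_support V \<Longrightarrow> indec (Arr C) V \<rho> \<Longrightarrow> \<exists>W \<sigma>. (W, \<sigma>) \<in> F \<and> op_iso (Arr C) V \<rho> W \<sigma>"
    by (rule fin_typeE[OF fin]) (rule that)
  have "\<exists>D'. finite D' \<and> (\<forall>U\<in>D'. op_rep (Arr D) U (snd Y) \<and> U \<subseteq> fst Y) \<and>
    (\<forall>(M :: ('i \<Rightarrow> 'k) set) \<mu>. op_rep (Arr D) M \<mu> \<and> fin_support M \<and> indec (Arr D) M \<mu> \<and> retract (Arr D) M \<mu> (fst Y) (snd Y) \<longrightarrow>
       (\<exists>U\<in>D'. op_iso (Arr D) M \<mu> U (snd Y)))" if "Y \<in> F" for Y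
    using that F(2,3)[of "fst Y" "snd Y"]
    by (intro finitely_many_indec_retracts) (auto intro: op_rep_sub_arrows[OF cat_repD(1) sub])
  then obtain Ret where Ret: "\<And>Y. Y \<in> F \<Longrightarrow> finite (Ret Y)"
    "\<And>Y U. Y \<in> F \<Longrightarrow> U \<in> Ret Y \<Longrightarrow> op_rep (Arr D) U (snd Y)"
    "\<And>Y (M :: ('i \<Rightarrow> 'k) set) \<mu>. Y \<in> F \<Longrightarrow> op_rep (Arr D) M \<mu> \<Longrightarrow> fin_support M \<Longrightarrow> indec (Arr D) M \<mu> \<Longrightarrow>
      retract (Arr D) M \<mu> (fst Y) (snd Y) \<Longrightarrow> \<exists>U\<in>Ret Y. op_iso (Arr D) M \<mu> U (snd Y)"
    by metis
  define S where "S = (SIGMA Y:F. Ret Y)"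
  show ?thesis
  proof (rule fin_typeI[where S = S and R = "\<lambda>N \<sigma> s. op_iso (Arr D) N \<sigma> (snd s) (snd (fst s))"])
    show "finite S" unfolding S_def using F(1) Ret(1) by blast
  next
    fix N :: "('i \<Rightarrow> 'k) set" and \<sigma>
    assume N: "cat_rep D N \<sigma>" "fin_support N" "indec (Arr D) N \<sigma>"
    obtain Y :: "('j \<Rightarrow> 'k) set" and \<tau> where Y: "cat_rep C Y \<tau>" "fin_support Y" "retract (Arr D) N \<sigma> Y \<tau>"
      using ind[OF N(1,2)] by blast
    obtain m U e where "decomp (Arr C) Y \<tau> m U e" using decomp_exists[OF cat_repD(1)[OF Y(1)] Y(2)] by blast
    note dec = decompD[OF this]
    have "\<exists>j\<in>{..<m}. retract (Arr D) N \<sigma> (U j) \<tau>"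
    proof (rule retract_component[OF cat_repD(1)[OF N(1)] N(2,3) Y(3), of _ U e])
      show "op_rep (Arr D) Y \<tau>" by (rule op_rep_sub_arrows[OF cat_repD(1)[OF Y(1)] sub])
      show "op_hom (Arr D) Y \<tau> (U j) \<tau> (e j)" if "j \<in> {..<m}" for j
        using dec(1)[of j] that op_hom_sub_arrows[OF _ sub] by auto
    qed (use dec in auto)
    then obtain j where j: "j < m" "retract (Arr D) N \<sigma> (U j) \<tau>" by blast
    have Uj: "op_rep (Arr C) (U j) \<tau>" "U j \<subseteq> Y" "indec (Arr C) (U j) \<tau>" using dec(1)[OF j(1)] by auto
    obtain W \<omega> where W: "(W, \<omega>) \<in> F" "op_iso (Arr C) (U j) \<tau> W \<omega>"
      using F(4)[OF cat_rep_sub[OF Y(1) Uj(1,2)] fin_support_mono[OF Y(2) Uj(2)] Uj(3)] by blast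
    have "retract (Arr D) (U j) \<tau> W \<omega>"
      by (rule op_iso_retr[OF op_iso_sub_arrows[OF W(2) sub] op_rep_sub_arrows[OF Uj(1) sub]])
    then have "retract (Arr D) N \<sigma> W \<omega>" by (rule retract_trans[OF j(2)])
    then obtain U' where "U' \<in> Ret (W, \<omega>)" "op_iso (Arr D) N \<sigma> U' \<omega>"
      using Ret(3)[OF W(1) cat_repD(1)[OF N(1)] N(2,3)] by auto
    then show "\<exists>s\<in>S. op_iso (Arr D) N \<sigma> (snd s) (snd (fst s))"
      using W(1) by (intro bexI[of _ "((W, \<omega>), U')"]) (auto simp: S_def)
  next
    fix V V' :: "('i \<Rightarrow> 'k) set" and \<rho> \<rho>' s
    assume "cat_rep D V \<rho>" "cat_rep D V' \<rho>'" "s \<in> S" "op_iso (Arr D) V \<rho> (snd s) (snd (fst s))"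
      "op_iso (Arr D) V' \<rho>' (snd s) (snd (fst s))"
    then show "op_iso (Arr D) V \<rho> V' \<rho>'"
      using op_iso_trans op_iso_sym cat_repD(1) by blast
  qed
qed

text \<open>
  Objects enter only through the identities and through composability, so the bijection \<open>h\<close> is one
  of arrows alone.
\<close>

lemma fin_type_category_iso:
  fixes C :: "('o, 'm, 'z) cat_scheme" and D :: "('p, 'n, 'y) cat_scheme"
  assumes fin: "fin_type TYPE('i) TYPE('k::field) D"
    and bij: "bij_betw h (Arr C) (Arr D)" and id: "h ` Ident C ` Obj C = Ident D ` Obj D" "Ident C ` Obj C \<subseteq> Arr C"
    and comp: "\<And>a b. a \<in> Arr C \<Longrightarrow> b \<in> Arr C \<Longrightarrow> Dom C a = Cod C b \<longleftrightarrow> Dom D (h a) = Cod D (h b)"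
      "\<And>a b. a \<in> Arr C \<Longrightarrow> b \<in> Arr C \<Longrightarrow> Dom C a = Cod C b \<Longrightarrow> h (Comp C a b) = Comp D (h a) (h b)"
    and closed: "\<And>a b. a \<in> Arr C \<Longrightarrow> b \<in> Arr C \<Longrightarrow> Dom C a = Cod C b \<Longrightarrow> Comp C a b \<in> Arr C"
  shows "fin_type TYPE('i) TYPE('k) C"
proof -
  obtain F :: "(('i \<Rightarrow> 'k) set \<times> ('n \<Rightarrow> ('i \<Rightarrow> 'k) \<Rightarrow> ('i \<Rightarrow> 'k))) set" where F: "finite F"
    "\<And>(V :: ('i \<Rightarrow> 'k) set) \<rho>. cat_rep D V \<rho> \<Longrightarrow> fin_support V \<Longrightarrow> indec (Arr D) V \<rho> \<Longrightarrow> \<exists>W \<sigma>. (W, \<sigma>) \<in> F \<and> op_iso (Arr D) V \<rho> W \<sigma>"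
    by (rule fin_typeE[OF fin]) blast
  define g where "g = inv_into (Arr C) h"
  have gh: "g (h a) = a" if "a \<in> Arr C" for a using bij_betw_inv_into_left[OF bij that] by (simp add: g_def)
  have img: "Arr D = h ` Arr C" using bij by (simp add: bij_betw_def)
  have op_rep: "op_rep (Arr D) V (\<lambda>b. \<rho> (g b)) \<longleftrightarrow> op_rep (Arr C) V \<rho>" for V :: "('i \<Rightarrow> 'k) set" and \<rho>
    unfolding op_rep_def img by (simp add: gh)
  show ?thesis
  proof (rule fin_typeI[where S = F and R = "\<lambda>V \<rho> s. op_iso (Arr D) V (\<lambda>b. \<rho> (g b)) (fst s) (snd s)"])
    fix V :: "('i \<Rightarrow> 'k) set" and \<rho>
    assume V: "cat_rep C V \<rho>" "fin_support V" "indec (Arr C) V \<rho>"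
    have "(\<Sum>b\<in>Ident D ` Obj D. \<rho> (g b) v) = v" if "v \<in> V" for v
    proof -
      have "(\<Sum>b\<in>h ` Ident C ` Obj C. \<rho> (g b) v) = (\<Sum>a\<in>Ident C ` Obj C. \<rho> (g (h a)) v)"
        using bij id(2) by (subst sum.reindex) (auto simp: bij_betw_def intro: inj_on_subset)
      also have "\<dots> = (\<Sum>a\<in>Ident C ` Obj C. \<rho> a v)" using gh id(2) by (intro sum.cong) auto
      finally show ?thesis using cat_repD(3)[OF V(1) that] id(1) by simp
    qed
    then have "cat_rep D V (\<lambda>b. \<rho> (g b))"
      using op_rep cat_repD(1,2)[OF V(1)] unfolding cat_rep_def img
      by (auto simp: gh comp(1)[symmetric] comp(2)[symmetric] closed)
    moreover have "indec (Arr D) V (\<lambda>b. \<rho> (g b))" using V(3) unfolding indec_def op_rep .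
    ultimately obtain W \<sigma> where "(W, \<sigma>) \<in> F" "op_iso (Arr D) V (\<lambda>b. \<rho> (g b)) W \<sigma>"
      using F(2) V(2) by blast
    then show "\<exists>s\<in>F. op_iso (Arr D) V (\<lambda>b. \<rho> (g b)) (fst s) (snd s)"
      by (intro bexI[of _ "(W, \<sigma>)"]) auto
  next
    fix V V' :: "('i \<Rightarrow> 'k) set" and \<rho> \<rho>' s
    assume V: "cat_rep C V \<rho>" "cat_rep C V' \<rho>'"
      and iso: "op_iso (Arr D) V (\<lambda>b. \<rho> (g b)) (fst s) (snd s)" "op_iso (Arr D) V' (\<lambda>b. \<rho>' (g b)) (fst s) (snd s)"
    have "op_iso (Arr D) V (\<lambda>b. \<rho> (g b)) V' (\<lambda>b. \<rho>' (g b))"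
      using op_iso_trans[OF iso(1) op_iso_sym[OF iso(2)]] op_rep cat_repD(1)[OF V(2)] by blast
    then show "op_iso (Arr C) V \<rho> V' \<rho>'"
      unfolding op_iso_def op_hom_def img by (simp add: gh)
  qed (rule F(1))
qed

section \<open>Representations as modules over the category algebra\<close>

definition rep_module :: "('o, 'm, 'z) cat_scheme \<Rightarrow> ('i \<Rightarrow> 'k::field) set \<Rightarrow> ('m \<Rightarrow> ('i \<Rightarrow> 'k) \<Rightarrow> ('i \<Rightarrow> 'k)) \<Rightarrow>
    ('m \<Rightarrow> 'k, 'i \<Rightarrow> 'k) module" where
  "rep_module C V \<rho> = \<lparr>carrier = V, monoid.mult = undefined, monoid.one = undefined, ring.zero = 0,
     ring.add = (+), module.smult = (\<lambda>f v. \<Sum>a\<in>Arr C. fscale (f a) (\<rho> a v))\<rparr>"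

lemma rep_module_simps [simp]:
  "carrier (rep_module C V \<rho>) = V" "\<zero>\<^bsub>rep_module C V \<rho>\<^esub> = 0"
  "x \<oplus>\<^bsub>rep_module C V \<rho>\<^esub> y = x + y"
  by (simp_all add: rep_module_def)

lemma rep_module_smult: "f \<odot>\<^bsub>rep_module C V \<rho>\<^esub> v = (\<Sum>a\<in>Arr C. fscale (f a) (\<rho> a v))"
  by (simp add: rep_module_def)

text \<open>
  The element \<open>c \<cdot> 1\<close> of the category algebra, which recovers scalar multiplication from the module
  structure.
\<close>

definition scal :: "('o, 'm, 'z) cat_scheme \<Rightarrow> 'k::field \<Rightarrow> 'm \<Rightarrow> 'k" where
  "scal C c = (\<lambda>a. if a \<in> Ident C ` Obj C then c else 0)"

definition basis :: "'m \<Rightarrow> 'm \<Rightarrow> 'k::field" where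
  "basis a = (\<lambda>b. if b = a then 1 else 0)"

context finite_category
begin

lemma Id_sub: "Ident C ` Obj C \<subseteq> Arr C"
  using Id_Arr by auto

lemma scal_carrier: "scal C c \<in> carrier (category_algebra TYPE('k::field) C)"
  using Id_sub by (auto simp: category_algebra_def scal_def)

lemma basis_carrier: "a \<in> Arr C \<Longrightarrow> basis a \<in> carrier (category_algebra TYPE('k::field) C)"
  by (auto simp: category_algebra_def basis_def)

lemma rep_smult_scal:
  assumes "cat_rep C V \<rho>" "v \<in> V"
  shows "scal C c \<odot>\<^bsub>rep_module C V \<rho>\<^esub> v = fscale c v"
proof -
  have "(\<Sum>a\<in>Arr C. fscale (scal C c a) (\<rho> a v)) = (\<Sum>a\<in>Ident C ` Obj C. fscale c (\<rho> a v))"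
    using Id_sub finite_Arr by (intro sum.mono_neutral_cong_right) (auto simp: scal_def)
  also have "\<dots> = fscale c v"
    using cat_repD(3)[OF assms] by (simp flip: fs.scale_sum_right)
  finally show ?thesis by (simp add: rep_module_smult)
qed

lemma rep_smult_basis:
  assumes "a \<in> Arr C"
  shows "basis a \<odot>\<^bsub>rep_module C V \<rho>\<^esub> v = \<rho> a v"
proof -
  have "(\<Sum>b\<in>Arr C. fscale (basis a b) (\<rho> b v)) = (\<Sum>b\<in>{a}. fscale 1 (\<rho> b v))"
    using assms finite_Arr by (intro sum.mono_neutral_cong_right) (auto simp: basis_def)
  then show ?thesis by (simp add: rep_module_smult)
qed

lemma rep_smult_closed:
  assumes "op_rep (Arr C) V \<rho>" "v \<in> V"
  shows "f \<odot>\<^bsub>rep_module C W \<rho>\<^esub> v \<in> V"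
  unfolding rep_module_smult using op_repD(1,2)[OF assms(1)] assms(2)
  by (intro fs.subspace_sum fs.subspace_scale) auto

lemma left_module_rep_module:
  fixes V :: "('i \<Rightarrow> 'k::field) set"
  assumes V: "cat_rep C V \<rho>"
  shows "left_module (category_algebra TYPE('k) C) (rep_module C V \<rho>)"
proof -
  let ?R = "category_algebra TYPE('k) C" and ?M = "rep_module C V \<rho>"
  note rep = cat_repD(1)[OF V] and sub = op_repD(1)[OF cat_repD(1)[OF V]]
  have ab: "abelian_group ?M"
  proof (rule abelian_groupI)
    show "\<exists>y\<in>carrier ?M. y \<oplus>\<^bsub>?M\<^esub> x = \<zero>\<^bsub>?M\<^esub>" if "x \<in> carrier ?M" for x
      using that fs.subspace_neg[OF sub] by (intro bexI[of _ "- x"]) auto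
  qed (use fs.subspace_add[OF sub] fs.subspace_0[OF sub] in \<open>auto simp: add_ac\<close>)
  have lin: "lin_on V (\<rho> a)" if "a \<in> Arr C" for a using op_repD(3)[OF rep that] .
  have mem: "\<rho> a v \<in> V" if "a \<in> Arr C" "v \<in> V" for a v using op_repD(2)[OF rep that] .
  have assoc: "(f \<otimes>\<^bsub>?R\<^esub> g) \<odot>\<^bsub>?M\<^esub> v = f \<odot>\<^bsub>?M\<^esub> (g \<odot>\<^bsub>?M\<^esub> v)" if v: "v \<in> V" for f g v
  proof -
    \<comment> \<open>the convolution product is regrouped as a sum over composable pairs; the other pairs act as zero\<close>
    define Pr where "Pr = {(a, b). a \<in> Arr C \<and> b \<in> Arr C \<and> Dom C a = Cod C b}"
    define h where "h p = fscale (f (fst p) * g (snd p)) (\<rho> (Comp C (fst p) (snd p)) v)" for p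
    have PA: "Pr \<subseteq> Arr C \<times> Arr C" by (auto simp: Pr_def)
    have fP: "finite Pr" by (rule finite_subset[OF PA]) (simp add: finite_Arr)
    have "(f \<otimes>\<^bsub>?R\<^esub> g) \<odot>\<^bsub>?M\<^esub> v = (\<Sum>c\<in>Arr C. \<Sum>p\<in>{p \<in> Pr. Comp C (fst p) (snd p) = c}. h p)"
      unfolding rep_module_smult
    proof (rule sum.cong[OF refl])
      fix c
      have S: "{(a, b). a \<in> Arr C \<and> b \<in> Arr C \<and> Dom C a = Cod C b \<and> Comp C a b = c} =
          {p \<in> Pr. Comp C (fst p) (snd p) = c}" by (auto simp: Pr_def)
      show "fscale ((f \<otimes>\<^bsub>?R\<^esub> g) c) (\<rho> c v) = (\<Sum>p\<in>{p \<in> Pr. Comp C (fst p) (snd p) = c}. h p)"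
        by (auto simp: category_algebra_def S fs.scale_sum_left h_def split_beta intro!: sum.cong)
    qed
    also have "\<dots> = (\<Sum>p\<in>Pr. h p)"
      by (rule sum.group[OF fP finite_Arr]) (auto simp: Pr_def Comp_Arr)
    also have "\<dots> = (\<Sum>p\<in>Arr C \<times> Arr C. fscale (f (fst p) * g (snd p)) (\<rho> (fst p) (\<rho> (snd p) v)))"
    proof (rule sum.mono_neutral_cong_left)
      show "\<forall>p\<in>Arr C \<times> Arr C - Pr. fscale (f (fst p) * g (snd p)) (\<rho> (fst p) (\<rho> (snd p) v)) = 0"
      proof
        fix p assume "p \<in> Arr C \<times> Arr C - Pr"
        then have "\<rho> (fst p) (\<rho> (snd p) v) = 0"
          using cat_repD(2)[OF V, of "fst p" "snd p" v] v by (auto simp: Pr_def)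
        then show "fscale (f (fst p) * g (snd p)) (\<rho> (fst p) (\<rho> (snd p) v)) = 0"
          by (simp only: fs.scale_zero_right)
      qed
      show "h p = fscale (f (fst p) * g (snd p)) (\<rho> (fst p) (\<rho> (snd p) v))" if "p \<in> Pr" for p
        using that cat_repD(2)[OF V, of "fst p" "snd p" v] v by (auto simp: Pr_def h_def)
    qed (use finite_Arr PA in auto)
    also have "\<dots> = (\<Sum>a\<in>Arr C. \<Sum>b\<in>Arr C. fscale (f a * g b) (\<rho> a (\<rho> b v)))"
      by (simp add: sum.cartesian_product split_beta)
    also have "\<dots> = f \<odot>\<^bsub>?M\<^esub> (g \<odot>\<^bsub>?M\<^esub> v)"
      unfolding rep_module_smult
    proof (rule sum.cong[OF refl])
      fix a assume a: "a \<in> Arr C"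
      have "\<rho> a (\<Sum>b\<in>Arr C. fscale (g b) (\<rho> b v)) = (\<Sum>b\<in>Arr C. \<rho> a (fscale (g b) (\<rho> b v)))"
        by (rule lin_on_sum[OF lin[OF a] sub]) (use mem v fs.subspace_scale[OF sub] in auto)
      also have "\<dots> = (\<Sum>b\<in>Arr C. fscale (g b) (\<rho> a (\<rho> b v)))"
        using mem v by (intro sum.cong) (auto simp: lin_onD(2)[OF lin[OF a]])
      finally show "(\<Sum>b\<in>Arr C. fscale (f a * g b) (\<rho> a (\<rho> b v))) =
          fscale (f a) (\<rho> a (\<Sum>b\<in>Arr C. fscale (g b) (\<rho> b v)))"
        by (simp add: fs.scale_sum_right)
    qed
    finally show ?thesis .
  qed
  have one: "\<one>\<^bsub>?R\<^esub> = scal C 1" by (simp add: category_algebra_def scal_def)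
  show ?thesis
    unfolding left_module_def left_module_axioms_def
  proof (intro conjI ballI allI impI ring_category_algebra ab)
    fix f g and v w :: "'i \<Rightarrow> 'k" assume v: "v \<in> carrier ?M"
    show "f \<odot>\<^bsub>?M\<^esub> v \<in> carrier ?M" using rep_smult_closed[OF rep] v by simp
    show "(f \<oplus>\<^bsub>?R\<^esub> g) \<odot>\<^bsub>?M\<^esub> v = f \<odot>\<^bsub>?M\<^esub> v \<oplus>\<^bsub>?M\<^esub> g \<odot>\<^bsub>?M\<^esub> v"
      by (simp add: rep_module_smult category_algebra_def fs.scale_left_distrib sum.distrib)
    show "(f \<otimes>\<^bsub>?R\<^esub> g) \<odot>\<^bsub>?M\<^esub> v = f \<odot>\<^bsub>?M\<^esub> (g \<odot>\<^bsub>?M\<^esub> v)" using assoc v by simp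
    show "\<one>\<^bsub>?R\<^esub> \<odot>\<^bsub>?M\<^esub> v = v" using rep_smult_scal[OF V] v by (simp add: one)
    assume w: "w \<in> carrier ?M"
    have "(\<Sum>a\<in>Arr C. fscale (f a) (\<rho> a (v + w))) = (\<Sum>a\<in>Arr C. fscale (f a) (\<rho> a v) + fscale (f a) (\<rho> a w))"
      using v w by (intro sum.cong) (auto simp: lin_onD(1)[OF lin] fs.scale_right_distrib)
    then show "f \<odot>\<^bsub>?M\<^esub> (v \<oplus>\<^bsub>?M\<^esub> w) = f \<odot>\<^bsub>?M\<^esub> v \<oplus>\<^bsub>?M\<^esub> f \<odot>\<^bsub>?M\<^esub> w"
      by (simp add: rep_module_smult sum.distrib)
  qed
qed

lemma a_inv_rep_module:
  fixes V :: "('i \<Rightarrow> 'k::field) set"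
  assumes V: "cat_rep C V \<rho>" and v: "v \<in> V"
  shows "\<ominus>\<^bsub>rep_module C V \<rho>\<^esub> v = - v"
proof -
  interpret left_module "category_algebra TYPE('k) C" "rep_module C V \<rho>"
    by (rule left_module_rep_module[OF V])
  show ?thesis
    by (rule M.minus_equality) (use v fs.subspace_neg[OF op_repD(1)[OF cat_repD(1)[OF V]]] in auto)
qed

text \<open>
  The elements \<open>scal C c\<close> and \<open>basis a\<close> generate the category algebra, so closure under them is the same as
  closure under the whole algebra.
\<close>

lemma submodule_rep_module:
  fixes V :: "('i \<Rightarrow> 'k::field) set"
  assumes V: "cat_rep C V \<rho>"
  shows "submodule U (category_algebra TYPE('k) C) (rep_module C V \<rho>) \<longleftrightarrow> op_rep (Arr C) U \<rho> \<and> U \<subseteq> V"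
proof
  let ?R = "category_algebra TYPE('k) C"
  assume "submodule U ?R (rep_module C V \<rho>)"
  then interpret U: submodule U ?R "rep_module C V \<rho>" .
  have UV: "U \<subseteq> V" using U.subset by simp
  have "fscale c u \<in> U" if "u \<in> U" for c u
    using U.smult_closed[OF scal_carrier that] rep_smult_scal[OF V] that UV by auto
  moreover have "\<rho> a u \<in> U" if "a \<in> Arr C" "u \<in> U" for a u
    using U.smult_closed[OF basis_carrier[OF that(1)] that(2)] unfolding rep_smult_basis[OF that(1)] .
  moreover have "u + v \<in> U" if "u \<in> U" "v \<in> U" for u v using U.m_closed[OF that] by simp
  moreover have "0 \<in> U" using U.one_closed by simp
  ultimately show "op_rep (Arr C) U \<rho> \<and> U \<subseteq> V"
    unfolding op_rep_def
    by (intro conjI ballI fs.subspaceI image_subsetI lin_on_subset[OF op_repD(3)[OF cat_repD(1)[OF V]] UV] UV)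
next
  let ?R = "category_algebra TYPE('k) C" and ?M = "rep_module C V \<rho>"
  assume U: "op_rep (Arr C) U \<rho> \<and> U \<subseteq> V"
  then have sub: "fs.subspace U" by (simp add: op_rep_def)
  show "submodule U ?R ?M"
  proof (intro submodule.intro subgroup.intro submodule_axioms.intro)
    show "inv\<^bsub>add_monoid ?M\<^esub> x \<in> U" if "x \<in> U" for x
      using a_inv_rep_module[OF V, of x] that U fs.subspace_neg[OF sub] unfolding a_inv_def by auto
  qed (use U sub fs.subspace_add[OF sub] fs.subspace_0[OF sub] rep_smult_closed in auto)
qed

lemma indecomposable_rep_module:
  fixes V :: "('i \<Rightarrow> 'k::field) set"
  assumes V: "cat_rep C V \<rho>"
  shows "indecomposable_module (category_algebra TYPE('k) C) (rep_module C V \<rho>) \<longleftrightarrow> indec (Arr C) V \<rho>"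
proof -
  have sum: "U <+>\<^bsub>rep_module C V \<rho>\<^esub> W = V \<longleftrightarrow> (\<forall>v\<in>V. \<exists>u\<in>U. \<exists>w\<in>W. v = u + w)"
    if "U \<subseteq> V" "W \<subseteq> V" for U W
    unfolding set_add_def set_mult_def
    using that fs.subspace_add[OF op_repD(1)[OF cat_repD(1)[OF V]]] by auto
  have eq: "(op_rep (Arr C) U \<rho> \<and> U \<subseteq> V) \<and> (op_rep (Arr C) W \<rho> \<and> W \<subseteq> V) \<and>
        U <+>\<^bsub>rep_module C V \<rho>\<^esub> W = V \<and> U \<inter> W = {0} \<longleftrightarrow>
      op_rep (Arr C) U \<rho> \<and> op_rep (Arr C) W \<rho> \<and> U \<subseteq> V \<and> W \<subseteq> V \<and> U \<inter> W = {0} \<and>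
        (\<forall>v\<in>V. \<exists>u\<in>U. \<exists>w\<in>W. v = u + w)" for U W
    using sum[of U W] by argo
  show ?thesis
    unfolding indecomposable_module_def indec_def submodule_rep_module[OF V] rep_module_simps eq
    using left_module_rep_module[OF V] by (simp only: simp_thms)
qed

lemma finsum_rep_module:
  fixes V :: "('i \<Rightarrow> 'k::field) set"
  assumes V: "cat_rep C V \<rho>" and "finite S" "f \<in> S \<rightarrow> V"
  shows "finsum (rep_module C V \<rho>) f S = sum f S"
proof -
  interpret left_module "category_algebra TYPE('k) C" "rep_module C V \<rho>"
    by (rule left_module_rep_module[OF V])
  show ?thesis
    using assms(2,3)
  proof (induction S rule: finite_induct)
    case empty
    show ?case by simp
  next
    case (insert x F)
    have "finsum (rep_module C V \<rho>) f (insert x F) = f x \<oplus>\<^bsub>rep_module C V \<rho>\<^esub> finsum (rep_module C V \<rho>) f F"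
      using insert by (intro M.finsum_insert) auto
    then show ?case using insert by simp
  qed
qed

text \<open>
  A basis over the field generates over the algebra.
\<close>

lemma finitely_generated_rep_module:
  fixes V :: "('i \<Rightarrow> 'k::field) set"
  assumes V: "cat_rep C V \<rho>" "fin_support V"
  shows "finitely_generated_module (category_algebra TYPE('k) C) (rep_module C V \<rho>)"
proof -
  obtain T where T: "finite T" "V \<subseteq> fs.span T" using fin_support_span[OF V(2)] by blast
  obtain B where B: "B \<subseteq> V" "fs.independent B" "V \<subseteq> fs.span B"
    by (rule fs.basis_exists[of V]) (rule that)
  have fB: "finite B" using fs.independent_span_bound[OF T(1) B(2) subset_trans[OF B(1) T(2)]] by (rule conjunct1)
  have "\<exists>c\<in>B \<rightarrow> carrier (category_algebra TYPE('k) C). x = (\<Oplus>\<^bsub>rep_module C V \<rho>\<^esub>a\<in>B. c a \<odot>\<^bsub>rep_module C V \<rho>\<^esub> a)"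
    if x: "x \<in> V" for x
  proof -
    have "x \<in> range (\<lambda>u. \<Sum>b\<in>B. fscale (u b) b)"
      using x B(3) unfolding fs.span_finite[OF fB] by (rule set_rev_mp)
    then obtain u where u: "x = (\<Sum>b\<in>B. fscale (u b) b)" by (rule rangeE)
    have "(\<Oplus>\<^bsub>rep_module C V \<rho>\<^esub>a\<in>B. scal C (u a) \<odot>\<^bsub>rep_module C V \<rho>\<^esub> a) = (\<Sum>a\<in>B. scal C (u a) \<odot>\<^bsub>rep_module C V \<rho>\<^esub> a)"
      by (rule finsum_rep_module[OF V(1) fB]) (rule funcsetI, rule rep_smult_closed[OF cat_repD(1)[OF V(1)] subsetD[OF B(1)]])
    also have "\<dots> = x"
      unfolding u by (rule sum.cong[OF refl]) (rule rep_smult_scal[OF V(1) subsetD[OF B(1)]])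
    finally have "x = (\<Oplus>\<^bsub>rep_module C V \<rho>\<^esub>a\<in>B. scal C (u a) \<odot>\<^bsub>rep_module C V \<rho>\<^esub> a)" by (rule sym)
    moreover have "(\<lambda>a. scal C (u a)) \<in> B \<rightarrow> carrier (category_algebra TYPE('k) C)"
      using scal_carrier by (rule funcsetI)
    ultimately show ?thesis by (rule bexI)
  qed
  then show ?thesis
    unfolding finitely_generated_module_def rep_module_simps using left_module_rep_module[OF V(1)] fB B(1)
    by (intro conjI exI[of _ B] ballI)
qed

lemma rep_module_iso_iff:
  fixes V :: "('i \<Rightarrow> 'k::field) set" and W :: "('j \<Rightarrow> 'k) set"
  assumes V: "cat_rep C V \<rho>" and W: "cat_rep C W \<sigma>"
  shows "module_iso (category_algebra TYPE('k) C) (rep_module C V \<rho>) (rep_module C W \<sigma>) \<noteq> {} \<longleftrightarrow>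
    op_iso (Arr C) V \<rho> W \<sigma>"
proof
  let ?R = "category_algebra TYPE('k) C"
  assume "module_iso ?R (rep_module C V \<rho>) (rep_module C W \<sigma>) \<noteq> {}"
  then obtain f where f: "f \<in> iso (add_monoid (rep_module C V \<rho>)) (add_monoid (rep_module C W \<sigma>))"
    and sm: "\<And>r x. r \<in> carrier ?R \<Longrightarrow> x \<in> V \<Longrightarrow> f (r \<odot>\<^bsub>rep_module C V \<rho>\<^esub> x) = r \<odot>\<^bsub>rep_module C W \<sigma>\<^esub> f x"
    unfolding module_iso_def by auto
  have bij: "bij_betw f V W" and add: "\<And>x y. x \<in> V \<Longrightarrow> y \<in> V \<Longrightarrow> f (x + y) = f x + f y"
    using f by (auto simp: iso_def hom_def)
  have mem: "f v \<in> W" if "v \<in> V" for v using bij that by (auto simp: bij_betw_def)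
  have "f (fscale c v) = fscale c (f v)" if "v \<in> V" for c v
    using sm[OF scal_carrier that] rep_smult_scal[OF V that] rep_smult_scal[OF W mem[OF that]] by simp
  moreover have "f (\<rho> a v) = \<sigma> a (f v)" if "a \<in> Arr C" "v \<in> V" for a v
    using sm[OF basis_carrier[OF that(1)] that(2)]
      rep_smult_basis[OF that(1), of V \<rho> v] rep_smult_basis[OF that(1), of W \<sigma> "f v"] by simp
  ultimately have "op_hom (Arr C) V \<rho> W \<sigma> f"
    using add mem unfolding op_hom_def lin_on_def by blast
  then show "op_iso (Arr C) V \<rho> W \<sigma>" using bij unfolding op_iso_def by blast
next
  let ?R = "category_algebra TYPE('k) C"
  assume "op_iso (Arr C) V \<rho> W \<sigma>"
  then obtain f where f: "op_hom (Arr C) V \<rho> W \<sigma> f" "bij_betw f V W" unfolding op_iso_def by blast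
  note h = op_homD[OF f(1)] and rep = cat_repD(1)[OF V]
  have "f (r \<odot>\<^bsub>rep_module C V \<rho>\<^esub> x) = r \<odot>\<^bsub>rep_module C W \<sigma>\<^esub> f x" if x: "x \<in> V" for r x
  proof -
    have "f (\<Sum>a\<in>Arr C. fscale (r a) (\<rho> a x)) = (\<Sum>a\<in>Arr C. f (fscale (r a) (\<rho> a x)))"
      using op_repD(1,2)[OF rep] x by (intro lin_on_sum[OF h(1)]) (auto intro: fs.subspace_scale)
    also have "\<dots> = (\<Sum>a\<in>Arr C. fscale (r a) (\<sigma> a (f x)))"
      using op_repD(2)[OF rep] x by (intro sum.cong) (auto simp: lin_onD(2)[OF h(1)] h(3))
    finally show ?thesis by (simp add: rep_module_smult)
  qed
  then have "f \<in> module_iso ?R (rep_module C V \<rho>) (rep_module C W \<sigma>)"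
    unfolding module_iso_def using f(2) h(2) lin_onD(1)[OF h(1)] by (auto simp: iso_def hom_def)
  then show "module_iso ?R (rep_module C V \<rho>) (rep_module C W \<sigma>) \<noteq> {}" by blast
qed

end

lemma (in left_module) smult_l_null: "x \<in> carrier M \<Longrightarrow> \<zero>\<^bsub>R\<^esub> \<odot>\<^bsub>M\<^esub> x = \<zero>\<^bsub>M\<^esub>"
  using smult_l_distr[of "\<zero>\<^bsub>R\<^esub>" "\<zero>\<^bsub>R\<^esub>" x] by (simp add: M.add.l_cancel_one')

lemma (in left_module) smult_r_null: "a \<in> carrier R \<Longrightarrow> a \<odot>\<^bsub>M\<^esub> \<zero>\<^bsub>M\<^esub> = \<zero>\<^bsub>M\<^esub>"
  using smult_r_distr[of a "\<zero>\<^bsub>M\<^esub>" "\<zero>\<^bsub>M\<^esub>"] by (simp add: M.add.l_cancel_one')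

lemma (in left_module) smult_finsum:
  assumes "finite S" "a \<in> carrier R" "f \<in> S \<rightarrow> carrier M"
  shows "a \<odot>\<^bsub>M\<^esub> finsum M f S = finsum M (\<lambda>i. a \<odot>\<^bsub>M\<^esub> f i) S"
  using assms(1,3)
proof (induction S rule: finite_induct)
  case empty
  then show ?case using smult_r_null[OF assms(2)] by simp
next
  case (insert x F)
  then have "f x \<in> carrier M" "f \<in> F \<rightarrow> carrier M" by auto
  then show ?case
    using insert.IH insert.hyps assms(2) by (simp add: M.finsum_insert smult_r_distr Pi_iff)
qed

lemma module_isoD:
  assumes "f \<in> module_iso R M N"
  shows "bij_betw f (carrier M) (carrier N)" "x \<in> carrier M \<Longrightarrow> f x \<in> carrier N"
    "x \<in> carrier M \<Longrightarrow> y \<in> carrier M \<Longrightarrow> f (x \<oplus>\<^bsub>M\<^esub> y) = f x \<oplus>\<^bsub>N\<^esub> f y"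
    "r \<in> carrier R \<Longrightarrow> x \<in> carrier M \<Longrightarrow> f (r \<odot>\<^bsub>M\<^esub> x) = r \<odot>\<^bsub>N\<^esub> f x"
  using assms by (auto simp: module_iso_def iso_def hom_def)

lemma module_isoI:
  assumes "bij_betw f (carrier M) (carrier N)"
    "\<And>x y. x \<in> carrier M \<Longrightarrow> y \<in> carrier M \<Longrightarrow> f (x \<oplus>\<^bsub>M\<^esub> y) = f x \<oplus>\<^bsub>N\<^esub> f y"
    "\<And>r x. r \<in> carrier R \<Longrightarrow> x \<in> carrier M \<Longrightarrow> f (r \<odot>\<^bsub>M\<^esub> x) = r \<odot>\<^bsub>N\<^esub> f x"
  shows "f \<in> module_iso R M N"
  using assms bij_betwE[OF assms(1)] by (auto simp: module_iso_def iso_def hom_def)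

lemma module_iso_trans:
  assumes "f \<in> module_iso R M N" "g \<in> module_iso R N Q"
  shows "(\<lambda>x. g (f x)) \<in> module_iso R M Q"
  using bij_betw_trans[OF module_isoD(1)[OF assms(1)] module_isoD(1)[OF assms(2)]]
    module_isoD(2-4)[OF assms(1)] module_isoD(2-4)[OF assms(2)]
  by (intro module_isoI) (auto simp: o_def)

lemma module_iso_sym:
  assumes M: "left_module R M" and f: "f \<in> module_iso R M N"
  shows "inv_into (carrier M) f \<in> module_iso R N M"
proof -
  interpret M: left_module R M by (rule M)
  note f = module_isoD[OF f]
  let ?g = "inv_into (carrier M) f"
  have g: "?g y \<in> carrier M" "f (?g y) = y" if "y \<in> carrier N" for y
    using that f(1) by (auto simp: bij_betw_def inv_into_into f_inv_into_f)
  have eq: "?g y = x" if "x \<in> carrier M" "y = f x" for x y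
    using that bij_betw_inv_into_left[OF f(1)] by simp
  show ?thesis
  proof (rule module_isoI)
    show "bij_betw ?g (carrier N) (carrier M)" by (rule bij_betw_inv_into[OF f(1)])
    show "?g (x \<oplus>\<^bsub>N\<^esub> y) = ?g x \<oplus>\<^bsub>M\<^esub> ?g y" if "x \<in> carrier N" "y \<in> carrier N" for x y
      using g that by (intro eq) (auto simp: f(3))
    show "?g (r \<odot>\<^bsub>N\<^esub> x) = r \<odot>\<^bsub>M\<^esub> ?g x" if "r \<in> carrier R" "x \<in> carrier N" for r x
      using g that by (intro eq) (auto simp: f(4))
  qed
qed

lemma module_iso_zero:
  assumes M: "left_module R M" and N: "left_module R N" and f: "f \<in> module_iso R M N"
  shows "f \<zero>\<^bsub>M\<^esub> = \<zero>\<^bsub>N\<^esub>"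
proof -
  interpret M: left_module R M by (rule M)
  interpret N: left_module R N by (rule N)
  show ?thesis
    using module_isoD(3)[OF f, of "\<zero>\<^bsub>M\<^esub>" "\<zero>\<^bsub>M\<^esub>"] module_isoD(2)[OF f, of "\<zero>\<^bsub>M\<^esub>"]
    by (simp add: N.M.add.l_cancel_one')
qed

lemma module_iso_finsum:
  assumes M: "left_module R M" and N: "left_module R N" and f: "f \<in> module_iso R M N"
    and S: "finite S" "h \<in> S \<rightarrow> carrier M"
  shows "f (finsum M h S) = finsum N (\<lambda>i. f (h i)) S"
proof -
  interpret M: left_module R M by (rule M)
  interpret N: left_module R N by (rule N)
  show ?thesis
    using S
  proof (induction S rule: finite_induct)
    case empty
    then show ?case using module_iso_zero[OF M N f] by simp
  next
    case (insert x F)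
    then have "h x \<in> carrier M" "h \<in> F \<rightarrow> carrier M" by auto
    then show ?case
      using insert.IH insert.hyps module_isoD(2)[OF f]
      by (simp add: M.M.finsum_insert N.M.finsum_insert module_isoD(3)[OF f] Pi_iff)
  qed
qed

lemma finitely_generated_module_iso:
  assumes M: "finitely_generated_module R M" and N: "left_module R N" and f: "f \<in> module_iso R M N"
  shows "finitely_generated_module R N"
proof -
  from M obtain A where Mm: "left_module R M" and A: "finite A" "A \<subseteq> carrier M"
    and gen: "\<And>x. x \<in> carrier M \<Longrightarrow> \<exists>c\<in>A \<rightarrow> carrier R. x = (\<Oplus>\<^bsub>M\<^esub>a\<in>A. c a \<odot>\<^bsub>M\<^esub> a)"
    unfolding finitely_generated_module_def by blast
  interpret M: left_module R M by (rule Mm)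
  interpret N: left_module R N by (rule N)
  have inj: "inj_on f A" using module_isoD(1)[OF f] A(2) by (auto simp: bij_betw_def intro: inj_on_subset)
  have "\<exists>c\<in>f ` A \<rightarrow> carrier R. y = (\<Oplus>\<^bsub>N\<^esub>a\<in>f ` A. c a \<odot>\<^bsub>N\<^esub> a)" if y: "y \<in> carrier N" for y
  proof -
    obtain x where x: "x \<in> carrier M" "y = f x" using y module_isoD(1)[OF f] by (auto simp: bij_betw_def)
    obtain c where c: "c \<in> A \<rightarrow> carrier R" "x = (\<Oplus>\<^bsub>M\<^esub>a\<in>A. c a \<odot>\<^bsub>M\<^esub> a)" using gen[OF x(1)] by blast
    let ?c = "\<lambda>b. c (inv_into A f b)"
    have fA: "f a \<in> carrier N" if "a \<in> A" for a using that A(2) module_isoD(2)[OF f] by blast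
    have "y = (\<Oplus>\<^bsub>N\<^esub>a\<in>A. f (c a \<odot>\<^bsub>M\<^esub> a))"
      unfolding x(2) c(2) by (rule module_iso_finsum[OF Mm N f A(1)]) (use c(1) A(2) in auto)
    also have "\<dots> = (\<Oplus>\<^bsub>N\<^esub>a\<in>A. ?c (f a) \<odot>\<^bsub>N\<^esub> f a)"
      using inj c(1) A(2) fA by (intro N.M.finsum_cong') (auto simp: module_isoD(4)[OF f] Pi_iff subset_iff)
    also have "\<dots> = (\<Oplus>\<^bsub>N\<^esub>b\<in>f ` A. ?c b \<odot>\<^bsub>N\<^esub> b)"
      using inj c(1) fA by (intro N.M.finsum_reindex[symmetric]) (auto simp: Pi_iff)
    finally show ?thesis
      using c(1) inj by (intro bexI[of _ ?c]) auto
  qed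
  then show ?thesis
    unfolding finitely_generated_module_def using N A module_isoD(2)[OF f]
    by (intro conjI exI[of _ "f ` A"]) auto
qed

lemma indecomposable_module_iso:
  assumes M: "left_module R M" and N: "left_module R N" and f: "f \<in> module_iso R M N"
    and ind: "indecomposable_module R M"
  shows "indecomposable_module R N"
proof -
  interpret M: left_module R M by (rule M)
  interpret N: left_module R N by (rule N)
  define g where "g = inv_into (carrier M) f"
  have g: "g \<in> module_iso R N M" unfolding g_def by (rule module_iso_sym[OF M f])
  note gD = module_isoD[OF g]
  have g0: "g \<zero>\<^bsub>N\<^esub> = \<zero>\<^bsub>M\<^esub>" by (rule module_iso_zero[OF N M g])
  have inj: "inj_on g (carrier N)" and img: "g ` carrier N = carrier M" using gD(1) by (auto simp: bij_betw_def)
  have nz: "carrier N \<noteq> {\<zero>\<^bsub>N\<^esub>}"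
    using ind img g0 unfolding indecomposable_module_def by auto
  have sub: "submodule (g ` A) R M" if A: "submodule A R N" for A
  proof -
    interpret A: submodule A R N by (rule A)
    have "group_hom (add_monoid N) (add_monoid M) g"
      using g N.M.a_group M.M.a_group
      by (auto simp: group_hom_def group_hom_axioms_def module_iso_def iso_def)
    then have "subgroup (g ` A) (add_monoid M)"
      using A.subgroup_axioms by (rule group_hom.subgroup_img_is_subgroup)
    moreover have "a \<odot>\<^bsub>M\<^esub> x \<in> g ` A" if "a \<in> carrier R" "x \<in> g ` A" for a x
    proof -
      from that(2) obtain y where y: "y \<in> A" "x = g y" by blast
      then have "a \<odot>\<^bsub>M\<^esub> x = g (a \<odot>\<^bsub>N\<^esub> y)" using gD(4)[OF that(1)] A.subset by auto
      then show ?thesis using A.smult_closed[OF that(1) y(1)] by simp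
    qed
    ultimately show ?thesis by (intro submodule.intro submodule_axioms.intro)
  qed
  have "A = {\<zero>\<^bsub>N\<^esub>} \<or> B = {\<zero>\<^bsub>N\<^esub>}"
    if A: "submodule A R N" and B: "submodule B R N" and sum: "A <+>\<^bsub>N\<^esub> B = carrier N" and int: "A \<inter> B = {\<zero>\<^bsub>N\<^esub>}" for A B
  proof -
    interpret A: submodule A R N by (rule A)
    interpret B: submodule B R N by (rule B)
    have AB: "A \<subseteq> carrier N" "B \<subseteq> carrier N" using A.subset B.subset by auto
    have "g ` A <+>\<^bsub>M\<^esub> g ` B = (\<Union>a\<in>A. \<Union>b\<in>B. {g a \<oplus>\<^bsub>M\<^esub> g b})"
      by (simp add: set_add_def set_mult_def)
    also have "\<dots> = (\<Union>a\<in>A. \<Union>b\<in>B. {g (a \<oplus>\<^bsub>N\<^esub> b)})"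
      by (intro SUP_cong refl) (simp add: gD(3)[OF subsetD[OF AB(1)] subsetD[OF AB(2)]])
    also have "\<dots> = g ` (A <+>\<^bsub>N\<^esub> B)"
      by (simp add: set_add_def set_mult_def image_UN)
    finally have "g ` A <+>\<^bsub>M\<^esub> g ` B = g ` (A <+>\<^bsub>N\<^esub> B)" .
    then have "g ` A <+>\<^bsub>M\<^esub> g ` B = carrier M" using sum img by simp
    moreover have "g ` A \<inter> g ` B = {\<zero>\<^bsub>M\<^esub>}"
      using inj_on_image_Int[OF inj AB] int g0 by simp
    ultimately have "g ` A = {\<zero>\<^bsub>M\<^esub>} \<or> g ` B = {\<zero>\<^bsub>M\<^esub>}"
      using ind sub[OF A] sub[OF B] unfolding indecomposable_module_def by blast
    moreover have "D = {\<zero>\<^bsub>N\<^esub>}" if "g ` D = {\<zero>\<^bsub>M\<^esub>}" "D \<subseteq> carrier N" for D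
    proof -
      have "g ` D = g ` {\<zero>\<^bsub>N\<^esub>}" using that(1) g0 by simp
      then show ?thesis using inj_on_image_eq_iff[OF inj that(2), of "{\<zero>\<^bsub>N\<^esub>}"] by simp
    qed
    ultimately show ?thesis using AB by blast
  qed
  then show ?thesis unfolding indecomposable_module_def using N nz by blast
qed

context finite_category
begin

lemma scal_one: "scal C 1 = \<one>\<^bsub>category_algebra TYPE('k::field) C\<^esub>"
  by (simp add: category_algebra_def scal_def)

lemma scal_add: "scal C (c + d) = scal C c \<oplus>\<^bsub>category_algebra TYPE('k::field) C\<^esub> scal C d"
  by (auto simp: category_algebra_def scal_def)

lemma scal_zero: "scal C 0 = \<zero>\<^bsub>category_algebra TYPE('k::field) C\<^esub>"
  by (auto simp: category_algebra_def scal_def)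

lemma scal_mult:
  assumes "r \<in> carrier (category_algebra TYPE('k::field) C)"
  shows "scal C c \<otimes>\<^bsub>category_algebra TYPE('k) C\<^esub> r = (\<lambda>a. c * r a)"
    "r \<otimes>\<^bsub>category_algebra TYPE('k) C\<^esub> scal C c = (\<lambda>a. c * r a)"
proof -
  interpret R: ring "category_algebra TYPE('k) C" by (rule ring_category_algebra)
  have s: "scal C c = (\<lambda>a. c * \<one>\<^bsub>category_algebra TYPE('k) C\<^esub> a)"
    by (auto simp: scal_def category_algebra_def)
  have "scal C c \<otimes>\<^bsub>category_algebra TYPE('k) C\<^esub> r =
      (\<lambda>a. c * (\<one>\<^bsub>category_algebra TYPE('k) C\<^esub> \<otimes>\<^bsub>category_algebra TYPE('k) C\<^esub> r) a)"
    unfolding s by (rule ext) (simp add: category_algebra_def sum_distrib_left split_beta mult.assoc)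
  then show "scal C c \<otimes>\<^bsub>category_algebra TYPE('k) C\<^esub> r = (\<lambda>a. c * r a)" using R.l_one[OF assms] by simp
  have "r \<otimes>\<^bsub>category_algebra TYPE('k) C\<^esub> scal C c =
      (\<lambda>a. c * (r \<otimes>\<^bsub>category_algebra TYPE('k) C\<^esub> \<one>\<^bsub>category_algebra TYPE('k) C\<^esub>) a)"
    unfolding s by (rule ext) (simp add: category_algebra_def sum_distrib_left split_beta mult_ac)
  then show "r \<otimes>\<^bsub>category_algebra TYPE('k) C\<^esub> scal C c = (\<lambda>a. c * r a)" using R.r_one[OF assms] by simp
qed

lemma basis_mult:
  assumes "a \<in> Arr C" "b \<in> Arr C"
  shows "basis a \<otimes>\<^bsub>category_algebra TYPE('k::field) C\<^esub> basis b =
    (if Dom C a = Cod C b then basis (Comp C a b) else \<zero>\<^bsub>category_algebra TYPE('k) C\<^esub>)"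
proof
  fix c
  let ?S = "{(x, y). x \<in> Arr C \<and> y \<in> Arr C \<and> Dom C x = Cod C y \<and> Comp C x y = c}"
  have fS: "finite ?S" by (rule finite_subset[of _ "Arr C \<times> Arr C"]) (auto simp: finite_Arr)
  have "(basis a \<otimes>\<^bsub>category_algebra TYPE('k) C\<^esub> basis b) c = (\<Sum>p\<in>?S. if p = (a, b) then 1 else 0)"
    by (auto simp: category_algebra_def basis_def intro!: sum.cong)
  also have "\<dots> = (if (a, b) \<in> ?S then 1 else 0)" using fS by simp
  finally show "(basis a \<otimes>\<^bsub>category_algebra TYPE('k) C\<^esub> basis b) c =
      (if Dom C a = Cod C b then basis (Comp C a b) else \<zero>\<^bsub>category_algebra TYPE('k) C\<^esub>) c"
    using assms by (auto simp: category_algebra_def basis_def)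
qed

lemma smult_eq_finsum:
  assumes M: "left_module (category_algebra TYPE('k::field) C) M"
    and r: "r \<in> carrier (category_algebra TYPE('k) C)" and x: "x \<in> carrier M"
  shows "r \<odot>\<^bsub>M\<^esub> x = (\<Oplus>\<^bsub>M\<^esub>a\<in>Arr C. scal C (r a) \<odot>\<^bsub>M\<^esub> (basis a \<odot>\<^bsub>M\<^esub> x))"
proof -
  let ?R = "category_algebra TYPE('k) C"
  interpret M: left_module ?R M by (rule M)
  define res where "res S = (\<lambda>a. if a \<in> S then r a else 0)" for S
  have res: "res S \<in> carrier ?R" if "S \<subseteq> Arr C" for S using that by (auto simp: category_algebra_def res_def)
  have "S \<subseteq> Arr C \<Longrightarrow> res S \<odot>\<^bsub>M\<^esub> x = (\<Oplus>\<^bsub>M\<^esub>a\<in>S. scal C (r a) \<odot>\<^bsub>M\<^esub> (basis a \<odot>\<^bsub>M\<^esub> x))" if "finite S" for S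
    using that
  proof (induction S rule: finite_induct)
    case empty
    have "res {} = \<zero>\<^bsub>?R\<^esub>" by (simp add: res_def category_algebra_def)
    then show ?case using M.smult_l_null[OF x] by simp
  next
    case (insert b F)
    then have bF: "b \<in> Arr C" "F \<subseteq> Arr C" by auto
    have sb: "scal C (r b) \<in> carrier ?R" by (rule scal_carrier)
    have bb: "basis b \<in> carrier ?R" by (rule basis_carrier[OF bF(1)])
    have "res (insert b F) = (scal C (r b) \<otimes>\<^bsub>?R\<^esub> basis b) \<oplus>\<^bsub>?R\<^esub> res F"
      unfolding scal_mult(1)[OF basis_carrier[OF bF(1)]]
      using insert.hyps by (auto simp: res_def category_algebra_def basis_def)
    then have "res (insert b F) \<odot>\<^bsub>M\<^esub> x = scal C (r b) \<odot>\<^bsub>M\<^esub> (basis b \<odot>\<^bsub>M\<^esub> x) \<oplus>\<^bsub>M\<^esub> res F \<odot>\<^bsub>M\<^esub> x"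
      using x sb bb res[OF bF(2)]
      by (simp add: M.smult_l_distr M.smult_assoc1)
    moreover have "(\<lambda>a. scal C (r a) \<odot>\<^bsub>M\<^esub> (basis a \<odot>\<^bsub>M\<^esub> x)) \<in> F \<rightarrow> carrier M"
      using bF(2) x scal_carrier basis_carrier by (intro funcsetI M.smult_closed) auto
    ultimately show ?case
      using insert bF x sb bb by (simp add: M.M.finsum_insert)
  qed
  from this[OF finite_Arr] have "res (Arr C) \<odot>\<^bsub>M\<^esub> x = (\<Oplus>\<^bsub>M\<^esub>a\<in>Arr C. scal C (r a) \<odot>\<^bsub>M\<^esub> (basis a \<odot>\<^bsub>M\<^esub> x))" by simp
  moreover have "res (Arr C) = r" using r by (auto simp: res_def category_algebra_def)
  ultimately show ?thesis by simp
qed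

end

text \<open>
  A subspace of maximal dimension among those meeting \<open>K\<close> trivially is a complement of \<open>K\<close>.
\<close>

lemma subspace_complement:
  fixes E :: "('i \<Rightarrow> 'k::field) set"
  assumes E: "fs.subspace E" "fin_support E" and K: "fs.subspace K" "K \<subseteq> E"
  shows "\<exists>V. fs.subspace V \<and> V \<subseteq> E \<and> V \<inter> K = {0} \<and> (\<forall>u\<in>E. \<exists>w\<in>V. u - w \<in> K)"
proof -
  define P where "P V \<longleftrightarrow> fs.subspace V \<and> V \<subseteq> E \<and> V \<inter> K = {0}" for V
  have "P {0}" unfolding P_def using fs.subspace_0[OF E(1)] fs.subspace_0[OF K(1)] by auto
  moreover have "\<forall>V. P V \<longrightarrow> fs.dim V < Suc (fs.dim E)"
    using dim_mono[OF _ E(2)] by (simp add: P_def less_Suc_eq_le)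
  ultimately obtain V where V: "P V" "\<And>U. P U \<Longrightarrow> fs.dim U \<le> fs.dim V"
    using ex_has_greatest_nat[of P "{0}" fs.dim "Suc (fs.dim E)"] by auto
  have sV: "fs.subspace V" and VE: "V \<subseteq> E" and VK: "V \<inter> K = {0}" using V(1) by (auto simp: P_def)
  have "\<exists>w\<in>V. u - w \<in> K" if u: "u \<in> E" for u
  proof (rule ccontr)
    assume no: "\<not> (\<exists>w\<in>V. u - w \<in> K)"
    define U where "U = fs.span (insert u V)"
    have UE: "U \<subseteq> E" unfolding U_def using u VE E(1) by (intro fs.span_minimal) auto
    have "y = 0" if y: "y \<in> U" "y \<in> K" for y
    proof -
      have "y \<in> {x. \<exists>k. x - fscale k u \<in> V}"
        using y(1) sV unfolding U_def fs.span_insert by (simp add: fs.span_eq_iff[THEN iffD2])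
      then obtain k where k: "y - fscale k u \<in> V" by blast
      show ?thesis
      proof (cases "k = 0")
        case True
        then have "y \<in> V" using k by simp
        then show ?thesis using y(2) VK by blast
      next
        case False
        have "fscale (- inverse k) (y - fscale k u) \<in> V" by (rule fs.subspace_scale[OF sV k])
        moreover have "u - fscale (- inverse k) (y - fscale k u) = fscale (inverse k) y"
          using False by (simp add: fs.scale_right_diff_distrib)
        then have "u - fscale (- inverse k) (y - fscale k u) \<in> K"
          using fs.subspace_scale[OF K(1) y(2)] by metis
        ultimately show ?thesis using no by blast
      qed
    qed
    then have "U \<inter> K = {0}"
      using fs.subspace_0[OF K(1)] fs.span_zero[of "insert u V"] unfolding U_def by blast
    then have "P U" unfolding P_def using UE by (simp add: U_def)
    then have "fs.dim U \<le> fs.dim V" by (rule V(2))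
    moreover have "u \<notin> V" using no fs.subspace_0[OF K(1)] by (metis diff_self)
    then have "V \<subset> U" unfolding U_def using fs.span_superset[of "insert u V"] by blast
    then have "fs.dim V < fs.dim U" by (rule dim_less[OF sV fin_support_mono[OF E(2) UE]])
    ultimately show False by simp
  qed
  then show ?thesis using sV VE VK by blast
qed

context finite_category
begin

text \<open>
  A finitely generated module is finite-dimensional, hence the image of some \<open>k\<^sup>n\<close> under a linear
  map \<open>L\<close>. The representation lives on a complement of the kernel of \<open>L\<close> and is transported along \<open>L\<close>;
  a complement is used in place of the quotient in order to stay within function spaces.
\<close>

lemma module_to_rep:
  fixes M :: "('m \<Rightarrow> 'k::field, 'n, 't) module_scheme"
  assumes fg: "finitely_generated_module (category_algebra TYPE('k) C) M"
  shows "\<exists>(V :: (nat \<Rightarrow> 'k) set) \<rho>. cat_rep C V \<rho> \<and> fin_support V \<and>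
    module_iso (category_algebra TYPE('k) C) (rep_module C V \<rho>) M \<noteq> {}"
proof -
  let ?R = "category_algebra TYPE('k) C"
  from fg obtain A where Mm: "left_module ?R M" and A: "finite A" "A \<subseteq> carrier M"
    and gen: "\<And>x. x \<in> carrier M \<Longrightarrow> \<exists>c\<in>A \<rightarrow> carrier ?R. x = (\<Oplus>\<^bsub>M\<^esub>a\<in>A. c a \<odot>\<^bsub>M\<^esub> a)"
    unfolding finitely_generated_module_def by blast
  interpret M: left_module ?R M by (rule Mm)
  define sc where "sc c x = (scal C c :: 'm \<Rightarrow> 'k) \<odot>\<^bsub>M\<^esub> x" for c x
  define ac where "ac a x = (basis a :: 'm \<Rightarrow> 'k) \<odot>\<^bsub>M\<^esub> x" for a x
  have sR: "(scal C c :: 'm \<Rightarrow> 'k) \<in> carrier ?R" for c by (rule scal_carrier)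
  have bR: "(basis a :: 'm \<Rightarrow> 'k) \<in> carrier ?R" if "a \<in> Arr C" for a using that by (rule basis_carrier)
  have sc_closed: "sc c x \<in> carrier M" if "x \<in> carrier M" for c x
    unfolding sc_def using sR that by (rule M.smult_closed)
  have ac_closed: "ac a x \<in> carrier M" if "a \<in> Arr C" "x \<in> carrier M" for a x
    unfolding ac_def using bR[OF that(1)] that(2) by (rule M.smult_closed)
  have sc_add: "sc (c + d) x = sc c x \<oplus>\<^bsub>M\<^esub> sc d x" if "x \<in> carrier M" for c d x
    unfolding sc_def scal_add using M.smult_l_distr[OF sR sR that] .
  have sc_zero: "sc 0 x = \<zero>\<^bsub>M\<^esub>" if "x \<in> carrier M" for x
    unfolding sc_def scal_zero using M.smult_l_null[OF that] .
  have sc_one: "sc 1 x = x" if "x \<in> carrier M" for x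
    unfolding sc_def scal_one using M.smult_one[OF that] .
  have sc_sc: "sc (c * d) x = sc c (sc d x)" if "x \<in> carrier M" for c d x
  proof -
    have "(scal C (c * d) :: 'm \<Rightarrow> 'k) = scal C c \<otimes>\<^bsub>?R\<^esub> scal C d"
      unfolding scal_mult(1)[OF sR] by (auto simp: scal_def)
    then show ?thesis unfolding sc_def using M.smult_assoc1[OF sR sR that] by simp
  qed
  have ac_sc: "ac a (sc c x) = sc c (ac a x)" if "a \<in> Arr C" "x \<in> carrier M" for a c x
    unfolding sc_def ac_def
    using M.smult_assoc1[OF sR bR[OF that(1)] that(2), of c] M.smult_assoc1[OF bR[OF that(1)] sR that(2), of c]
    unfolding scal_mult[OF bR[OF that(1)]] by simp
  have ac_ac: "ac a (ac b x) = (if Dom C a = Cod C b then ac (Comp C a b) x else \<zero>\<^bsub>M\<^esub>)"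
    if "a \<in> Arr C" "b \<in> Arr C" "x \<in> carrier M" for a b x
    unfolding ac_def M.smult_assoc1[OF bR[OF that(1)] bR[OF that(2)] that(3), symmetric] basis_mult[OF that(1,2)]
    using M.smult_l_null[OF that(3)] by simp
  have ac_add: "ac a (x \<oplus>\<^bsub>M\<^esub> y) = ac a x \<oplus>\<^bsub>M\<^esub> ac a y" if "a \<in> Arr C" "x \<in> carrier M" "y \<in> carrier M" for a x y
    unfolding ac_def using M.smult_r_distr[OF bR[OF that(1)] that(2,3)] .
  \<comment> \<open>a finite spanning set over the field: all images of the generators under arrows\<close>
  define B where "B = (\<lambda>(m, a). ac m a) ` (Arr C \<times> A)"
  have BM: "B \<subseteq> carrier M" unfolding B_def using ac_closed A(2) by auto
  have "finite B" unfolding B_def using finite_Arr A(1) by simp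
  then obtain b where b: "bij_betw b {0..<card B} B" using ex_bij_betw_nat_finite by blast
  define n where "n = card B"
  have bM: "b i \<in> carrier M" if "i < n" for i
    using b BM that unfolding n_def bij_betw_def by auto
  define L where "L v = (\<Oplus>\<^bsub>M\<^esub>i\<in>{..<n}. sc (v i) (b i))" for v :: "nat \<Rightarrow> 'k"
  have Lc: "L v \<in> carrier M" for v
    unfolding L_def using sc_closed bM by (intro M.M.finsum_closed) auto
  have L_add: "L (u + v) = L u \<oplus>\<^bsub>M\<^esub> L v" for u v
  proof -
    have "L (u + v) = (\<Oplus>\<^bsub>M\<^esub>i\<in>{..<n}. sc (u i) (b i) \<oplus>\<^bsub>M\<^esub> sc (v i) (b i))"
      unfolding L_def using sc_closed bM by (intro M.M.finsum_cong') (auto simp: sc_add)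
    then show ?thesis unfolding L_def using sc_closed bM by (simp add: M.M.finsum_addf Pi_iff)
  qed
  have L_scale: "L (fscale c v) = sc c (L v)" for c v
  proof -
    have "L (fscale c v) = (\<Oplus>\<^bsub>M\<^esub>i\<in>{..<n}. sc c (sc (v i) (b i)))"
      unfolding L_def using sc_closed bM by (intro M.M.finsum_cong') (auto simp: sc_sc fscale_apply)
    also have "\<dots> = sc c (L v)"
      unfolding L_def sc_def[of c] using sc_closed bM
      by (intro M.smult_finsum[symmetric] sR) auto
    finally show ?thesis .
  qed
  have L_zero: "L 0 = \<zero>\<^bsub>M\<^esub>"
    using L_scale[of 0 0] sc_zero[OF Lc] by simp
  have L_sum: "L (\<Sum>j\<in>J. w j) = (\<Oplus>\<^bsub>M\<^esub>j\<in>J. L (w j))" if "finite J" for J and w :: "'j \<Rightarrow> nat \<Rightarrow> 'k"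
    using that
  proof (induction J rule: finite_induct)
    case empty
    show ?case by (simp only: sum.empty L_zero M.M.finsum_empty)
  next
    case (insert j J)
    have "(\<Oplus>\<^bsub>M\<^esub>j\<in>insert j J. L (w j)) = L (w j) \<oplus>\<^bsub>M\<^esub> (\<Oplus>\<^bsub>M\<^esub>j\<in>J. L (w j))"
      using insert.hyps Lc by (intro M.M.finsum_insert) auto
    then show ?case by (simp only: sum.insert[OF insert.hyps] L_add insert.IH)
  qed
  have im_finsum: "\<exists>v. L v = finsum M f J" if J: "finite J" "\<And>j. j \<in> J \<Longrightarrow> \<exists>v. L v = f j" for J and f :: "'j \<Rightarrow> 'n"
  proof -
    obtain w where w: "\<And>j. j \<in> J \<Longrightarrow> L (w j) = f j" using J(2) by metis
    have "L (\<Sum>j\<in>J. w j) = finsum M f J"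
      unfolding L_sum[OF J(1)] using w Lc by (intro M.M.finsum_cong') (auto, metis)
    then show ?thesis by blast
  qed
  have im_b: "\<exists>v. L v = x" if x: "x \<in> B" for x
  proof -
    have "x \<in> b ` {0..<n}" using b x unfolding n_def bij_betw_def by simp
    then obtain i where i: "i < n" "x = b i" by auto
    have "L (\<lambda>j. if i = j then 1 else 0) = (\<Oplus>\<^bsub>M\<^esub>j\<in>{..<n}. if i = j then b j else \<zero>\<^bsub>M\<^esub>)"
      unfolding L_def using bM by (intro M.M.finsum_cong') (auto simp: sc_one sc_zero)
    also have "\<dots> = b i" using i(1) bM by (intro M.M.add.finprod_singleton[of i "{..<n}" b]) auto
    finally show ?thesis using i(2) by blast
  qed
  have surj: "\<exists>v. L v = x" if x: "x \<in> carrier M" for x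
  proof -
    obtain c where c: "c \<in> A \<rightarrow> carrier ?R" "x = (\<Oplus>\<^bsub>M\<^esub>a\<in>A. c a \<odot>\<^bsub>M\<^esub> a)" using gen[OF x] by blast
    show ?thesis
      unfolding c(2)
    proof (rule im_finsum[OF A(1)])
      fix a assume a: "a \<in> A"
      then have ca: "c a \<in> carrier ?R" "a \<in> carrier M" using c(1) A(2) by auto
      show "\<exists>v. L v = c a \<odot>\<^bsub>M\<^esub> a"
        unfolding smult_eq_finsum[OF Mm ca]
      proof (rule im_finsum[OF finite_Arr])
        fix m assume "m \<in> Arr C"
        then have "ac m a \<in> B" using a by (auto simp: B_def)
        then obtain v where "L v = ac m a" using im_b by blast
        then have "L (fscale (c a m) v) = scal C (c a m) \<odot>\<^bsub>M\<^esub> (basis m \<odot>\<^bsub>M\<^esub> a)"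
          unfolding L_scale by (simp add: sc_def ac_def)
        then show "\<exists>v. L v = scal C (c a m) \<odot>\<^bsub>M\<^esub> (basis m \<odot>\<^bsub>M\<^esub> a)" by blast
      qed
    qed
  qed
  define E where "E = {v :: nat \<Rightarrow> 'k. \<forall>i\<ge>n. v i = 0}"
  have E: "fs.subspace E" by (rule fs.subspaceI) (auto simp: E_def fscale_apply)
  have fE: "fin_support E" unfolding fin_support_def E_def by (intro exI[of _ "{..<n}"]) auto
  have surjE: "\<exists>v\<in>E. L v = x" if x: "x \<in> carrier M" for x
  proof -
    obtain v where v: "L v = x" using surj[OF x] by blast
    have "L (\<lambda>i. if i < n then v i else 0) = L v"
      unfolding L_def using sc_closed bM by (intro M.M.finsum_cong') auto
    then show ?thesis using v by (intro bexI[of _ "\<lambda>i. if i < n then v i else 0"]) (auto simp: E_def)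
  qed
  define K where "K = {v \<in> E. L v = \<zero>\<^bsub>M\<^esub>}"
  have sc_null: "sc c \<zero>\<^bsub>M\<^esub> = \<zero>\<^bsub>M\<^esub>" for c unfolding sc_def using M.smult_r_null[OF sR] .
  have K: "fs.subspace K"
    by (rule fs.subspaceI)
      (use E L_zero sc_null in \<open>auto simp: K_def L_add L_scale fs.subspace_0 fs.subspace_add fs.subspace_scale\<close>)
  have KE: "K \<subseteq> E" by (auto simp: K_def)
  obtain V where "fs.subspace V \<and> V \<subseteq> E \<and> V \<inter> K = {0} \<and> (\<forall>u\<in>E. \<exists>w\<in>V. u - w \<in> K)"
    using subspace_complement[OF E fE K KE] by (rule exE)
  then have V: "fs.subspace V" "V \<subseteq> E" "V \<inter> K = {0}" and VK: "\<And>u. u \<in> E \<Longrightarrow> \<exists>w\<in>V. u - w \<in> K"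
    by simp_all
  have surjV: "\<exists>v\<in>V. L v = x" if x: "x \<in> carrier M" for x
  proof -
    obtain u where u: "u \<in> E" "L u = x" using surjE[OF x] by blast
    obtain w where w: "w \<in> V" "u - w \<in> K" using VK[OF u(1)] by blast
    have "L u = L ((u - w) + w)" by simp
    also have "\<dots> = L w" unfolding L_add using w(2) Lc by (simp add: K_def)
    finally have "L w = x" using u(2) by simp
    then show ?thesis using w(1) by (rule bexI)
  qed
  have inj: "inj_on L V"
  proof (rule inj_onI)
    fix u v assume uv: "u \<in> V" "v \<in> V" "L u = L v"
    have d: "u - v \<in> V" by (rule fs.subspace_diff[OF V(1) uv(1,2)])
    have "L (u - v) \<oplus>\<^bsub>M\<^esub> L v = \<zero>\<^bsub>M\<^esub> \<oplus>\<^bsub>M\<^esub> L v"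
      unfolding L_add[symmetric] using uv(3) Lc by simp
    then have "L (u - v) = \<zero>\<^bsub>M\<^esub>" using Lc by (simp add: M.M.add.right_cancel)
    then have "u - v \<in> V \<inter> K" using d V(2) by (auto simp: K_def)
    then have "u - v = 0" using V(3) by blast
    then show "u = v" by simp
  qed
  have bij: "bij_betw L V (carrier M)"
    unfolding bij_betw_def using inj surjV Lc by (auto simp: image_iff)
  define h where "h = inv_into V L"
  have h: "h x \<in> V" "L (h x) = x" if "x \<in> carrier M" for x
    using that bij unfolding h_def bij_betw_def by (auto simp: inv_into_into f_inv_into_f)
  have Leq: "u = v" if "u \<in> V" "v \<in> V" "L u = L v" for u v
    using inj_onD[OF inj that(3,1,2)] .
  define \<rho> where "\<rho> a v = h (ac a (L v))" for a v
  have rV: "\<rho> a v \<in> V" and Lr: "L (\<rho> a v) = ac a (L v)" if "a \<in> Arr C" for a v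
    unfolding \<rho>_def using h ac_closed[OF that Lc] by auto
  note sV = fs.subspace_add[OF V(1)] fs.subspace_scale[OF V(1)] fs.subspace_0[OF V(1)] fs.subspace_sum[OF V(1)]
  have lin: "lin_on V (\<rho> a)" if a: "a \<in> Arr C" for a
    unfolding lin_on_def
  proof (intro conjI ballI allI)
    show "\<rho> a (u + v) = \<rho> a u + \<rho> a v" if "u \<in> V" "v \<in> V" for u v
      by (rule Leq) (simp_all add: rV[OF a] Lr[OF a] sV L_add ac_add[OF a] Lc)
    show "\<rho> a (fscale c v) = fscale c (\<rho> a v)" if "v \<in> V" for c v
      by (rule Leq) (simp_all add: rV[OF a] Lr[OF a] sV L_scale ac_sc[OF a] Lc)
  qed
  have Lsm: "L (\<Sum>a\<in>Arr C. fscale (f a) (\<rho> a v)) = f \<odot>\<^bsub>M\<^esub> L v" if f: "f \<in> carrier ?R" for f v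
  proof -
    have "L (\<Sum>a\<in>Arr C. fscale (f a) (\<rho> a v)) = (\<Oplus>\<^bsub>M\<^esub>a\<in>Arr C. scal C (f a) \<odot>\<^bsub>M\<^esub> (basis a \<odot>\<^bsub>M\<^esub> L v))"
      unfolding L_sum[OF finite_Arr]
    proof (rule M.M.finsum_cong'[OF refl])
      show "(\<lambda>a. scal C (f a) \<odot>\<^bsub>M\<^esub> (basis a \<odot>\<^bsub>M\<^esub> L v)) \<in> Arr C \<rightarrow> carrier M"
        using sc_closed ac_closed Lc unfolding sc_def ac_def by blast
      show "L (fscale (f a) (\<rho> a v)) = scal C (f a) \<odot>\<^bsub>M\<^esub> (basis a \<odot>\<^bsub>M\<^esub> L v)" if "a \<in> Arr C" for a
        unfolding L_scale Lr[OF that] by (simp add: sc_def ac_def)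
    qed
    then show ?thesis using smult_eq_finsum[OF Mm f Lc] by simp
  qed
  have unit: "(\<Sum>a\<in>Ident C ` Obj C. \<rho> a v) = v" if v: "v \<in> V" for v
  proof (rule Leq)
    show "(\<Sum>a\<in>Ident C ` Obj C. \<rho> a v) \<in> V" using rV Id_sub by (intro sV(4)) auto
    have "(\<Sum>a\<in>Ident C ` Obj C. \<rho> a v) = (\<Sum>a\<in>Arr C. fscale (scal C 1 a) (\<rho> a v))"
      using Id_sub finite_Arr by (intro sum.mono_neutral_cong_left) (auto simp: scal_def)
    then show "L (\<Sum>a\<in>Ident C ` Obj C. \<rho> a v) = L v"
      using Lsm[OF sR, of 1 v] sc_one[OF Lc, of v] by (simp add: sc_def)
  qed (rule v)
  have comp: "\<rho> a (\<rho> b v) = (if Dom C a = Cod C b then \<rho> (Comp C a b) v else 0)"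
    if ab: "a \<in> Arr C" "b \<in> Arr C" and v: "v \<in> V" for a b v
    by (rule Leq) (use ab in \<open>auto simp: rV Lr sV ac_ac Lc L_zero Comp_Arr\<close>)
  have cat_rep: "cat_rep C V \<rho>"
    unfolding cat_rep_def op_rep_def using V(1) rV lin unit comp by auto
  have "L \<in> module_iso ?R (rep_module C V \<rho>) M"
    by (rule module_isoI) (simp_all add: bij L_add rep_module_smult Lsm)
  then show ?thesis using cat_rep fin_support_mono[OF fE V(2)] by blast
qed

text \<open>
  An indecomposable representation is labelled by the isomorphism class of a module isomorphic to
  it; such a module exists in the prescribed type by \<open>finitely_generated_module_copy\<close>.
\<close>

theorem fin_type_if_finite_representation_type:
  assumes fin: "finite_representation_type (category_algebra TYPE('k::field) C)"
  shows "fin_type TYPE('i) TYPE('k) C"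
proof -
  let ?R = "category_algebra TYPE('k) C"
  let ?E = "fg_indecomposables_iso_rel ?R"
  define R where "R V \<rho> s \<longleftrightarrow> (\<exists>N \<in> fg_indecomposables ?R. s = ?E `` {N} \<and> module_iso ?R (rep_module C V \<rho>) N \<noteq> {})"
    for V :: "('i \<Rightarrow> 'k) set" and \<rho> s
  show ?thesis
  proof (rule fin_typeI[where S = "fg_indecomposables ?R // ?E" and R = R])
    show "finite (fg_indecomposables ?R // ?E)"
      using fin by (simp add: finite_representation_type_def)
  next
    fix V :: "('i \<Rightarrow> 'k) set" and \<rho>
    assume V: "cat_rep C V \<rho>" "fin_support V" "indec (Arr C) V \<rho>"
    note fg = finitely_generated_rep_module[OF V(1,2)] and lm = left_module_rep_module[OF V(1)]
    obtain N :: "('m \<Rightarrow> 'k, (nat \<Rightarrow> 'm \<Rightarrow> 'k) set) module" and f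
      where N: "left_module ?R N" "f \<in> module_iso ?R (rep_module C V \<rho>) N"
      using finitely_generated_module_copy[OF fg] by blast
    have "finitely_generated_module ?R N" by (rule finitely_generated_module_iso[OF fg N])
    moreover have "indecomposable_module ?R N"
      using indecomposable_module_iso[OF lm N] indecomposable_rep_module[OF V(1)] V(3) by simp
    ultimately have "N \<in> fg_indecomposables ?R" by (simp add: fg_indecomposables_def)
    then show "\<exists>s\<in>fg_indecomposables ?R // ?E. R V \<rho> s"
      unfolding R_def using N(2) by (intro bexI[of _ "?E `` {N}"] bexI[of _ N]) (auto intro: quotientI)
  next
    fix V V' :: "('i \<Rightarrow> 'k) set" and \<rho> \<rho>' s
    assume V: "cat_rep C V \<rho>" "cat_rep C V' \<rho>'" and "R V \<rho> s" "R V' \<rho>' s"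
    then obtain N N' f f' where N: "N \<in> fg_indecomposables ?R" "N' \<in> fg_indecomposables ?R"
      and eq: "?E `` {N} = ?E `` {N'}"
      and f: "f \<in> module_iso ?R (rep_module C V \<rho>) N" "f' \<in> module_iso ?R (rep_module C V' \<rho>') N'"
      unfolding R_def by blast
    have "(\<lambda>x. x) \<in> module_iso ?R N' N'" by (rule module_isoI) (auto simp: bij_betw_def)
    then have "N' \<in> ?E `` {N}" unfolding eq using N(2) by (auto simp: fg_indecomposables_iso_rel_def)
    then obtain g where "g \<in> module_iso ?R N N'" by (auto simp: fg_indecomposables_iso_rel_def)
    from module_iso_trans[OF module_iso_trans[OF f(1) this] module_iso_sym[OF left_module_rep_module[OF V(2)] f(2)]]
    have "module_iso ?R (rep_module C V \<rho>) (rep_module C V' \<rho>') \<noteq> {}" by blast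
    then show "op_iso (Arr C) V \<rho> V' \<rho>'" using rep_module_iso_iff[OF V] by blast
  qed
qed

text \<open>
  Each isomorphism class of indecomposable modules is determined by the representative in \<open>F\<close> of the
  representation that corresponds to it.
\<close>

theorem finite_representation_type_if_fin_type:
  assumes fin: "fin_type TYPE(nat) TYPE('k::field) C"
  shows "finite_representation_type (category_algebra TYPE('k) C)"
proof -
  let ?R = "category_algebra TYPE('k) C"
  let ?E = "fg_indecomposables_iso_rel ?R"
  obtain F :: "((nat \<Rightarrow> 'k) set \<times> ('m \<Rightarrow> (nat \<Rightarrow> 'k) \<Rightarrow> (nat \<Rightarrow> 'k))) set" where F: "finite F"
    "\<And>W \<sigma>. (W, \<sigma>) \<in> F \<Longrightarrow> cat_rep C W \<sigma>"
    "\<And>(V :: (nat \<Rightarrow> 'k) set) \<rho>. cat_rep C V \<rho> \<Longrightarrow> fin_support V \<Longrightarrow> indec (Arr C) V \<rho> \<Longrightarrow> \<exists>W \<sigma>. (W, \<sigma>) \<in> F \<and> op_iso (Arr C) V \<rho> W \<sigma>"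
    using fin by (rule fin_typeE) blast
  have ex: "\<exists>Y. Y \<in> F \<and> module_iso ?R (rep_module C (fst Y) (snd Y)) M \<noteq> {}"
    if M: "M \<in> fg_indecomposables ?R" for M
  proof -
    have fg: "finitely_generated_module ?R M" "indecomposable_module ?R M"
      using M by (auto simp: fg_indecomposables_def)
    obtain V :: "(nat \<Rightarrow> 'k) set" and \<rho> f where V: "cat_rep C V \<rho>" "fin_support V"
      and f: "f \<in> module_iso ?R (rep_module C V \<rho>) M"
      using module_to_rep[OF fg(1)] by blast
    have lm: "left_module ?R M" using fg(2) by (simp add: indecomposable_module_def)
    have "indecomposable_module ?R (rep_module C V \<rho>)"
      using indecomposable_module_iso[OF lm left_module_rep_module[OF V(1)]
          module_iso_sym[OF left_module_rep_module[OF V(1)] f] fg(2)] .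
    then have "indec (Arr C) V \<rho>" using indecomposable_rep_module[OF V(1)] by simp
    then obtain W \<sigma> where W: "(W, \<sigma>) \<in> F" "op_iso (Arr C) V \<rho> W \<sigma>" using F(3)[OF V] by blast
    then obtain g where g: "g \<in> module_iso ?R (rep_module C V \<rho>) (rep_module C W \<sigma>)"
      using rep_module_iso_iff[OF V(1) F(2)[OF W(1)]] by blast
    have "module_iso ?R (rep_module C W \<sigma>) M \<noteq> {}"
      using module_iso_trans[OF module_iso_sym[OF left_module_rep_module[OF V(1)] g] f] by blast
    then show ?thesis using W(1) by (intro exI[of _ "(W, \<sigma>)"]) simp
  qed
  have "\<forall>M\<in>fg_indecomposables ?R. \<exists>Y. Y \<in> F \<and> module_iso ?R (rep_module C (fst Y) (snd Y)) M \<noteq> {}"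
    using ex by (rule ballI)
  from bchoice[OF this] obtain lab where
    "\<forall>M\<in>fg_indecomposables ?R. lab M \<in> F \<and> module_iso ?R (rep_module C (fst (lab M)) (snd (lab M))) M \<noteq> {}" ..
  then have lab: "lab M \<in> F" "module_iso ?R (rep_module C (fst (lab M)) (snd (lab M))) M \<noteq> {}"
    if "M \<in> fg_indecomposables ?R" for M using that by simp_all
  have iso: "module_iso ?R M N \<noteq> {}" if MN: "M \<in> fg_indecomposables ?R" "N \<in> fg_indecomposables ?R" "lab M = lab N" for M N
  proof -
    obtain f g where f: "f \<in> module_iso ?R (rep_module C (fst (lab M)) (snd (lab M))) M"
      and g: "g \<in> module_iso ?R (rep_module C (fst (lab M)) (snd (lab M))) N"
      using lab(2)[OF MN(1)] lab(2)[OF MN(2)] MN(3) by auto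
    have "left_module ?R (rep_module C (fst (lab M)) (snd (lab M)))"
      using F(2) lab(1)[OF MN(1)] by (intro left_module_rep_module) simp
    from module_iso_trans[OF module_iso_sym[OF this f] g] show ?thesis by blast
  qed
  have lm: "left_module ?R M" if "M \<in> fg_indecomposables ?R" for M
    using that by (simp add: fg_indecomposables_def indecomposable_module_def)
  have cls: "?E `` {M} = {N \<in> fg_indecomposables ?R. module_iso ?R M N \<noteq> {}}" if "M \<in> fg_indecomposables ?R" for M
    using that by (auto simp: fg_indecomposables_iso_rel_def)
  have same: "?E `` {M} = ?E `` {N}" if MN: "M \<in> fg_indecomposables ?R" "N \<in> fg_indecomposables ?R" "lab M = lab N" for M N
  proof -
    obtain f g where f: "f \<in> module_iso ?R M N" and g: "g \<in> module_iso ?R N M"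
      using iso[OF MN] iso[OF MN(2,1) MN(3)[symmetric]] by blast
    show ?thesis
      unfolding cls[OF MN(1)] cls[OF MN(2)] using module_iso_trans[OF f] module_iso_trans[OF g] by blast
  qed
  have "fg_indecomposables ?R // ?E \<subseteq> (\<lambda>l. ?E `` {SOME M. M \<in> fg_indecomposables ?R \<and> lab M = l}) ` F"
  proof
    fix c assume "c \<in> fg_indecomposables ?R // ?E"
    then obtain M where M: "M \<in> fg_indecomposables ?R" "c = ?E `` {M}" by (rule quotientE)
    define N where "N = (SOME N. N \<in> fg_indecomposables ?R \<and> lab N = lab M)"
    have N: "N \<in> fg_indecomposables ?R \<and> lab N = lab M"
      unfolding N_def by (rule someI[of _ M]) (simp add: M(1))
    then have "c = ?E `` {N}" using same[OF M(1)] M(2) by simp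
    then show "c \<in> (\<lambda>l. ?E `` {SOME M. M \<in> fg_indecomposables ?R \<and> lab M = l}) ` F"
      using lab(1)[OF M(1)] unfolding N_def by (rule image_eqI)
  qed
  then show ?thesis
    unfolding finite_representation_type_def using F(1) by (meson finite_imageI finite_subset)
qed

end

section \<open>Restriction and coinduction for transporter categories\<close>

text \<open>
  A function from a group to \<open>'i \<Rightarrow> 'k\<close> is stored in uncurried form, so that coinduced representations
  are again spaces of functions with values in the field.
\<close>

definition slice :: "('g \<times> 'i \<Rightarrow> 'k) \<Rightarrow> 'g \<Rightarrow> 'i \<Rightarrow> 'k" where
  "slice F u = (\<lambda>i. F (u, i))"

lemma slice_add: "slice (F + F') u = slice F u + slice F' u"
  by (rule ext) (simp add: slice_def)

lemma slice_scale: "slice (fscale c F) u = fscale c (slice F u)"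
  by (rule ext) (simp add: slice_def fscale_apply)

lemma slice_zero: "slice 0 u = 0"
  by (rule ext) (simp add: slice_def)

locale poset_with_action =
  fixes G :: "('g, 's) monoid_scheme" (structure) and P :: "'x set" and r :: "'x rel" and \<phi> :: "'g \<Rightarrow> 'x \<Rightarrow> 'x"
  assumes grp: "group G" and finite_G: "finite (carrier G)"
    and po: "partial_order_on P r" and finite_P: "finite P" and act: "poset_action G P r \<phi>"
begin

sublocale group G by (rule grp)

abbreviation T where "T \<equiv> transporter_category G P r \<phi>"

text \<open>
  The subcategory of the arrows \<open>\<alpha>h\<close> with \<open>h \<in> H\<close>. It has the same objects; for the trivial subgroup it
  is the poset, for \<open>H = carrier G\<close> the whole transporter category.
\<close>

definition TH where "TH H = T\<lparr>Arr := r \<times> H\<rparr>"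

lemma T_simps [simp]:
  "Obj T = P" "Arr T = r \<times> carrier G" "Dom T (\<alpha>, g) = \<phi> (inv g) (fst \<alpha>)" "Cod T (\<alpha>, g) = snd \<alpha>"
  "Ident T x = ((x, x), \<one>)" "Comp T (\<alpha>, g) (\<beta>, h) = ((\<phi> g (fst \<beta>), snd \<alpha>), g \<otimes> h)"
  by (simp_all add: transporter_category_def poset_category_def)

lemma TH_simps [simp]:
  "Obj (TH H) = P" "Arr (TH H) = r \<times> H" "Dom (TH H) = Dom T" "Cod (TH H) = Cod T"
  "Ident (TH H) = Ident T" "Comp (TH H) = Comp T"
  by (simp_all add: TH_def)

lemma r_refl: "x \<in> P \<Longrightarrow> (x, x) \<in> r"
  using partial_order_onD(1)[OF po] by (simp add: refl_on_def)

lemma r_trans: "(x, y) \<in> r \<Longrightarrow> (y, z) \<in> r \<Longrightarrow> (x, z) \<in> r"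
  using partial_order_onD(2)[OF po] by (meson transD)

lemma r_antisym: "(x, y) \<in> r \<Longrightarrow> (y, x) \<in> r \<Longrightarrow> x = y"
  using partial_order_onD(3)[OF po] by (meson antisymD)

lemma r_P: "(x, y) \<in> r \<Longrightarrow> x \<in> P \<and> y \<in> P"
  using partial_order_onD(4)[OF po] by blast

lemma action: "group_action G P \<phi>"
  using act by (simp add: poset_action_def)

lemma phi_P: "g \<in> carrier G \<Longrightarrow> x \<in> P \<Longrightarrow> \<phi> g x \<in> P"
  using group_action.element_image[OF action] by blast

lemma phi_one: "x \<in> P \<Longrightarrow> \<phi> \<one> x = x"
  using group_action.id_eq_one[OF action] by (metis restrict_apply')

lemma phi_mult: "g \<in> carrier G \<Longrightarrow> h \<in> carrier G \<Longrightarrow> x \<in> P \<Longrightarrow> \<phi> (g \<otimes> h) x = \<phi> g (\<phi> h x)"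
  using group_action.composition_rule[OF action] by blast

lemma phi_inv: "g \<in> carrier G \<Longrightarrow> x \<in> P \<Longrightarrow> \<phi> (inv g) (\<phi> g x) = x"
  "g \<in> carrier G \<Longrightarrow> x \<in> P \<Longrightarrow> \<phi> g (\<phi> (inv g) x) = x"
  using phi_mult[of "inv g" g x] phi_mult[of g "inv g" x] phi_one[of x] by auto

lemma phi_eq_iff: "g \<in> carrier G \<Longrightarrow> x \<in> P \<Longrightarrow> y \<in> P \<Longrightarrow> \<phi> (inv g) x = y \<longleftrightarrow> x = \<phi> g y"
  using phi_inv by metis

lemma phi_inj: "g \<in> carrier G \<Longrightarrow> x \<in> P \<Longrightarrow> y \<in> P \<Longrightarrow> \<phi> g x = \<phi> g y \<longleftrightarrow> x = y"
  using phi_inv(1) by metis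

lemma phi_mono: "g \<in> carrier G \<Longrightarrow> (x, y) \<in> r \<Longrightarrow> (\<phi> g x, \<phi> g y) \<in> r"
  using act r_P unfolding poset_action_def by blast

definition act_arrow where "act_arrow g \<alpha> = (\<phi> g (fst \<alpha>), \<phi> g (snd \<alpha>))"

lemma fst_act_arrow [simp]: "fst (act_arrow g \<alpha>) = \<phi> g (fst \<alpha>)" and snd_act_arrow [simp]: "snd (act_arrow g \<alpha>) = \<phi> g (snd \<alpha>)"
  by (simp_all add: act_arrow_def)

lemma r_PD: "\<alpha> \<in> r \<Longrightarrow> fst \<alpha> \<in> P" "\<alpha> \<in> r \<Longrightarrow> snd \<alpha> \<in> P"
  using r_P[of "fst \<alpha>" "snd \<alpha>"] by auto

lemma act_arrow_r [simp]: "g \<in> carrier G \<Longrightarrow> \<alpha> \<in> r \<Longrightarrow> act_arrow g \<alpha> \<in> r"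
  using phi_mono[of g "fst \<alpha>" "snd \<alpha>"] by (simp add: act_arrow_def)

lemma act_arrow_one [simp]: "\<alpha> \<in> r \<Longrightarrow> act_arrow \<one> \<alpha> = \<alpha>"
  using r_PD by (simp add: act_arrow_def phi_one)

lemma act_arrow_act_arrow: "g \<in> carrier G \<Longrightarrow> h \<in> carrier G \<Longrightarrow> \<alpha> \<in> r \<Longrightarrow> act_arrow g (act_arrow h \<alpha>) = act_arrow (g \<otimes> h) \<alpha>"
  using r_PD by (simp add: act_arrow_def phi_mult)

text \<open>
  The action of the group element \<open>g\<close>, viewed in the skew group algebra as the sum of the arrows
  \<open>1\<^sub>x g\<close> over all \<open>x\<close>.
\<close>

definition gact :: "(('x \<times> 'x) \<times> 'g \<Rightarrow> ('i \<Rightarrow> 'k) \<Rightarrow> ('i \<Rightarrow> 'k::field)) \<Rightarrow> 'g \<Rightarrow> ('i \<Rightarrow> 'k) \<Rightarrow> ('i \<Rightarrow> 'k)" where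
  "gact \<sigma> g v = (\<Sum>x\<in>P. \<sigma> ((x, x), g) v)"

end

locale transporter_rep = poset_with_action G P r \<phi>
  for G :: "('g, 's) monoid_scheme" (structure) and P :: "'x set" and r \<phi> +
  fixes H :: "'g set" and N :: "('i \<Rightarrow> 'k::field) set" and \<sigma> :: "('x \<times> 'x) \<times> 'g \<Rightarrow> ('i \<Rightarrow> 'k) \<Rightarrow> ('i \<Rightarrow> 'k)"
  assumes subgroup_H: "subgroup H G" and rep: "cat_rep (TH H) N \<sigma>"
begin

lemma H_G: "h \<in> H \<Longrightarrow> h \<in> carrier G"
  using subgroup.subset[OF subgroup_H] by blast

lemma H_closed [simp]: "\<one> \<in> H" "g \<in> H \<Longrightarrow> h \<in> H \<Longrightarrow> g \<otimes> h \<in> H" "h \<in> H \<Longrightarrow> inv h \<in> H"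
  using subgroup_H by (auto simp: subgroup.one_closed subgroup.m_closed subgroup.m_inv_closed)

lemma sub: "fs.subspace N"
  using op_repD(1)[OF cat_repD(1)[OF rep]] .

lemma sigma_closed: "\<alpha> \<in> r \<Longrightarrow> h \<in> H \<Longrightarrow> v \<in> N \<Longrightarrow> \<sigma> (\<alpha>, h) v \<in> N"
  by (rule op_repD(2)[OF cat_repD(1)[OF rep]]) auto

lemma sigma_lin: "\<alpha> \<in> r \<Longrightarrow> h \<in> H \<Longrightarrow> lin_on N (\<sigma> (\<alpha>, h))"
  by (rule op_repD(3)[OF cat_repD(1)[OF rep]]) auto

lemma sigma_sigma:
  assumes "\<alpha> \<in> r" "\<beta> \<in> r" "g \<in> H" "h \<in> H" "v \<in> N"
  shows "\<sigma> (\<alpha>, g) (\<sigma> (\<beta>, h) v) = (if fst \<alpha> = \<phi> g (snd \<beta>) then \<sigma> ((\<phi> g (fst \<beta>), snd \<alpha>), g \<otimes> h) v else 0)"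
  using cat_repD(2)[OF rep, of "(\<alpha>, g)" "(\<beta>, h)" v] assms r_PD H_G by (auto simp: phi_eq_iff)

lemma gact_closed: "h \<in> H \<Longrightarrow> v \<in> N \<Longrightarrow> gact \<sigma> h v \<in> N"
  unfolding gact_def by (intro fs.subspace_sum[OF sub] sigma_closed r_refl)

lemma gact_add: "h \<in> H \<Longrightarrow> u \<in> N \<Longrightarrow> v \<in> N \<Longrightarrow> gact \<sigma> h (u + v) = gact \<sigma> h u + gact \<sigma> h v"
  unfolding gact_def sum.distrib[symmetric] by (intro sum.cong refl lin_onD(1)[OF sigma_lin] r_refl)

lemma gact_scale: "h \<in> H \<Longrightarrow> v \<in> N \<Longrightarrow> gact \<sigma> h (fscale c v) = fscale c (gact \<sigma> h v)"
  unfolding gact_def fs.scale_sum_right by (intro sum.cong refl lin_onD(2)[OF sigma_lin] r_refl)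

lemma gact_lin: "h \<in> H \<Longrightarrow> lin_on N (gact \<sigma> h)"
  unfolding lin_on_def using gact_add gact_scale by blast

text \<open>
  This lemma and the next are the rules of the skew group algebra: an arrow \<open>\<alpha>g\<close> acts as \<open>\<alpha>\<close> after \<open>g\<close>, and
  conjugation by \<open>h\<close> moves \<open>\<alpha>\<close> to \<open>h(\<alpha>)\<close>.
\<close>

lemma sigma_gact:
  assumes "\<alpha> \<in> r" "g \<in> H" "h \<in> H" "v \<in> N"
  shows "\<sigma> (\<alpha>, g) (gact \<sigma> h v) = \<sigma> (\<alpha>, g \<otimes> h) v"
proof -
  have "\<sigma> (\<alpha>, g) (gact \<sigma> h v) = (\<Sum>x\<in>P. \<sigma> (\<alpha>, g) (\<sigma> ((x, x), h) v))"
    unfolding gact_def using assms by (intro lin_on_sum[OF sigma_lin sub] sigma_closed r_refl)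
  also have "\<dots> = (\<Sum>x\<in>P. if x = \<phi> (inv g) (fst \<alpha>) then \<sigma> (\<alpha>, g \<otimes> h) v else 0)"
    using assms r_PD[OF assms(1)] H_G phi_eq_iff[of g "fst \<alpha>"] phi_P[of g]
    by (intro sum.cong refl) (auto simp: sigma_sigma r_refl phi_inv)
  also have "\<dots> = \<sigma> (\<alpha>, g \<otimes> h) v"
    using finite_P phi_P[of "inv g" "fst \<alpha>"] r_PD[OF assms(1)] H_G[OF assms(2)] by (simp add: sum.delta)
  finally show ?thesis .
qed

lemma gact_sigma:
  assumes "\<alpha> \<in> r" "g \<in> H" "h \<in> H" "v \<in> N"
  shows "gact \<sigma> h (\<sigma> (\<alpha>, g) v) = \<sigma> (act_arrow h \<alpha>, h \<otimes> g) v"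
proof -
  have "gact \<sigma> h (\<sigma> (\<alpha>, g) v) = (\<Sum>x\<in>P. if x = \<phi> h (snd \<alpha>) then \<sigma> (act_arrow h \<alpha>, h \<otimes> g) v else 0)"
    unfolding gact_def
    using assms by (intro sum.cong refl) (auto simp: sigma_sigma r_refl act_arrow_def)
  also have "\<dots> = \<sigma> (act_arrow h \<alpha>, h \<otimes> g) v"
    using finite_P phi_P[of h "snd \<alpha>"] r_PD[OF assms(1)] H_G[OF assms(3)] by (simp add: sum.delta)
  finally show ?thesis .
qed

lemma gact_gact: "g \<in> H \<Longrightarrow> h \<in> H \<Longrightarrow> v \<in> N \<Longrightarrow> gact \<sigma> g (gact \<sigma> h v) = gact \<sigma> (g \<otimes> h) v"
  unfolding gact_def[of _ g] gact_def[of _ "g \<otimes> h"]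
  by (intro sum.cong refl sigma_gact r_refl)

lemma gact_one: "v \<in> N \<Longrightarrow> gact \<sigma> \<one> v = v"
proof -
  assume v: "v \<in> N"
  have "gact \<sigma> \<one> v = (\<Sum>a\<in>(\<lambda>x. ((x, x), \<one>)) ` P. \<sigma> a v)"
    unfolding gact_def by (subst sum.reindex) (auto simp: inj_on_def)
  also have "(\<lambda>x. ((x, x), \<one>)) ` P = Ident (TH H) ` Obj (TH H)" by (intro image_cong) simp_all
  finally show ?thesis using cat_repD(3)[OF rep v] by simp
qed

end

context poset_with_action
begin

text \<open>
  The functions \<open>F\<close> from \<open>G\<close> to \<open>N\<close> with \<open>F(u h\<inverse>) = h F(u)\<close> for \<open>h \<in> H\<close>.
\<close>

definition coind :: "'g set \<Rightarrow> ('i \<Rightarrow> 'k::field) set \<Rightarrow> (('x \<times> 'x) \<times> 'g \<Rightarrow> ('i \<Rightarrow> 'k) \<Rightarrow> ('i \<Rightarrow> 'k)) \<Rightarrow> ('g \<times> 'i \<Rightarrow> 'k) set" where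
  "coind H N \<sigma> = {F. (\<forall>u i. u \<notin> carrier G \<longrightarrow> F (u, i) = 0) \<and> (\<forall>u\<in>carrier G. slice F u \<in> N) \<and>
     (\<forall>u\<in>carrier G. \<forall>h\<in>H. slice F (u \<otimes> inv h) = gact \<sigma> h (slice F u))}"

text \<open>
  The arrow \<open>\<alpha>g\<close> sends \<open>F\<close> to the function \<open>u \<mapsto> u\<inverse>(\<alpha>) F(g\<inverse> u)\<close>: the group acts by left translation, and
  the twist of \<open>\<alpha>\<close> by \<open>u\<inverse>\<close> makes the operators satisfy the relations of the skew group algebra. The arrow \<open>u\<inverse>(\<alpha>)\<close> of
  the poset acts on \<open>N\<close> through its pair with the identity of \<open>G\<close>.
\<close>

definition coind_act :: "(('x \<times> 'x) \<times> 'g \<Rightarrow> ('i \<Rightarrow> 'k) \<Rightarrow> ('i \<Rightarrow> 'k::field)) \<Rightarrow>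
    ('x \<times> 'x) \<times> 'g \<Rightarrow> ('g \<times> 'i \<Rightarrow> 'k) \<Rightarrow> ('g \<times> 'i \<Rightarrow> 'k)" where
  "coind_act \<sigma> a F = (\<lambda>(u, i). if u \<in> carrier G
     then \<sigma> (act_arrow (inv u) (fst a), \<one>) (slice F (inv (snd a) \<otimes> u)) i else 0)"

definition glue :: "('g \<Rightarrow> 'i \<Rightarrow> 'k::field) \<Rightarrow> ('g \<times> 'i \<Rightarrow> 'k)" where
  "glue f = (\<lambda>(u, i). if u \<in> carrier G then f u i else 0)"

lemma slice_glue: "u \<in> carrier G \<Longrightarrow> slice (glue f) u = f u"
  by (simp add: glue_def slice_def)

lemma glue_supp: "u \<notin> carrier G \<Longrightarrow> glue f (u, i) = 0"
  by (simp add: glue_def)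

lemma coind_act_glue: "coind_act \<sigma> a F = glue (\<lambda>u. \<sigma> (act_arrow (inv u) (fst a), \<one>) (slice F (inv (snd a) \<otimes> u)))"
  by (simp add: coind_act_def glue_def)

lemma slice_coind_act: "u \<in> carrier G \<Longrightarrow>
    slice (coind_act \<sigma> a F) u = \<sigma> (act_arrow (inv u) (fst a), \<one>) (slice F (inv (snd a) \<otimes> u))"
  by (simp add: coind_act_glue slice_glue)

lemma slice_eqI:
  assumes "\<And>u i. u \<notin> carrier G \<Longrightarrow> F (u, i) = 0" "\<And>u i. u \<notin> carrier G \<Longrightarrow> F' (u, i) = 0"
    "\<And>u. u \<in> carrier G \<Longrightarrow> slice F u = slice F' u"
  shows "F = F'"
proof (rule ext, clarify)
  fix u i show "F (u, i) = F' (u, i)"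
  proof (cases "u \<in> carrier G")
    case True
    from fun_cong[OF assms(3)[OF this], of i] show ?thesis by (simp add: slice_def)
  qed (use assms in simp)
qed

lemma coindD:
  assumes "F \<in> coind H N \<sigma>"
  shows "u \<notin> carrier G \<Longrightarrow> F (u, i) = 0" "u \<in> carrier G \<Longrightarrow> slice F u \<in> N"
    "u \<in> carrier G \<Longrightarrow> h \<in> H \<Longrightarrow> slice F (u \<otimes> inv h) = gact \<sigma> h (slice F u)"
  using assms by (auto simp: coind_def)

lemma glue_coindI:
  assumes "\<And>u. u \<in> carrier G \<Longrightarrow> f u \<in> N" "\<And>u h. u \<in> carrier G \<Longrightarrow> h \<in> H \<Longrightarrow> f (u \<otimes> inv h) = gact \<sigma> h (f u)"
    "H \<subseteq> carrier G"
  shows "glue f \<in> coind H N \<sigma>"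
  using assms by (auto simp: coind_def slice_glue glue_supp subset_iff)

lemma coind_fin_support: "fin_support N \<Longrightarrow> fin_support (coind H N \<sigma>)"
proof -
  assume "fin_support N"
  then obtain I where I: "finite I" "\<And>v i. v \<in> N \<Longrightarrow> i \<notin> I \<Longrightarrow> v i = 0" unfolding fin_support_def by blast
  have "F (u, i) = 0" if "F \<in> coind H N \<sigma>" "(u, i) \<notin> carrier G \<times> I" for F u i
    using coindD[OF that(1)] I(2)[of "slice F u" i] that(2) by (cases "u \<in> carrier G") (auto simp: slice_def)
  then show ?thesis unfolding fin_support_def
    using finite_G I(1) by (intro exI[of _ "carrier G \<times> I"]) auto
qed

end

context transporter_rep
begin

lemma coind_subspace: "fs.subspace (coind H N \<sigma>)"
proof (rule fs.subspaceI)
  have "gact \<sigma> h 0 = 0" if "h \<in> H" for h by (rule lin_on_zero[OF gact_lin[OF that] sub])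
  then show "0 \<in> coind H N \<sigma>" by (simp add: coind_def slice_zero fs.subspace_0[OF sub])
  show "F + F' \<in> coind H N \<sigma>" if "F \<in> coind H N \<sigma>" "F' \<in> coind H N \<sigma>" for F F'
    using that by (simp add: coind_def slice_add fs.subspace_add[OF sub] gact_add)
  show "fscale c F \<in> coind H N \<sigma>" if "F \<in> coind H N \<sigma>" for F c
    using that by (simp add: coind_def slice_scale fs.subspace_scale[OF sub] gact_scale fscale_apply)
qed

lemma coind_act_closed:
  assumes F: "F \<in> coind H N \<sigma>" and \<alpha>: "\<alpha> \<in> r" and g: "g \<in> carrier G"
  shows "coind_act \<sigma> (\<alpha>, g) F \<in> coind H N \<sigma>"
  unfolding coind_act_glue
proof (rule glue_coindI)
  show "\<sigma> (act_arrow (inv u) (fst (\<alpha>, g)), \<one>) (slice F (inv (snd (\<alpha>, g)) \<otimes> u)) \<in> N" if "u \<in> carrier G" for u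
    using that \<alpha> g coindD(2)[OF F] by (intro sigma_closed) auto
  fix u h assume u: "u \<in> carrier G" and h: "h \<in> H"
  note hG = H_G[OF h]
  have "slice F (inv g \<otimes> (u \<otimes> inv h)) = gact \<sigma> h (slice F (inv g \<otimes> u))"
    using coindD(3)[OF F, of "inv g \<otimes> u" h] u g h hG by (simp add: m_assoc)
  moreover have "act_arrow (inv (u \<otimes> inv h)) \<alpha> = act_arrow h (act_arrow (inv u) \<alpha>)"
    using u hG \<alpha> by (simp add: act_arrow_act_arrow inv_mult_group)
  ultimately show "\<sigma> (act_arrow (inv (u \<otimes> inv h)) (fst (\<alpha>, g)), \<one>) (slice F (inv (snd (\<alpha>, g)) \<otimes> (u \<otimes> inv h))) =
      gact \<sigma> h (\<sigma> (act_arrow (inv u) (fst (\<alpha>, g)), \<one>) (slice F (inv (snd (\<alpha>, g)) \<otimes> u)))"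
    using u g h hG \<alpha> coindD(2)[OF F, of "inv g \<otimes> u"]
      sigma_gact[of "act_arrow h (act_arrow (inv u) \<alpha>)" \<one> h] gact_sigma[of "act_arrow (inv u) \<alpha>" \<one> h]
    by simp
qed (use H_G in blast)

lemma cat_rep_coind: "cat_rep T (coind H N \<sigma>) (coind_act \<sigma>)"
  unfolding cat_rep_def op_rep_def
proof (intro conjI ballI)
  show "fs.subspace (coind H N \<sigma>)" by (rule coind_subspace)
next
  fix a assume "a \<in> Arr T"
  then obtain \<alpha> g where a: "a = (\<alpha>, g)" "\<alpha> \<in> r" "g \<in> carrier G" by auto
  show "coind_act \<sigma> a ` coind H N \<sigma> \<subseteq> coind H N \<sigma>" using coind_act_closed[OF _ a(2,3)] unfolding a(1) by (rule image_subsetI)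
  have mem: "slice F (inv g \<otimes> u) \<in> N" if "F \<in> coind H N \<sigma>" "u \<in> carrier G" for F u
    using coindD(2)[OF that(1)] that(2) a(3) by simp
  show "lin_on (coind H N \<sigma>) (coind_act \<sigma> a)"
    unfolding lin_on_def
  proof (intro conjI ballI allI)
    fix F F' assume F: "F \<in> coind H N \<sigma>" "F' \<in> coind H N \<sigma>"
    have "\<sigma> (act_arrow (inv u) \<alpha>, \<one>) (slice F (inv g \<otimes> u) + slice F' (inv g \<otimes> u)) =
        \<sigma> (act_arrow (inv u) \<alpha>, \<one>) (slice F (inv g \<otimes> u)) + \<sigma> (act_arrow (inv u) \<alpha>, \<one>) (slice F' (inv g \<otimes> u))"
      if "u \<in> carrier G" for u
      using that mem F a by (intro lin_onD(1)[OF sigma_lin]) auto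
    then show "coind_act \<sigma> a (F + F') = coind_act \<sigma> a F + coind_act \<sigma> a F'"
      by (intro slice_eqI) (auto simp: slice_add slice_coind_act a(1) coind_act_glue[of _ "(\<alpha>, g)"] glue_supp slice_glue)
  next
    fix c F assume F: "F \<in> coind H N \<sigma>"
    have "\<sigma> (act_arrow (inv u) \<alpha>, \<one>) (fscale c (slice F (inv g \<otimes> u))) = fscale c (\<sigma> (act_arrow (inv u) \<alpha>, \<one>) (slice F (inv g \<otimes> u)))"
      if "u \<in> carrier G" for u
      using that mem F a by (intro lin_onD(2)[OF sigma_lin]) auto
    then show "coind_act \<sigma> a (fscale c F) = fscale c (coind_act \<sigma> a F)"
      by (intro slice_eqI) (auto simp: slice_scale a(1) coind_act_glue[of _ "(\<alpha>, g)"] glue_supp slice_glue fscale_apply)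
  qed
next
  fix a b F assume "a \<in> Arr T" "b \<in> Arr T" and F: "F \<in> coind H N \<sigma>"
  then obtain \<alpha> g \<beta> h where a: "a = (\<alpha>, g)" "\<alpha> \<in> r" "g \<in> carrier G" and b: "b = (\<beta>, h)" "\<beta> \<in> r" "h \<in> carrier G"
    by auto
  note P\<alpha> = r_PD[OF a(2)] and P\<beta> = r_PD[OF b(2)]
  show "coind_act \<sigma> a (coind_act \<sigma> b F) = (if Dom T a = Cod T b then coind_act \<sigma> (Comp T a b) F else 0)"
  proof (rule slice_eqI)
    show "coind_act \<sigma> a (coind_act \<sigma> b F) (u, i) = 0" if "u \<notin> carrier G" for u i
      using that by (simp add: coind_act_def)
    show "(if Dom T a = Cod T b then coind_act \<sigma> (Comp T a b) F else 0) (u, i) = 0" if "u \<notin> carrier G" for u i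
      using that by (simp add: coind_act_def)
    fix u assume u: "u \<in> carrier G"
    have w: "inv g \<otimes> u \<in> carrier G" using u a by simp
    define v where "v = slice F (inv (g \<otimes> h) \<otimes> u)"
    have v: "v \<in> N" unfolding v_def using coindD(2)[OF F] u a(3) b(3) by simp
    have e1: "inv h \<otimes> (inv g \<otimes> u) = inv (g \<otimes> h) \<otimes> u"
      using u a(3) b(3) by (simp add: inv_mult_group m_assoc)
    have e2: "act_arrow (inv (inv g \<otimes> u)) \<beta> = act_arrow (inv u) (act_arrow g \<beta>)"
      using u a(3) b(2) by (simp add: act_arrow_act_arrow inv_mult_group)
    have "slice (coind_act \<sigma> a (coind_act \<sigma> b F)) u = \<sigma> (act_arrow (inv u) \<alpha>, \<one>) (\<sigma> (act_arrow (inv u) (act_arrow g \<beta>), \<one>) v)"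
      unfolding a b slice_coind_act[OF u] fst_conv snd_conv slice_coind_act[OF w] e1 e2 v_def ..
    also have "\<dots> = (if \<phi> (inv u) (fst \<alpha>) = \<phi> (inv u) (\<phi> g (snd \<beta>)) then
        \<sigma> ((\<phi> (inv u) (\<phi> g (fst \<beta>)), \<phi> (inv u) (snd \<alpha>)), \<one>) v else 0)"
      using u a b v P\<beta> by (subst sigma_sigma) (auto simp: phi_P phi_one)
    also have "\<phi> (inv u) (fst \<alpha>) = \<phi> (inv u) (\<phi> g (snd \<beta>)) \<longleftrightarrow> Dom T a = Cod T b"
      using u a b P\<alpha> P\<beta> by (simp add: phi_inj phi_P phi_eq_iff)
    finally show "slice (coind_act \<sigma> a (coind_act \<sigma> b F)) u =
        slice (if Dom T a = Cod T b then coind_act \<sigma> (Comp T a b) F else 0) u"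
      using u by (simp add: slice_zero slice_coind_act a(1) b(1) v_def act_arrow_def) (simp add: zero_fun_def)
  qed
next
  fix F assume F: "F \<in> coind H N \<sigma>"
  have I: "Ident T ` Obj T = (\<lambda>x. ((x, x), \<one>)) ` P" by (intro image_cong) simp_all
  have "(\<Sum>a\<in>Ident T ` Obj T. coind_act \<sigma> a F) = (\<Sum>x\<in>P. coind_act \<sigma> ((x, x), \<one>) F)"
    unfolding I by (subst sum.reindex) (auto simp: inj_on_def)
  also have "\<dots> = F"
  proof (rule slice_eqI)
    show "(\<Sum>x\<in>P. coind_act \<sigma> ((x, x), \<one>) F) (u, i) = 0" if "u \<notin> carrier G" for u i
      using that by (simp add: coind_act_def sum_fun_apply)
    show "F (u, i) = 0" if "u \<notin> carrier G" for u i using coindD(1)[OF F that] .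
    fix u assume u: "u \<in> carrier G"
    have "slice (\<Sum>x\<in>P. coind_act \<sigma> ((x, x), \<one>) F) u = (\<Sum>x\<in>P. slice (coind_act \<sigma> ((x, x), \<one>) F) u)"
      by (rule ext) (simp add: slice_def sum_fun_apply)
    also have "\<dots> = (\<Sum>x\<in>P. \<sigma> ((\<phi> (inv u) x, \<phi> (inv u) x), \<one>) (slice F u))"
      using u by (simp add: slice_coind_act act_arrow_def)
    also have "\<dots> = (\<Sum>y\<in>P. \<sigma> ((y, y), \<one>) (slice F u))"
      using u by (intro sum.reindex_bij_witness[of _ "\<phi> u" "\<phi> (inv u)"]) (auto simp: phi_inv phi_P)
    also have "\<dots> = slice F u"
      using gact_one[OF coindD(2)[OF F u]] by (simp add: gact_def)
    finally show "slice (\<Sum>x\<in>P. coind_act \<sigma> ((x, x), \<one>) F) u = slice F u" .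
  qed
  finally show "(\<Sum>a\<in>Ident T ` Obj T. coind_act \<sigma> a F) = F" .
qed

lemma slice_gact_inv:
  assumes F: "F \<in> coind H N \<sigma>" and h: "h \<in> H"
  shows "slice F (inv h) = gact \<sigma> h (slice F \<one>)"
  using coindD(3)[OF F one_closed h] H_G[OF h] by simp

text \<open>
  Sends \<open>v\<close> to the function on \<open>G\<close> that is \<open>u \<mapsto> u\<inverse> v\<close> on \<open>H\<close> and vanishes elsewhere. The same formula
  lands in the functions coinduced from any subgroup \<open>K\<close> of \<open>H\<close>; the cases \<open>K = H\<close> and \<open>K = {\<one>}\<close> are used.
\<close>

definition embed where "embed v = glue (\<lambda>u. if u \<in> H then gact \<sigma> (inv u) v else 0)"

lemma embed_hom:
  assumes K: "subgroup K G" "K \<subseteq> H"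
  shows "op_hom (Arr (TH H)) N \<sigma> (coind K N \<sigma>) (coind_act \<sigma>) embed"
proof -
  have KG: "K \<subseteq> carrier G" by (rule subgroup.subset[OF K(1)])
  have g0: "gact \<sigma> h 0 = 0" if "h \<in> H" for h by (rule lin_on_zero[OF gact_lin[OF that] sub])
  have s0: "\<sigma> (\<alpha>, \<one>) 0 = 0" if "\<alpha> \<in> r" for \<alpha> by (rule lin_on_zero[OF sigma_lin[OF that] sub]) simp
  have mem: "u \<otimes> h \<in> H \<longleftrightarrow> u \<in> H" if "u \<in> carrier G" "h \<in> H" for u h
  proof
    assume "u \<otimes> h \<in> H"
    then have "(u \<otimes> h) \<otimes> inv h \<in> H" using that by simp
    then show "u \<in> H" using that H_G[OF that(2)] by (simp add: m_assoc)
  qed (use that in simp)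
  have mem': "h \<otimes> u \<in> H \<longleftrightarrow> u \<in> H" if "u \<in> carrier G" "h \<in> H" for u h
  proof
    assume "h \<otimes> u \<in> H"
    then have "inv h \<otimes> (h \<otimes> u) \<in> H" using that by simp
    then show "u \<in> H" using that H_G[OF that(2)] by (simp add: m_assoc[symmetric])
  qed (use that in simp)
  have closed: "embed v \<in> coind K N \<sigma>" if v: "v \<in> N" for v
    unfolding embed_def
  proof (rule glue_coindI[OF _ _ KG])
    show "(if u \<in> H then gact \<sigma> (inv u) v else 0) \<in> N" if "u \<in> carrier G" for u
      using v gact_closed fs.subspace_0[OF sub] by simp
    fix u h assume u: "u \<in> carrier G" and "h \<in> K"
    then have h: "h \<in> H" using K(2) by blast
    show "(if u \<otimes> inv h \<in> H then gact \<sigma> (inv (u \<otimes> inv h)) v else 0) =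
        gact \<sigma> h (if u \<in> H then gact \<sigma> (inv u) v else 0)"
      using u h v H_G[OF h] mem[OF u, of "inv h"] g0[OF h] by (simp add: inv_mult_group gact_gact)
  qed
  show ?thesis
    unfolding op_hom_def lin_on_def
  proof (intro conjI ballI allI image_subsetI closed)
    show "embed (u + v) = embed u + embed v" if "u \<in> N" "v \<in> N" for u v
      unfolding embed_def using that
      by (intro slice_eqI) (auto simp: glue_supp slice_glue slice_add gact_add)
    show "embed (fscale c v) = fscale c (embed v)" if "v \<in> N" for c v
      unfolding embed_def using that
      by (intro slice_eqI) (auto simp: glue_supp slice_glue slice_scale gact_scale fscale_apply)
    fix a v assume "a \<in> Arr (TH H)" and v: "v \<in> N"
    then obtain \<alpha> g where a: "a = (\<alpha>, g)" "\<alpha> \<in> r" "g \<in> H" by auto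
    note gG = H_G[OF a(3)]
    show "embed (\<sigma> a v) = coind_act \<sigma> a (embed v)"
    proof (rule slice_eqI)
      show "embed (\<sigma> a v) (u, i) = 0" if "u \<notin> carrier G" for u i unfolding embed_def by (rule glue_supp[OF that])
      show "coind_act \<sigma> a (embed v) (u, i) = 0" if "u \<notin> carrier G" for u i using that by (simp add: coind_act_def)
      fix u assume u: "u \<in> carrier G"
      show "slice (embed (\<sigma> a v)) u = slice (coind_act \<sigma> a (embed v)) u"
      proof (cases "u \<in> H")
        case True
        then show ?thesis
          using u a v gG mem'[OF u, of "inv g"]
          by (simp add: embed_def slice_glue slice_coind_act inv_mult_group gact_sigma sigma_gact)
      next
        case False
        have w: "inv g \<otimes> u \<in> carrier G" "inv g \<otimes> u \<notin> H" using u a gG False mem'[OF u, of "inv g"] by auto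
        have "slice (embed (\<sigma> a v)) u = 0"
          unfolding embed_def slice_glue[OF u] using False by (simp only: if_False)
        moreover have "slice (embed v) (inv g \<otimes> u) = 0"
          unfolding embed_def slice_glue[OF w(1)] using w(2) by (simp only: if_False)
        moreover have "\<sigma> (act_arrow (inv u) \<alpha>, \<one>) 0 = 0" using u a(2) by (intro s0) simp
        ultimately show ?thesis
          unfolding a(1) slice_coind_act[OF u] fst_conv snd_conv by (simp only:)
      qed
    qed
  qed
qed

text \<open>
  Evaluation at the identity of \<open>G\<close> is a left inverse of \<open>embed\<close>.
\<close>

lemma retract_coind: "retract (Arr (TH H)) N \<sigma> (coind H N \<sigma>) (coind_act \<sigma>)"
proof -
  have "op_hom (Arr (TH H)) (coind H N \<sigma>) (coind_act \<sigma>) N \<sigma> (\<lambda>F. slice F \<one>)"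
    unfolding op_hom_def lin_on_def
  proof (intro conjI ballI allI image_subsetI)
    fix a F assume "a \<in> Arr (TH H)" and F: "F \<in> coind H N \<sigma>"
    then obtain \<alpha> g where a: "a = (\<alpha>, g)" "\<alpha> \<in> r" "g \<in> H" by auto
    show "slice (coind_act \<sigma> a F) \<one> = \<sigma> a (slice F \<one>)"
      using a H_G[OF a(3)] slice_gact_inv[OF F a(3)] coindD(2)[OF F one_closed]
      by (simp add: slice_coind_act sigma_gact)
  qed (auto simp: slice_add slice_scale coindD(2))
  moreover have "slice (embed v) \<one> = v" if "v \<in> N" for v
    using gact_one[OF that] by (simp add: embed_def slice_glue)
  ultimately show ?thesis unfolding retract_def using embed_hom[OF subgroup_H order_refl] by blast
qed

end

context poset_with_action
begin

lemma transporter_repI: "subgroup H G \<Longrightarrow> cat_rep (TH H) N \<sigma> \<Longrightarrow> transporter_rep G P r \<phi> H N \<sigma>"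
  by (intro transporter_rep.intro transporter_rep_axioms.intro poset_with_action_axioms)

lemma TH_carrier: "TH (carrier G) = T"
  by (simp add: TH_def transporter_category_def poset_category_def)

lemma cat_rep_TH_mono:
  assumes "cat_rep (TH H) N \<sigma>" "K \<subseteq> H" "\<one> \<in> K"
  shows "cat_rep (TH K) N \<sigma>"
proof -
  have "Arr (TH K) \<subseteq> Arr (TH H)" using assms(2) by auto
  then show ?thesis
    using assms(1) op_rep_sub_arrows[of "Arr (TH H)" N \<sigma> "Arr (TH K)"] unfolding cat_rep_def by (auto simp: subset_iff)
qed

theorem fin_type_subgroup:
  assumes fin: "fin_type TYPE('g \<times> 'i) TYPE('k::field) T" and H: "subgroup H G"
  shows "fin_type TYPE('i) TYPE('k) (TH H)"
proof (rule fin_type_restrict[OF fin])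
  show "Arr (TH H) \<subseteq> Arr T" using subgroup.subset[OF H] by auto
  fix N :: "('i \<Rightarrow> 'k) set" and \<sigma>
  assume N: "cat_rep (TH H) N \<sigma>" "fin_support N"
  interpret transporter_rep G P r \<phi> H N \<sigma> by (rule transporter_repI[OF H N(1)])
  show "\<exists>(Y :: ('g \<times> 'i \<Rightarrow> 'k) set) \<tau>. cat_rep T Y \<tau> \<and> fin_support Y \<and> retract (Arr (TH H)) N \<sigma> Y \<tau>"
    using cat_rep_coind coind_fin_support[OF N(2)] retract_coind by blast
qed

definition coind_map :: "(('i \<Rightarrow> 'k) \<Rightarrow> ('j \<Rightarrow> 'k::field)) \<Rightarrow> ('g \<times> 'i \<Rightarrow> 'k) \<Rightarrow> ('g \<times> 'j \<Rightarrow> 'k)" where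
  "coind_map f F = glue (\<lambda>u. f (slice F u))"

lemma slice_coind_map: "u \<in> carrier G \<Longrightarrow> slice (coind_map f F) u = f (slice F u)"
  by (simp add: coind_map_def slice_glue)

lemma coind_map_supp: "u \<notin> carrier G \<Longrightarrow> coind_map f F (u, i) = 0"
  by (simp add: coind_map_def glue_supp)

lemma coind_map_hom:
  assumes "transporter_rep G P r \<phi> H N \<sigma>" "transporter_rep G P r \<phi> H N' \<sigma>'"
    and f: "op_hom (Arr (TH H)) N \<sigma> N' \<sigma>' f"
  shows "op_hom (Arr T) (coind H N \<sigma>) (coind_act \<sigma>) (coind H N' \<sigma>') (coind_act \<sigma>') (coind_map f)"
proof -
  interpret A: transporter_rep G P r \<phi> H N \<sigma> by fact
  interpret B: transporter_rep G P r \<phi> H N' \<sigma>' by fact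
  have lin: "lin_on N f" and fN: "\<And>v. v \<in> N \<Longrightarrow> f v \<in> N'"
    and comm: "\<And>\<alpha> h v. \<alpha> \<in> r \<Longrightarrow> h \<in> H \<Longrightarrow> v \<in> N \<Longrightarrow> f (\<sigma> (\<alpha>, h) v) = \<sigma>' (\<alpha>, h) (f v)"
    using op_homD[OF f] by auto
  have g: "f (gact \<sigma> h v) = gact \<sigma>' h (f v)" if "h \<in> H" "v \<in> N" for h v
  proof -
    have "f (gact \<sigma> h v) = (\<Sum>x\<in>P. f (\<sigma> ((x, x), h) v))"
      unfolding gact_def using that by (intro lin_on_sum[OF lin A.sub] A.sigma_closed r_refl)
    also have "\<dots> = gact \<sigma>' h (f v)"
      unfolding gact_def using that by (intro sum.cong refl comm r_refl)
    finally show ?thesis .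
  qed
  show ?thesis
    unfolding op_hom_def lin_on_def
  proof (intro conjI ballI allI image_subsetI)
    fix F assume F: "F \<in> coind H N \<sigma>"
    show "coind_map f F \<in> coind H N' \<sigma>'"
      unfolding coind_map_def
    proof (rule glue_coindI)
      show "f (slice F (u \<otimes> inv h)) = gact \<sigma>' h (f (slice F u))" if "u \<in> carrier G" "h \<in> H" for u h
        using coindD(3)[OF F that] g[OF that(2) coindD(2)[OF F that(1)]] by simp
    qed (use F fN A.H_G in \<open>auto dest: coindD(2)\<close>)
    show "coind_map f (fscale c F) = fscale c (coind_map f F)" for c
      using F lin_onD(2)[OF lin coindD(2)[OF F]]
      by (intro slice_eqI) (auto simp: coind_map_supp slice_coind_map slice_scale fscale_apply)
    show "coind_map f (F + F') = coind_map f F + coind_map f F'" if F': "F' \<in> coind H N \<sigma>" for F'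
      using lin_onD(1)[OF lin coindD(2)[OF F] coindD(2)[OF F']]
      by (intro slice_eqI) (auto simp: coind_map_supp slice_coind_map slice_add)
  next
    fix a F assume "a \<in> Arr T" and F: "F \<in> coind H N \<sigma>"
    then obtain \<alpha> g where a: "a = (\<alpha>, g)" "\<alpha> \<in> r" "g \<in> carrier G" by auto
    show "coind_map f (coind_act \<sigma> a F) = coind_act \<sigma>' a (coind_map f F)"
    proof (rule slice_eqI)
      show "coind_act \<sigma>' a (coind_map f F) (u, i) = 0" if "u \<notin> carrier G" for u i
        using that by (simp add: coind_act_def)
      fix u assume u: "u \<in> carrier G"
      then show "slice (coind_map f (coind_act \<sigma> a F)) u = slice (coind_act \<sigma>' a (coind_map f F)) u"
        using a coindD(2)[OF F, of "inv g \<otimes> u"] by (simp add: slice_coind_map slice_coind_act comm)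
    qed (rule coind_map_supp)
  qed
qed

lemma retract_coind_mono:
  assumes N: "transporter_rep G P r \<phi> H N \<sigma>" "transporter_rep G P r \<phi> H N' \<sigma>'"
    and "retract (Arr (TH H)) N \<sigma> N' \<sigma>'"
  shows "retract (Arr T) (coind H N \<sigma>) (coind_act \<sigma>) (coind H N' \<sigma>') (coind_act \<sigma>')"
proof -
  obtain f g where f: "op_hom (Arr (TH H)) N \<sigma> N' \<sigma>' f" and g: "op_hom (Arr (TH H)) N' \<sigma>' N \<sigma> g"
    and gf: "\<And>x. x \<in> N \<Longrightarrow> g (f x) = x"
    using assms(3) unfolding retract_def by blast
  have "coind_map g (coind_map f F) = F" if F: "F \<in> coind H N \<sigma>" for F
    using gf coindD[OF F] by (intro slice_eqI) (auto simp: coind_map_supp slice_coind_map)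
  then show ?thesis
    unfolding retract_def using coind_map_hom[OF N f] coind_map_hom[OF N(2,1) g] by blast
qed

text \<open>
  The average of \<open>u F(u)\<close> over \<open>u \<in> G\<close> is a morphism of representations of the whole transporter
  category, and it is a left inverse of \<open>embed\<close>, since every term of the average of \<open>embed v\<close> equals \<open>v\<close>.
\<close>

lemma maschke:
  fixes N :: "('i \<Rightarrow> 'k::field) set"
  assumes N: "cat_rep T N \<sigma>" and inv: "of_nat (card (carrier G)) \<noteq> (0 :: 'k)"
  shows "retract (Arr T) N \<sigma> (coind {\<one>} N \<sigma>) (coind_act \<sigma>)"
proof -
  interpret transporter_rep G P r \<phi> "carrier G" N \<sigma>
    by (rule transporter_repI) (use N in \<open>simp_all add: TH_carrier subgroup_self\<close>)
  have triv: "subgroup {\<one>} G" by (rule triv_subgroup)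
  define c where "c = inverse (of_nat (card (carrier G)) :: 'k)"
  define S where "S F = (\<Sum>u\<in>carrier G. gact \<sigma> u (slice F u))" for F
  have SN: "S F \<in> N" if "F \<in> coind {\<one>} N \<sigma>" for F
    unfolding S_def using coindD(2)[OF that] by (intro fs.subspace_sum[OF sub] gact_closed) auto
  have e: "op_hom (Arr T) N \<sigma> (coind {\<one>} N \<sigma>) (coind_act \<sigma>) embed"
    using embed_hom[OF triv] by (simp add: TH_carrier)
  have p: "op_hom (Arr T) (coind {\<one>} N \<sigma>) (coind_act \<sigma>) N \<sigma> (\<lambda>F. fscale c (S F))"
    unfolding op_hom_def lin_on_def
  proof (intro conjI ballI allI image_subsetI)
    fix F assume F: "F \<in> coind {\<one>} N \<sigma>"
    note FN = coindD(2)[OF F]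
    show "fscale c (S F) \<in> N" by (rule fs.subspace_scale[OF sub SN[OF F]])
    have "S (fscale d F) = fscale d (S F)" for d
      unfolding S_def fs.scale_sum_right using FN by (intro sum.cong refl) (simp add: slice_scale gact_scale)
    then show "fscale c (S (fscale d F)) = fscale d (fscale c (S F))" for d
      by (simp add: mult.commute)
    show "fscale c (S (F + F')) = fscale c (S F) + fscale c (S F')" if F': "F' \<in> coind {\<one>} N \<sigma>" for F'
    proof -
      have "S (F + F') = S F + S F'"
        unfolding S_def sum.distrib[symmetric] using FN coindD(2)[OF F']
        by (intro sum.cong refl) (simp add: slice_add gact_add)
      then show ?thesis by (simp add: fs.scale_right_distrib)
    qed
  next
    fix a F assume "a \<in> Arr T" and F: "F \<in> coind {\<one>} N \<sigma>"
    then obtain \<alpha> g where a: "a = (\<alpha>, g)" "\<alpha> \<in> r" "g \<in> carrier G" by auto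
    note FN = coindD(2)[OF F]
    have "S (coind_act \<sigma> a F) = (\<Sum>u\<in>carrier G. \<sigma> (\<alpha>, u) (slice F (inv g \<otimes> u)))"
      unfolding S_def
    proof (rule sum.cong[OF refl])
      fix u assume u: "u \<in> carrier G"
      then show "gact \<sigma> u (slice (coind_act \<sigma> a F) u) = \<sigma> (\<alpha>, u) (slice F (inv g \<otimes> u))"
        using a FN[of "inv g \<otimes> u"] by (simp add: slice_coind_act gact_sigma act_arrow_act_arrow)
    qed
    also have "\<dots> = (\<Sum>w\<in>carrier G. \<sigma> (\<alpha>, g \<otimes> w) (slice F w))"
      using a by (intro sum.reindex_bij_witness[of _ "\<lambda>w. g \<otimes> w" "\<lambda>u. inv g \<otimes> u"])
        (auto simp: m_assoc[symmetric])
    also have "\<dots> = (\<Sum>w\<in>carrier G. \<sigma> (\<alpha>, g) (gact \<sigma> w (slice F w)))"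
      using a FN by (intro sum.cong refl) (simp add: sigma_gact)
    also have "\<dots> = \<sigma> (\<alpha>, g) (S F)"
      unfolding S_def using a FN by (intro lin_on_sum[OF sigma_lin sub, symmetric] gact_closed) auto
    finally show "fscale c (S (coind_act \<sigma> a F)) = \<sigma> a (fscale c (S F))"
      using lin_onD(2)[OF sigma_lin[OF a(2,3)] SN[OF F]] a(1) by simp
  qed
  have "fscale c (S (embed v)) = v" if v: "v \<in> N" for v
  proof -
    have "S (embed v) = (\<Sum>u\<in>carrier G. v)"
      unfolding S_def
    proof (rule sum.cong[OF refl])
      fix u assume u: "u \<in> carrier G"
      then have "slice (embed v) u = gact \<sigma> (inv u) v" by (simp add: embed_def slice_glue)
      then show "gact \<sigma> u (slice (embed v) u) = v" using u v by (simp add: gact_gact gact_one)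
    qed
    also have "\<dots> = fscale (of_nat (card (carrier G))) v" by (rule fs.sum_constant_scale)
    finally have "fscale c (S (embed v)) = fscale (c * of_nat (card (carrier G))) v"
      by (simp only: fs.scale_scale)
    then show ?thesis using inv by (simp add: c_def)
  qed
  then show ?thesis unfolding retract_def using e p by blast
qed

text \<open>
  An indecomposable \<open>N\<close> is a summand of the representation coinduced from its restriction to the
  poset. Coinduction respects the decomposition of that restriction, so \<open>N\<close> is a summand of a representation
  coinduced from one indecomposable of the poset.
\<close>

theorem fin_type_transporter:
  assumes fin: "fin_type TYPE('i) TYPE('k::field) (TH {\<one>})" and inv: "of_nat (card (carrier G)) \<noteq> (0 :: 'k)"
  shows "fin_type TYPE('i) TYPE('k) T"
proof -
  let ?A = "Arr (TH {\<one>})"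
  obtain F :: "(('i \<Rightarrow> 'k) set \<times> (('x \<times> 'x) \<times> 'g \<Rightarrow> ('i \<Rightarrow> 'k) \<Rightarrow> ('i \<Rightarrow> 'k))) set" where F: "finite F"
    "\<And>W \<sigma>. (W, \<sigma>) \<in> F \<Longrightarrow> cat_rep (TH {\<one>}) W \<sigma>" "\<And>W \<sigma>. (W, \<sigma>) \<in> F \<Longrightarrow> fin_support W"
    "\<And>(V :: ('i \<Rightarrow> 'k) set) \<rho>. cat_rep (TH {\<one>}) V \<rho> \<Longrightarrow> fin_support V \<Longrightarrow> indec ?A V \<rho> \<Longrightarrow> \<exists>W \<sigma>. (W, \<sigma>) \<in> F \<and> op_iso ?A V \<rho> W \<sigma>"
    by (rule fin_typeE[OF fin]) (rule that)
  have tr: "transporter_rep G P r \<phi> {\<one>} W \<sigma>" if "cat_rep (TH {\<one>}) W \<sigma>" for W :: "('i \<Rightarrow> 'k) set" and \<sigma>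
    by (rule transporter_repI[OF triv_subgroup that])
  let ?co = "\<lambda>Y. coind {\<one>} (fst Y) (snd Y)" and ?act = "\<lambda>Y. coind_act (snd Y)"
  have "\<exists>D'. finite D' \<and> (\<forall>U\<in>D'. op_rep (Arr T) U (?act Y) \<and> U \<subseteq> ?co Y) \<and>
    (\<forall>(M :: ('i \<Rightarrow> 'k) set) \<mu>. op_rep (Arr T) M \<mu> \<and> fin_support M \<and> indec (Arr T) M \<mu> \<and> retract (Arr T) M \<mu> (?co Y) (?act Y) \<longrightarrow>
       (\<exists>U\<in>D'. op_iso (Arr T) M \<mu> U (?act Y)))" if "Y \<in> F" for Y
  proof (rule finitely_many_indec_retracts)
    have Y: "(fst Y, snd Y) \<in> F" using that by simp
    show "op_rep (Arr T) (?co Y) (?act Y)"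
      by (rule cat_repD(1)[OF transporter_rep.cat_rep_coind[OF tr[OF F(2)[OF Y]]]])
    show "fin_support (?co Y)" by (rule coind_fin_support[OF F(3)[OF Y]])
  qed
  then obtain Ret where Ret: "\<And>Y. Y \<in> F \<Longrightarrow> finite (Ret Y)"
    "\<And>Y U. Y \<in> F \<Longrightarrow> U \<in> Ret Y \<Longrightarrow> op_rep (Arr T) U (?act Y)"
    "\<And>Y (M :: ('i \<Rightarrow> 'k) set) \<mu>. Y \<in> F \<Longrightarrow> op_rep (Arr T) M \<mu> \<Longrightarrow> fin_support M \<Longrightarrow> indec (Arr T) M \<mu> \<Longrightarrow>
      retract (Arr T) M \<mu> (?co Y) (?act Y) \<Longrightarrow> \<exists>U\<in>Ret Y. op_iso (Arr T) M \<mu> U (?act Y)"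
    by metis
  define S where "S = (SIGMA Y:F. Ret Y)"
  show ?thesis
  proof (rule fin_typeI[where S = S and R = "\<lambda>N \<sigma> s. op_iso (Arr T) N \<sigma> (snd s) (?act (fst s))"])
    show "finite S" unfolding S_def using F(1) Ret(1) by blast
  next
    fix N :: "('i \<Rightarrow> 'k) set" and \<sigma>
    assume N: "cat_rep T N \<sigma>" "fin_support N" "indec (Arr T) N \<sigma>"
    have N1: "cat_rep (TH {\<one>}) N \<sigma>"
      by (rule cat_rep_TH_mono[of "carrier G"]) (use N(1) in \<open>simp_all add: TH_carrier\<close>)
    note trN = tr[OF N1]
    obtain m U e where "decomp ?A N \<sigma> m U e" using decomp_exists[OF cat_repD(1)[OF N1] N(2)] by blast
    note dec = decompD[OF this]
    have U: "cat_rep (TH {\<one>}) (U j) \<sigma>" if "j < m" for j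
      using dec(1)[OF that] by (intro cat_rep_sub[OF N1]) auto
    have "\<exists>j\<in>{..<m}. retract (Arr T) N \<sigma> (coind {\<one>} (U j) \<sigma>) (coind_act \<sigma>)"
    proof (rule retract_component[OF cat_repD(1)[OF N(1)] N(2,3) maschke[OF N(1) inv], of _ "\<lambda>j. coind {\<one>} (U j) \<sigma>" "\<lambda>j. coind_map (e j)"])
      show "op_rep (Arr T) (coind {\<one>} N \<sigma>) (coind_act \<sigma>)"
        by (rule cat_repD(1)[OF transporter_rep.cat_rep_coind[OF trN]])
      show "op_hom (Arr T) (coind {\<one>} N \<sigma>) (coind_act \<sigma>) (coind {\<one>} (U j) \<sigma>) (coind_act \<sigma>) (coind_map (e j))"
        if "j \<in> {..<m}" for j
        using that dec(1)[of j] by (intro coind_map_hom trN tr U) auto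
      show "coind {\<one>} (U j) \<sigma> \<subseteq> coind {\<one>} N \<sigma>" if "j \<in> {..<m}" for j
        using that dec(1)[of j] by (auto simp: coind_def)
      show "(\<Sum>j<m. coind_map (e j) Q) = Q" if Q: "Q \<in> coind {\<one>} N \<sigma>" for Q
      proof (rule slice_eqI)
        show "(\<Sum>j<m. coind_map (e j) Q) (u, i) = 0" if "u \<notin> carrier G" for u i
          using that by (simp add: sum_fun_apply coind_map_supp)
        show "Q (u, i) = 0" if "u \<notin> carrier G" for u i using coindD(1)[OF Q that] .
        fix u assume u: "u \<in> carrier G"
        have "slice (\<Sum>j<m. coind_map (e j) Q) u = (\<Sum>j<m. slice (coind_map (e j) Q) u)"
          by (rule ext) (simp add: slice_def sum_fun_apply)
        also have "\<dots> = (\<Sum>j<m. e j (slice Q u))" using u by (simp add: slice_coind_map)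
        also have "\<dots> = slice Q u" by (rule dec(2)[OF coindD(2)[OF Q u]])
        finally show "slice (\<Sum>j<m. coind_map (e j) Q) u = slice Q u" .
      qed
    qed simp
    then obtain j where j: "j < m" "retract (Arr T) N \<sigma> (coind {\<one>} (U j) \<sigma>) (coind_act \<sigma>)" by blast
    have Uj: "U j \<subseteq> N" "indec ?A (U j) \<sigma>" using dec(1)[OF j(1)] by auto
    obtain W \<omega> where W: "(W, \<omega>) \<in> F" "op_iso ?A (U j) \<sigma> W \<omega>"
      using F(4)[OF U[OF j(1)] fin_support_mono[OF N(2) Uj(1)] Uj(2)] by blast
    have "retract (Arr T) (coind {\<one>} (U j) \<sigma>) (coind_act \<sigma>) (coind {\<one>} W \<omega>) (coind_act \<omega>)"
      by (rule retract_coind_mono[OF tr[OF U[OF j(1)]] tr[OF F(2)[OF W(1)]] op_iso_retr[OF W(2) cat_repD(1)[OF U[OF j(1)]]]])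
    then have "retract (Arr T) N \<sigma> (coind {\<one>} W \<omega>) (coind_act \<omega>)" by (rule retract_trans[OF j(2)])
    then obtain U' where "U' \<in> Ret (W, \<omega>)" "op_iso (Arr T) N \<sigma> U' (coind_act \<omega>)"
      using Ret(3)[OF W(1) cat_repD(1)[OF N(1)] N(2,3)] by auto
    then show "\<exists>s\<in>S. op_iso (Arr T) N \<sigma> (snd s) (?act (fst s))"
      using W(1) by (intro bexI[of _ "((W, \<omega>), U')"]) (auto simp: S_def)
  next
    fix V V' :: "('i \<Rightarrow> 'k) set" and \<rho> \<rho>' s
    assume "cat_rep T V \<rho>" "cat_rep T V' \<rho>'" "s \<in> S" "op_iso (Arr T) V \<rho> (snd s) (?act (fst s))"
      "op_iso (Arr T) V' \<rho>' (snd s) (?act (fst s))"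
    then show "op_iso (Arr T) V \<rho> V' \<rho>'"
      using op_iso_trans op_iso_sym cat_repD(1) by blast
  qed
qed

section \<open>The trivial subgroup and the one-point poset\<close>

lemma poset_category_simps [simp]:
  "Obj (poset_category P r) = P" "Arr (poset_category P r) = r" "Dom (poset_category P r) = fst"
  "Cod (poset_category P r) = snd" "Ident (poset_category P r) x = (x, x)"
  "Comp (poset_category P r) \<alpha> \<beta> = (fst \<beta>, snd \<alpha>)"
  by (simp_all add: poset_category_def)

lemma group_category_simps [simp]:
  "Obj (group_category G) = {()}" "Arr (group_category G) = carrier G" "Dom (group_category G) g = ()"
  "Cod (group_category G) g = ()" "Ident (group_category G) u = \<one>" "Comp (group_category G) g h = g \<otimes> h"
  by (simp_all add: group_category_def)

lemma r_comp: "\<alpha> \<in> r \<Longrightarrow> \<beta> \<in> r \<Longrightarrow> fst \<alpha> = snd \<beta> \<Longrightarrow> (fst \<beta>, snd \<alpha>) \<in> r"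
  using r_trans[of "fst \<beta>" "snd \<beta>" "snd \<alpha>"] by (cases \<alpha>; cases \<beta>) simp

lemma Ident_T_image: "Ident T ` Obj T = (\<lambda>x. ((x, x), \<one>)) ` P"
  by (intro image_cong) simp_all

lemma fin_type_TH_one_iff:
  "fin_type TYPE('i) TYPE('k::field) (TH {\<one>}) \<longleftrightarrow> fin_type TYPE('i) TYPE('k) (poset_category P r)"
proof
  have I: "Ident (poset_category P r) ` Obj (poset_category P r) = (\<lambda>x. (x, x)) ` P"
    "Ident (TH {\<one>}) ` Obj (TH {\<one>}) = (\<lambda>x. ((x, x), \<one>)) ` P"
    by (intro image_cong; simp)+
  assume *: "fin_type TYPE('i) TYPE('k) (TH {\<one>})"
  show "fin_type TYPE('i) TYPE('k) (poset_category P r)"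
  proof (rule fin_type_category_iso[OF *, where h = "\<lambda>\<alpha>. (\<alpha>, \<one>)"], unfold I)
    show "bij_betw (\<lambda>\<alpha>. (\<alpha>, \<one>)) (Arr (poset_category P r)) (Arr (TH {\<one>}))"
      by (auto simp: bij_betw_def inj_on_def)
    show "(\<lambda>\<alpha>. (\<alpha>, \<one>)) ` (\<lambda>x. (x, x)) ` P = (\<lambda>x. ((x, x), \<one>)) ` P" by (simp add: image_image)
    show "(\<lambda>x. (x, x)) ` P \<subseteq> Arr (poset_category P r)" using r_refl by auto
    fix \<alpha> \<beta> assume "\<alpha> \<in> Arr (poset_category P r)" "\<beta> \<in> Arr (poset_category P r)"
    then have ab: "\<alpha> \<in> r" "\<beta> \<in> r" by simp_all
    show "Dom (poset_category P r) \<alpha> = Cod (poset_category P r) \<beta> \<longleftrightarrow> Dom (TH {\<one>}) (\<alpha>, \<one>) = Cod (TH {\<one>}) (\<beta>, \<one>)"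
      using ab by (simp add: phi_one r_PD)
    show "(Comp (poset_category P r) \<alpha> \<beta>, \<one>) = Comp (TH {\<one>}) (\<alpha>, \<one>) (\<beta>, \<one>)"
      using ab by (simp add: phi_one r_PD)
    assume "Dom (poset_category P r) \<alpha> = Cod (poset_category P r) \<beta>"
    then show "Comp (poset_category P r) \<alpha> \<beta> \<in> Arr (poset_category P r)"
      using r_comp[OF ab] by simp
  qed
next
  have I: "Ident (poset_category P r) ` Obj (poset_category P r) = (\<lambda>x. (x, x)) ` P"
    "Ident (TH {\<one>}) ` Obj (TH {\<one>}) = (\<lambda>x. ((x, x), \<one>)) ` P"
    by (intro image_cong; simp)+
  assume *: "fin_type TYPE('i) TYPE('k) (poset_category P r)"
  show "fin_type TYPE('i) TYPE('k) (TH {\<one>})"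
  proof (rule fin_type_category_iso[OF *, where h = fst], unfold I)
    show "bij_betw fst (Arr (TH {\<one>})) (Arr (poset_category P r))"
      by (auto simp: bij_betw_def inj_on_def)
    show "fst ` (\<lambda>x. ((x, x), \<one>)) ` P = (\<lambda>x. (x, x)) ` P" by (simp add: image_image)
    show "(\<lambda>x. ((x, x), \<one>)) ` P \<subseteq> Arr (TH {\<one>})" using r_refl by auto
    fix a b assume "a \<in> Arr (TH {\<one>})" "b \<in> Arr (TH {\<one>})"
    then obtain \<alpha> \<beta> where ab: "a = (\<alpha>, \<one>)" "b = (\<beta>, \<one>)" "\<alpha> \<in> r" "\<beta> \<in> r" by auto
    show "Dom (TH {\<one>}) a = Cod (TH {\<one>}) b \<longleftrightarrow> Dom (poset_category P r) (fst a) = Cod (poset_category P r) (fst b)"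
      using ab by (simp add: phi_one r_PD)
    show "fst (Comp (TH {\<one>}) a b) = Comp (poset_category P r) (fst a) (fst b)"
      using ab by (simp add: phi_one r_PD)
    assume D: "Dom (TH {\<one>}) a = Cod (TH {\<one>}) b"
    have "fst \<alpha> = snd \<beta>" using ab D by (simp add: phi_one r_PD)
    then have "(fst \<beta>, snd \<alpha>) \<in> r" by (rule r_comp[OF ab(3,4)])
    then show "Comp (TH {\<one>}) a b \<in> Arr (TH {\<one>})"
      using ab by (simp add: phi_one r_PD)
  qed
qed

lemma one_point_order:
  assumes P: "P = {x}"
  shows "r = {(x, x)}"
proof (intro equalityI subsetI)
  fix a assume "a \<in> r"
  then have "fst a \<in> P" "snd a \<in> P" by (rule r_PD)+
  then show "a \<in> {(x, x)}" unfolding P by (cases a) simp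
next
  fix a assume "a \<in> {(x, x)}"
  then show "a \<in> r" using r_refl[of x] P by simp
qed

lemma fin_type_group_iff:
  assumes P: "P = {x}"
  shows "fin_type TYPE('i) TYPE('k::field) T \<longleftrightarrow> fin_type TYPE('i) TYPE('k) (group_category G)"
proof
  note r = one_point_order[OF P]
  have fx: "\<phi> g x = x" if "g \<in> carrier G" for g using phi_P[OF that, of x] P by simp
  have I: "Ident (group_category G) ` Obj (group_category G) = {\<one>}" "Ident T ` Obj T = {((x, x), \<one>)}"
    by simp (rule trans[OF Ident_T_image], simp add: P)
  have A: "Arr T = (\<lambda>g. ((x, x), g)) ` carrier G" by (rule trans[OF T_simps(2)]) (auto simp: r)
  assume *: "fin_type TYPE('i) TYPE('k) T"
  show "fin_type TYPE('i) TYPE('k) (group_category G)"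
    by (rule fin_type_category_iso[OF *, where h = "\<lambda>g. ((x, x), g)"], unfold I A)
      (auto simp: bij_betw_def inj_on_def fx)
next
  note r = one_point_order[OF P]
  have fx: "\<phi> g x = x" if "g \<in> carrier G" for g using phi_P[OF that, of x] P by simp
  have I: "Ident (group_category G) ` Obj (group_category G) = {\<one>}" "Ident T ` Obj T = {((x, x), \<one>)}"
    by simp (rule trans[OF Ident_T_image], simp add: P)
  have A: "Arr T = (\<lambda>g. ((x, x), g)) ` carrier G" by (rule trans[OF T_simps(2)]) (auto simp: r)
  assume *: "fin_type TYPE('i) TYPE('k) (group_category G)"
  show "fin_type TYPE('i) TYPE('k) T"
  proof (rule fin_type_category_iso[OF *, where h = snd], unfold I A)
    show "bij_betw snd ((\<lambda>g. ((x, x), g)) ` carrier G) (Arr (group_category G))"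
      by (auto simp: bij_betw_def inj_on_def image_image)
  qed (auto simp: fx)
qed

end

section \<open>Representations of a poset by coordinates\<close>

text \<open>
  Over a finite field the product of all \<open>x - a\<close> plus one has no root.
\<close>

lemma infinite_alg_closed_field: "infinite (UNIV :: 'k::alg_closed_field set)"
proof
  assume fin: "finite (UNIV :: 'k set)"
  define q :: "'k poly" where "q = (\<Prod>a\<in>UNIV. [:- a, 1:])"
  have "degree q = card (UNIV :: 'k set)"
    unfolding q_def by (subst degree_prod_eq_sum_degree) auto
  moreover have "card (UNIV :: 'k set) > 0" using fin by (simp add: card_gt_0_iff)
  ultimately have "degree (q + 1) > 0" by (simp add: degree_add_eq_left)
  then obtain x where x: "poly (q + 1) x = 0" using alg_closed_imp_poly_has_root by blast
  have "poly q x = 0" unfolding q_def poly_prod using fin by (simp add: prod_zero_iff)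
  then show False using x by simp
qed

definition supported :: "'i set \<Rightarrow> ('i \<Rightarrow> 'k::field) set" where
  "supported I = {v. \<forall>i. i \<notin> I \<longrightarrow> v i = 0}"

lemma supported_subspace: "fs.subspace (supported I)"
  by (rule fs.subspaceI) (auto simp: supported_def fscale_apply)

lemma supported_fin_support: "finite I \<Longrightarrow> fin_support (supported I)"
  unfolding fin_support_def supported_def by blast

definition unit_vec :: "'i \<Rightarrow> 'i \<Rightarrow> 'k::field" where
  "unit_vec i = (\<lambda>j. if j = i then 1 else 0)"

lemma unit_vec_supported: "i \<in> I \<Longrightarrow> unit_vec i \<in> supported I"
  by (auto simp: unit_vec_def supported_def)

lemma unit_vec_nonzero: "unit_vec i \<noteq> (0 :: 'i \<Rightarrow> 'k::field)"
  by (metis unit_vec_def zero_fun_apply zero_neq_one)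

context poset_with_action
begin

text \<open>
  Each coordinate \<open>i\<close> belongs to the value at the element \<open>col i\<close>; the conditions say that the arrow from
  \<open>x\<close> to \<open>y\<close> reads the coordinates at \<open>x\<close> and writes those at \<open>y\<close>.
\<close>

lemma cat_rep_posetI:
  fixes \<rho> :: "'x \<times> 'x \<Rightarrow> ('i \<Rightarrow> 'k::field) \<Rightarrow> ('i \<Rightarrow> 'k)"
  assumes col: "\<And>i. i \<in> I \<Longrightarrow> col i \<in> P"
    and id: "\<And>x v. x \<in> P \<Longrightarrow> v \<in> supported I \<Longrightarrow> \<rho> (x, x) v = (\<lambda>i. if col i = x then v i else 0)"
    and lin: "\<And>x y. (x, y) \<in> r \<Longrightarrow> lin_on (supported I) (\<rho> (x, y))"
    and supp: "\<And>x y v i. (x, y) \<in> r \<Longrightarrow> v \<in> supported I \<Longrightarrow> i \<notin> I \<or> col i \<noteq> y \<Longrightarrow> \<rho> (x, y) v i = 0"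
    and dep: "\<And>x y v. (x, y) \<in> r \<Longrightarrow> v \<in> supported I \<Longrightarrow> (\<And>i. col i = x \<Longrightarrow> v i = 0) \<Longrightarrow> \<rho> (x, y) v = 0"
    and comp: "\<And>x y z v. (x, y) \<in> r \<Longrightarrow> (y, z) \<in> r \<Longrightarrow> x \<noteq> y \<Longrightarrow> y \<noteq> z \<Longrightarrow> v \<in> supported I \<Longrightarrow>
      \<rho> (y, z) (\<rho> (x, y) v) = \<rho> (x, z) v"
  shows "cat_rep (poset_category P r) (supported I) \<rho>"
proof -
  have mem: "\<rho> (x, y) v \<in> supported I" if "(x, y) \<in> r" "v \<in> supported I" for x y v
    using supp[OF that] by (auto simp: supported_def)
  have left: "\<rho> (y, y) (\<rho> (x, y) v) = \<rho> (x, y) v" if "(x, y) \<in> r" "v \<in> supported I" for x y v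
    using id[OF _ mem[OF that], of y] supp[OF that] r_P[OF that(1)] by (auto simp: fun_eq_iff)
  have right: "\<rho> (x, y) (\<rho> (x, x) v) = \<rho> (x, y) v" if "(x, y) \<in> r" "v \<in> supported I" for x y v
  proof -
    have x: "x \<in> P" using r_P[OF that(1)] by simp
    note m = mem[OF r_refl[OF x] that(2)]
    have "\<rho> (x, y) (v - \<rho> (x, x) v) = 0"
      by (rule dep[OF that(1) fs.subspace_diff[OF supported_subspace that(2) m]]) (simp add: id[OF x that(2)])
    then show ?thesis
      using lin_on_diff[OF lin[OF that(1)] supported_subspace that(2) m] by simp
  qed
  have main: "\<rho> a (\<rho> b v) = (if fst a = snd b then \<rho> (fst b, snd a) v else 0)"
    if ab: "a \<in> r" "b \<in> r" and v: "v \<in> supported I" for a b v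
  proof -
    obtain y z where a: "a = (y, z)" by (cases a)
    obtain x w where b: "b = (x, w)" by (cases b)
    show ?thesis
    proof (cases "y = w")
      case True
      then show ?thesis using ab a b v left right comp by (cases "x = w"; cases "y = z") auto
    next
      case False
      then have "\<rho> (y, z) (\<rho> (x, w) v) = 0"
        using ab a b v by (intro dep mem supp) auto
      then show ?thesis using a b False by simp
    qed
  qed
  have I: "Ident (poset_category P r) ` Obj (poset_category P r) = (\<lambda>x. (x, x)) ` P"
    by (intro image_cong) simp_all
  have "(\<Sum>a\<in>(\<lambda>x. (x, x)) ` P. \<rho> a v) = v" if v: "v \<in> supported I" for v
  proof -
    have "(\<Sum>a\<in>(\<lambda>x. (x, x)) ` P. \<rho> a v) = (\<Sum>x\<in>P. \<rho> (x, x) v)"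
      by (subst sum.reindex) (auto simp: inj_on_def)
    also have "\<dots> = v"
    proof (rule ext)
      fix i
      have "(\<Sum>x\<in>P. \<rho> (x, x) v) i = (\<Sum>x\<in>P. if x = col i then v i else 0)"
        unfolding sum_fun_apply using v by (intro sum.cong) (auto simp: id)
      then show "(\<Sum>x\<in>P. \<rho> (x, x) v) i = v i"
        using finite_P col[of i] v by (auto simp: supported_def)
    qed
    finally show ?thesis .
  qed
  moreover have "op_rep r (supported I) \<rho>"
    unfolding op_rep_def using supported_subspace mem lin by auto
  ultimately show ?thesis
    unfolding cat_rep_def I using main by simp
qed

text \<open>
  Among the elements above \<open>x\<close>, one with the fewest elements below it covers \<open>x\<close>; dually below \<open>y\<close>.
\<close>

lemma cover_exists:
  assumes "(x, y) \<in> r" "x \<noteq> y"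
  shows "\<exists>z. (x, z) \<in> r \<and> x \<noteq> z \<and> (\<forall>w. (x, w) \<in> r \<longrightarrow> (w, z) \<in> r \<longrightarrow> w = x \<or> w = z)"
    and "\<exists>z. (z, y) \<in> r \<and> z \<noteq> y \<and> (\<forall>w. (z, w) \<in> r \<longrightarrow> (w, y) \<in> r \<longrightarrow> w = z \<or> w = y)"
proof -
  have card: "card {a \<in> P. (a, w) \<in> r} < card {a \<in> P. (a, z) \<in> r}" "card {a \<in> P. (z, a) \<in> r} < card {a \<in> P. (w, a) \<in> r}"
    if "(w, z) \<in> r" "w \<noteq> z" for w z
  proof -
    have "{a \<in> P. (a, w) \<in> r} \<subset> {a \<in> P. (a, z) \<in> r}" "{a \<in> P. (z, a) \<in> r} \<subset> {a \<in> P. (w, a) \<in> r}"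
      using that r_trans r_antisym r_refl r_P by blast+
    then show "card {a \<in> P. (a, w) \<in> r} < card {a \<in> P. (a, z) \<in> r}" "card {a \<in> P. (z, a) \<in> r} < card {a \<in> P. (w, a) \<in> r}"
      using finite_P by (simp_all add: psubset_card_mono)
  qed
  obtain z where z: "(x, z) \<in> r \<and> x \<noteq> z" "\<And>w. (x, w) \<in> r \<and> x \<noteq> w \<Longrightarrow> card {a \<in> P. (a, z) \<in> r} \<le> card {a \<in> P. (a, w) \<in> r}"
    using ex_has_least_nat[of "\<lambda>z. (x, z) \<in> r \<and> x \<noteq> z" y "\<lambda>z. card {a \<in> P. (a, z) \<in> r}"] assms by blast
  have "w = x \<or> w = z" if "(x, w) \<in> r" "(w, z) \<in> r" for w
    using z(2)[of w] card(1)[OF that(2)] that by fastforce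
  then show "\<exists>z. (x, z) \<in> r \<and> x \<noteq> z \<and> (\<forall>w. (x, w) \<in> r \<longrightarrow> (w, z) \<in> r \<longrightarrow> w = x \<or> w = z)"
    using z(1) by blast
  obtain u where u: "(u, y) \<in> r \<and> u \<noteq> y" "\<And>w. (w, y) \<in> r \<and> w \<noteq> y \<Longrightarrow> card {a \<in> P. (u, a) \<in> r} \<le> card {a \<in> P. (w, a) \<in> r}"
    using ex_has_least_nat[of "\<lambda>z. (z, y) \<in> r \<and> z \<noteq> y" x "\<lambda>z. card {a \<in> P. (z, a) \<in> r}"] assms by blast
  have "w = u \<or> w = y" if "(u, w) \<in> r" "(w, y) \<in> r" for w
    using u(2)[of w] card(2)[OF that(1)] that by fastforce
  then show "\<exists>z. (z, y) \<in> r \<and> z \<noteq> y \<and> (\<forall>w. (z, w) \<in> r \<longrightarrow> (w, y) \<in> r \<longrightarrow> w = z \<or> w = y)"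
    using u(1) by blast
qed

section \<open>Four neighbours of one element\<close>

text \<open>
  Coordinates 0 and 1 span a plane at \<open>x\<close>; each of the coordinates 2 to 5 spans a line at one of the four
  neighbours. The vectors \<open>(line1 i, line2 l i)\<close>, namely \<open>(1, 0)\<close>, \<open>(0, 1)\<close>, \<open>(1, 1)\<close> and \<open>(1, l)\<close>, serve as linear
  forms on the plane if the neighbours lie above \<open>x\<close> and as vectors in the plane if they lie below.
\<close>

definition star_col :: "'x \<Rightarrow> (nat \<Rightarrow> 'x) \<Rightarrow> nat \<Rightarrow> 'x" where
  "star_col x y i = (if i < 2 then x else y i)"

definition line1 :: "nat \<Rightarrow> 'k::field" where
  "line1 i = (if i = 3 then 0 else 1)"

definition line2 :: "'k \<Rightarrow> nat \<Rightarrow> 'k::field" where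
  "line2 l i = (if i = 2 then 0 else if i = 5 then l else 1)"

definition star_out :: "'x \<Rightarrow> (nat \<Rightarrow> 'x) \<Rightarrow> 'k::field \<Rightarrow> 'x \<times> 'x \<Rightarrow> (nat \<Rightarrow> 'k) \<Rightarrow> (nat \<Rightarrow> 'k)" where
  "star_out x y l = (\<lambda>(z, w) v i. if z = w then (if star_col x y i = z then v i else 0)
     else if z = x \<and> 2 \<le> i \<and> i < 6 \<and> y i = w then line1 i * v 0 + line2 l i * v 1 else 0)"

definition star_in :: "'x \<Rightarrow> (nat \<Rightarrow> 'x) \<Rightarrow> 'k::field \<Rightarrow> 'x \<times> 'x \<Rightarrow> (nat \<Rightarrow> 'k) \<Rightarrow> (nat \<Rightarrow> 'k)" where
  "star_in x y l = (\<lambda>(z, w) v i. if z = w then (if star_col x y i = z then v i else 0)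
     else if w = x \<and> i = 0 then (\<Sum>j\<in>{2..<6}. if y j = z then line1 j * v j else 0)
     else if w = x \<and> i = 1 then (\<Sum>j\<in>{2..<6}. if y j = z then line2 l j * v j else 0) else 0)"

text \<open>
  As each neighbour covers \<open>x\<close>, no chain of two proper steps leads from \<open>x\<close> to it, so every composite of
  two non-identity arrows acts as zero on both sides.
\<close>

lemma cat_rep_star_out:
  assumes x: "x \<in> P" and y: "\<And>i. 2 \<le> i \<Longrightarrow> i < 6 \<Longrightarrow> (x, y i) \<in> r \<and> x \<noteq> y i"
    and cover: "\<And>i w. 2 \<le> i \<Longrightarrow> i < 6 \<Longrightarrow> (x, w) \<in> r \<Longrightarrow> (w, y i) \<in> r \<Longrightarrow> w = x \<or> w = y i"
  shows "cat_rep (poset_category P r) (supported {..<6}) (star_out x y (l :: 'k::field))"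
proof (rule cat_rep_posetI[where col = "star_col x y"])
  show "star_col x y i \<in> P" if "i \<in> {..<6}" for i
    using that x y[of i] r_P by (auto simp: star_col_def)
  show "star_out x y l (z, z) v = (\<lambda>i. if star_col x y i = z then v i else 0)" for z v
    by (auto simp: star_out_def)
  show "lin_on (supported {..<6}) (star_out x y l (z, w))" for z w
    by (auto simp: lin_on_def star_out_def fscale_apply fun_eq_iff algebra_simps)
  show "star_out x y l (z, w) v i = 0" if "v \<in> supported {..<6}" "i \<notin> {..<6} \<or> star_col x y i \<noteq> w" for z w v i
    using that by (auto simp: star_out_def supported_def star_col_def)
  show "star_out x y l (z, w) v = 0" if "\<And>i. star_col x y i = z \<Longrightarrow> v i = 0" for z w v
    using that that[of 0] that[of 1] by (auto simp: star_out_def fun_eq_iff star_col_def)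
  show "star_out x y l (b, c) (star_out x y l (a, b) v) = star_out x y l (a, c) v"
    if "(a, b) \<in> r" "(b, c) \<in> r" "a \<noteq> b" "b \<noteq> c" "v \<in> supported {..<6}" for a b c v
  proof (rule ext)
    fix i
    have "a \<noteq> c" using that r_antisym by blast
    moreover have "star_out x y l (a, x) v j = 0" if "j < 2" "a \<noteq> x" for j
      using that y[of j] by (auto simp: star_out_def)
    moreover have "\<not> (a = x \<and> 2 \<le> i \<and> i < 6 \<and> y i = c)" using cover[of i b] that by auto
    ultimately show "star_out x y l (b, c) (star_out x y l (a, b) v) i = star_out x y l (a, c) v i"
      using that by (auto simp: star_out_def)
  qed
qed

lemma cat_rep_star_in:
  assumes x: "x \<in> P" and y: "\<And>i. 2 \<le> i \<Longrightarrow> i < 6 \<Longrightarrow> (y i, x) \<in> r \<and> x \<noteq> y i"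
    and cover: "\<And>i w. 2 \<le> i \<Longrightarrow> i < 6 \<Longrightarrow> (y i, w) \<in> r \<Longrightarrow> (w, x) \<in> r \<Longrightarrow> w = y i \<or> w = x"
  shows "cat_rep (poset_category P r) (supported {..<6}) (star_in x y (l :: 'k::field))"
proof (rule cat_rep_posetI[where col = "star_col x y"])
  show "star_col x y i \<in> P" if "i \<in> {..<6}" for i
    using that x y[of i] r_P by (auto simp: star_col_def)
  show "star_in x y l (z, z) v = (\<lambda>i. if star_col x y i = z then v i else 0)" for z v
    by (auto simp: star_in_def)
  show "lin_on (supported {..<6}) (star_in x y l (z, w))" for z w
    by (auto simp: lin_on_def star_in_def fscale_apply fun_eq_iff algebra_simps sum.distrib[symmetric]
        sum_distrib_left intro!: sum.cong)
  show "star_in x y l (z, w) v i = 0" if "v \<in> supported {..<6}" "i \<notin> {..<6} \<or> star_col x y i \<noteq> w" for z w v i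
    using that by (auto simp: star_in_def supported_def star_col_def)
  show "star_in x y l (z, w) v = 0" if "\<And>i. star_col x y i = z \<Longrightarrow> v i = 0" for z w v
    using that by (auto simp: star_in_def fun_eq_iff star_col_def intro!: sum.neutral)
  show "star_in x y l (b, c) (star_in x y l (a, b) v) = star_in x y l (a, c) v"
    if "(a, b) \<in> r" "(b, c) \<in> r" "a \<noteq> b" "b \<noteq> c" "v \<in> supported {..<6}" for a b c v
  proof (rule ext)
    fix i
    have ac: "a \<noteq> c" using that r_antisym by blast
    have "star_in x y l (a, b) v j = 0" if "2 \<le> j" for j
      using that \<open>a \<noteq> b\<close> by (auto simp: star_in_def)
    then have L: "star_in x y l (b, c) (star_in x y l (a, b) v) i = 0"
      using \<open>b \<noteq> c\<close> by (auto simp: star_in_def intro!: sum.neutral)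
    have "\<not> (c = x \<and> 2 \<le> j \<and> j < 6 \<and> y j = a)" for j using cover[of j b] that by auto
    then have "star_in x y l (a, c) v i = 0"
      using ac by (auto simp: star_in_def intro!: sum.neutral)
    then show "star_in x y l (b, c) (star_in x y l (a, b) v) i = star_in x y l (a, c) v i" using L by simp
  qed
qed

end

lemma bij_hom_eq_zero:
  assumes "op_hom A V \<rho> W \<sigma> f" "bij_betw f V W" "fs.subspace V" "v \<in> V" "f v = 0"
  shows "v = 0"
proof (rule inj_onD[OF bij_betw_imp_inj_on[OF assms(2)] _ assms(4) fs.subspace_0[OF assms(3)]])
  show "f v = f 0" using assms(5) lin_on_zero[OF op_homD(1)[OF assms(1)] assms(3)] by simp
qed

context poset_with_action
begin

text \<open>
  An isomorphism scales the four lines and preserves the four linear forms up to these factors.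
  The forms \<open>(1, 0)\<close> and \<open>(0, 1)\<close> make it diagonal on the plane, \<open>(1, 1)\<close> makes it a scalar there, and
  the last form then shows \<open>l = m\<close>.
\<close>

lemma star_out_not_iso:
  assumes inj: "inj_on y {2..<6}" and yx: "\<And>i. 2 \<le> i \<Longrightarrow> i < 6 \<Longrightarrow> (x, y i) \<in> r \<and> x \<noteq> y i"
    and iso: "op_iso r (supported {..<6}) (star_out x y l) (supported {..<6}) (star_out x y (m :: 'k::field))"
  shows "l = m"
proof -
  obtain f where f: "op_hom r (supported {..<6}) (star_out x y l) (supported {..<6}) (star_out x y m) f"
    and bij: "bij_betw f (supported {..<6}) (supported {..<6})"
    using iso unfolding op_iso_def by blast
  note fD = op_homD[OF f]
  have u: "(unit_vec i :: nat \<Rightarrow> 'k) \<in> supported {..<6}" if "i < 6" for i using that by (intro unit_vec_supported) simp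
  have y_eq: "y i = y j \<longleftrightarrow> i = j" if "2 \<le> i" "i < 6" "2 \<le> j" "j < 6" for i j
    using inj that by (auto simp: inj_on_def)
  have x: "x \<in> P" using yx[of 2] r_P by auto
  have colored: "f (unit_vec j) i = 0" if j: "2 \<le> j" "j < 6" and ij: "i \<noteq> j" for i j
  proof -
    have "unit_vec j = star_out x y l (y j, y j) (unit_vec j)"
      using j by (auto simp: star_out_def unit_vec_def star_col_def)
    then have "f (unit_vec j) = star_out x y m (y j, y j) (f (unit_vec j))"
      using fD(3)[of "(y j, y j)" "unit_vec j"] u[OF j(2)] r_refl r_P yx[OF j] by metis
    then have *: "f (unit_vec j) i = star_out x y m (y j, y j) (f (unit_vec j)) i" by simp
    show ?thesis
    proof (cases "i < 6")
      case True
      then show ?thesis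
        using * ij y_eq[of i j] j yx[OF j] by (auto simp: star_out_def star_col_def split: if_splits)
    next
      case False
      then show ?thesis using fD(2)[OF u[OF j(2)]] by (simp add: supported_def)
    qed
  qed
  define c where "c j = f (unit_vec j) j" for j
  have fu: "f (unit_vec j) = fscale (c j) (unit_vec j)" if "2 \<le> j" "j < 6" for j
    using colored[OF that] by (auto simp: c_def unit_vec_def fun_eq_iff fscale_apply)
  have c0: "c 4 \<noteq> 0"
  proof
    assume "c 4 = 0"
    then have "f (unit_vec 4) = 0" using fu[of 4] by simp
    with u[of 4] have "unit_vec 4 = (0 :: nat \<Rightarrow> 'k)"
      by (rule bij_hom_eq_zero[OF f bij supported_subspace]) simp_all
    then show False by (rule notE[OF unit_vec_nonzero])
  qed
  have rel: "fscale (line1 j) (f (unit_vec j)) = star_out x y m (x, y j) (f (unit_vec 0))"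
    "fscale (line2 l j) (f (unit_vec j)) = star_out x y m (x, y j) (f (unit_vec 1))" if j: "2 \<le> j" "j < 6" for j
  proof -
    have "star_out x y l (x, y j) (unit_vec 0) = fscale (line1 j) (unit_vec j)"
      "star_out x y l (x, y j) (unit_vec 1) = fscale (line2 l j) (unit_vec j)"
      using j yx[OF j] y_eq[of _ j] by (auto simp: star_out_def unit_vec_def fun_eq_iff fscale_apply)
    then show "fscale (line1 j) (f (unit_vec j)) = star_out x y m (x, y j) (f (unit_vec 0))"
      "fscale (line2 l j) (f (unit_vec j)) = star_out x y m (x, y j) (f (unit_vec 1))"
      using fD(3)[of "(x, y j)" "unit_vec 0"] fD(3)[of "(x, y j)" "unit_vec 1"] yx[OF j] u[of 0] u[of 1] u[OF j(2)]
      by (simp_all add: lin_onD(2)[OF fD(1)])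
  qed
  have eqs: "line1 j * c j = line1 j * f (unit_vec 0) 0 + line2 m j * f (unit_vec 0) 1"
    "line2 l j * c j = line1 j * f (unit_vec 1) 0 + line2 m j * f (unit_vec 1) 1" if j: "2 \<le> j" "j < 6" for j
    using fun_cong[OF rel(1)[OF j], of j] fun_cong[OF rel(2)[OF j], of j] j yx[OF j]
    by (simp_all add: c_def star_out_def fscale_apply)
  show ?thesis
    using eqs[of 2] eqs[of 3] eqs[of 4] eqs[of 5] c0 by (simp add: line1_def line2_def)
qed

lemma star_in_not_iso:
  assumes inj: "inj_on y {2..<6}" and yx: "\<And>i. 2 \<le> i \<Longrightarrow> i < 6 \<Longrightarrow> (y i, x) \<in> r \<and> x \<noteq> y i"
    and iso: "op_iso r (supported {..<6}) (star_in x y l) (supported {..<6}) (star_in x y (m :: 'k::field))"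
  shows "l = m"
proof -
  obtain f where f: "op_hom r (supported {..<6}) (star_in x y l) (supported {..<6}) (star_in x y m) f"
    and bij: "bij_betw f (supported {..<6}) (supported {..<6})"
    using iso unfolding op_iso_def by blast
  note fD = op_homD[OF f]
  have u: "(unit_vec i :: nat \<Rightarrow> 'k) \<in> supported {..<6}" if "i < 6" for i using that by (intro unit_vec_supported) simp
  have y_eq: "y i = y j \<longleftrightarrow> i = j" if "2 \<le> i" "i < 6" "2 \<le> j" "j < 6" for i j
    using inj that by (auto simp: inj_on_def)
  have colored: "f (unit_vec j) i = 0" if j: "2 \<le> j" "j < 6" and ij: "i \<noteq> j" for i j
  proof -
    have "unit_vec j = star_in x y l (y j, y j) (unit_vec j)"
      using j by (auto simp: star_in_def unit_vec_def star_col_def)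
    then have "f (unit_vec j) = star_in x y m (y j, y j) (f (unit_vec j))"
      using fD(3)[of "(y j, y j)" "unit_vec j"] u[OF j(2)] r_refl r_P yx[OF j] by metis
    then have *: "f (unit_vec j) i = star_in x y m (y j, y j) (f (unit_vec j)) i" by simp
    show ?thesis
    proof (cases "i < 6")
      case True
      then show ?thesis
        using * ij y_eq[of i j] j yx[OF j] by (auto simp: star_in_def star_col_def split: if_splits)
    next
      case False
      then show ?thesis using fD(2)[OF u[OF j(2)]] by (simp add: supported_def)
    qed
  qed
  define c where "c j = f (unit_vec j) j" for j
  have fu: "f (unit_vec j) = fscale (c j) (unit_vec j)" if "2 \<le> j" "j < 6" for j
    using colored[OF that] by (auto simp: c_def unit_vec_def fun_eq_iff fscale_apply)
  have c0: "c 4 \<noteq> 0"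
  proof
    assume "c 4 = 0"
    then have "f (unit_vec 4) = 0" using fu[of 4] by simp
    with u[of 4] have "unit_vec 4 = (0 :: nat \<Rightarrow> 'k)"
      by (rule bij_hom_eq_zero[OF f bij supported_subspace]) simp_all
    then show False by (rule notE[OF unit_vec_nonzero])
  qed
  have delta: "(\<Sum>i\<in>{2..<6}. if y i = y j then a i * b i else 0) = a j * b j"
    if j: "2 \<le> j" "j < 6" for j and a b :: "nat \<Rightarrow> 'k"
  proof -
    have "(\<Sum>i\<in>{2..<6}. if y i = y j then a i * b i else 0) = (\<Sum>i\<in>{2..<6}. if i = j then a i * b i else 0)"
      using y_eq[of _ j] j by (intro sum.cong) auto
    then show ?thesis using j by simp
  qed
  have rel: "fscale (line1 j) (f (unit_vec 0)) + fscale (line2 l j) (f (unit_vec 1)) = star_in x y m (y j, x) (f (unit_vec j))"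
    if j: "2 \<le> j" "j < 6" for j
  proof -
    have "star_in x y l (y j, x) (unit_vec j) = fscale (line1 j) (unit_vec 0) + fscale (line2 l j) (unit_vec 1)"
      using j yx[OF j] by (auto simp: star_in_def delta fun_eq_iff fscale_apply) (auto simp: unit_vec_def)
    then show ?thesis
      using fD(3)[of "(y j, x)" "unit_vec j"] yx[OF j] u[of 0] u[of 1] u[OF j(2)]
      by (simp add: lin_onD[OF fD(1)] fs.subspace_scale[OF supported_subspace])
  qed
  have eqs: "line1 j * f (unit_vec 0) 0 + line2 l j * f (unit_vec 1) 0 = line1 j * c j"
    "line1 j * f (unit_vec 0) 1 + line2 l j * f (unit_vec 1) 1 = line2 m j * c j" if j: "2 \<le> j" "j < 6" for j
    using fun_cong[OF rel[OF j], of 0] fun_cong[OF rel[OF j], of 1] j yx[OF j]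
    by (auto simp: c_def star_in_def delta fscale_apply)
  show ?thesis
    using eqs[of 2] eqs[of 3] eqs[of 4] eqs[of 5] c0 by (simp add: line1_def line2_def)
qed

theorem infinite_type_star:
  fixes y :: "nat \<Rightarrow> 'x"
  assumes inf: "infinite (UNIV :: 'k::field set)" and inj: "inj_on y {2..<6}" and x: "x \<in> P"
    and star: "(\<forall>i. 2 \<le> i \<and> i < 6 \<longrightarrow> (x, y i) \<in> r \<and> x \<noteq> y i \<and> (\<forall>w. (x, w) \<in> r \<longrightarrow> (w, y i) \<in> r \<longrightarrow> w = x \<or> w = y i)) \<or>
      (\<forall>i. 2 \<le> i \<and> i < 6 \<longrightarrow> (y i, x) \<in> r \<and> x \<noteq> y i \<and> (\<forall>w. (y i, w) \<in> r \<longrightarrow> (w, x) \<in> r \<longrightarrow> w = y i \<or> w = x))"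
  shows "\<not> fin_type TYPE(nat) TYPE('k) (poset_category P r)"
proof
  assume fin: "fin_type TYPE(nat) TYPE('k) (poset_category P r)"
  note V = supported_fin_support[of "{..<6 :: nat}"]
  from star show False
  proof
    assume *: "\<forall>i. 2 \<le> i \<and> i < 6 \<longrightarrow> (x, y i) \<in> r \<and> x \<noteq> y i \<and> (\<forall>w. (x, w) \<in> r \<longrightarrow> (w, y i) \<in> r \<longrightarrow> w = x \<or> w = y i)"
    have "cat_rep (poset_category P r) (supported {..<6}) (star_out x y (l :: 'k))" for l
      using * by (intro cat_rep_star_out x) blast+
    then obtain l m :: 'k where "l \<noteq> m" "op_iso r (supported {..<6}) (star_out x y l) (supported {..<6}) (star_out x y m)"
      using fin_type_family[OF fin inf, of "supported {..<6}" "star_out x y"] V by auto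
    then show False using star_out_not_iso[OF inj, of x l m] * by blast
  next
    assume *: "\<forall>i. 2 \<le> i \<and> i < 6 \<longrightarrow> (y i, x) \<in> r \<and> x \<noteq> y i \<and> (\<forall>w. (y i, w) \<in> r \<longrightarrow> (w, x) \<in> r \<longrightarrow> w = y i \<or> w = x)"
    have "cat_rep (poset_category P r) (supported {..<6}) (star_in x y (l :: 'k))" for l
      using * by (intro cat_rep_star_in x) blast+
    then obtain l m :: 'k where "l \<noteq> m" "op_iso r (supported {..<6}) (star_in x y l) (supported {..<6}) (star_in x y m)"
      using fin_type_family[OF fin inf, of "supported {..<6}" "star_in x y"] V by auto
    then show False using star_in_not_iso[OF inj, of x l m] * by blast
  qed
qed

end

section \<open>Two fixed elements, one covering the other\<close>

text \<open>
  Multiplication by \<open>t\<close> on two modules over \<open>k[t]\<close>, each a copy of \<open>k[t]/(t\<^sup>4) \<oplus> k[t]/(t\<^sup>2)\<close>. The first has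
  generators \<open>a\<close>, \<open>s\<close> and the second has generators \<open>b\<close>, \<open>q\<close>. The coordinates 0 to 3 belong to \<open>a, ta, t\<^sup>2a, t\<^sup>3a\<close>,
  4 and 5 to \<open>s, ts\<close>, 6 to 9 to \<open>b, tb, t\<^sup>2b, t\<^sup>3b\<close>, and 10 and 11 to \<open>q, tq\<close>.
\<close>

definition nilp :: "(nat \<Rightarrow> 'k::field) \<Rightarrow> nat \<Rightarrow> 'k" where
  "nilp v i = (if i \<in> {1, 2, 3, 5, 7, 8, 9, 11} then v (i - 1) else 0)"

definition unip :: "(nat \<Rightarrow> 'k::field) \<Rightarrow> nat \<Rightarrow> 'k" where
  "unip v = v + nilp v"

text \<open>
  The homomorphism from the first module to the second with \<open>a \<mapsto> q + l tb\<close> and \<open>s \<mapsto> tq + t\<^sup>2b\<close>. It is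
  well defined because \<open>t\<^sup>2s = 0\<close> goes to \<open>t\<^sup>3q + t\<^sup>4b = 0\<close>.
\<close>

definition link :: "'k \<Rightarrow> (nat \<Rightarrow> 'k::field) \<Rightarrow> nat \<Rightarrow> 'k" where
  "link l v i = (if i = 7 then l * v 0 else if i = 8 then l * v 1 + v 4 else if i = 9 then l * v 2 + v 5
     else if i = 10 then v 0 else if i = 11 then v 1 + v 4 else 0)"

lemma link_nilp: "link l (nilp v) = nilp (link l v)"
  by (auto simp: link_def nilp_def fun_eq_iff)

lemma nilp_add: "nilp (u + v) = nilp u + nilp v"
  by (auto simp: nilp_def fun_eq_iff)

lemma nilp_scale: "nilp (fscale c v) = fscale c (nilp v)"
  by (auto simp: nilp_def fun_eq_iff fscale_apply)

lemma link_add: "link l (u + v) = link l u + link l v"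
  by (auto simp: link_def fun_eq_iff algebra_simps)

lemma link_scale: "link l (fscale c v) = fscale c (link l v)"
  by (auto simp: link_def fun_eq_iff fscale_apply algebra_simps)

lemma nilp2: "nilp (nilp v) i = (if i \<in> {2, 3, 8, 9} then v (i - 2) else 0)"
  by (auto simp: nilp_def)

lemma nilp3: "nilp (nilp (nilp v)) i = (if i \<in> {3, 9} then v (i - 3) else 0)"
  by (auto simp: nilp_def)

lemma nilp4: "nilp (nilp (nilp (nilp v))) = 0"
  by (auto simp: nilp_def fun_eq_iff)

lemma unip_add: "unip (u + v) = unip u + unip v"
  unfolding unip_def nilp_add by (rule ext) (simp add: algebra_simps)

lemma unip_scale: "unip (fscale c v) = fscale c (unip v)"
  unfolding unip_def nilp_scale fs.scale_right_distrib ..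

lemma unip_pow_add: "(unip ^^ n) (u + v) = (unip ^^ n) u + (unip ^^ n) v"
  by (induction n) (simp_all only: funpow.simps id_apply o_apply unip_add)

lemma unip_pow_scale: "(unip ^^ n) (fscale c v) = fscale c ((unip ^^ n) v)"
  by (induction n) (simp_all only: funpow.simps id_apply o_apply unip_scale)

lemma unip_pow_supported: "v \<in> supported {..<12} \<Longrightarrow> (unip ^^ n) v \<in> supported {..<12}"
  by (induction n) (auto simp: unip_def nilp_def supported_def)

lemma unip_pow: "(unip ^^ n) v = v + fscale (of_nat n) (nilp v) + fscale (of_nat (n choose 2)) (nilp (nilp v)) +
    fscale (of_nat (n choose 3)) (nilp (nilp (nilp v)))"
proof (induction n)
  case 0
  show ?case by (rule ext) (simp add: fscale_apply binomial_eq_0)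
next
  case (Suc n)
  have c: "Suc n choose 2 = n + (n choose 2)" "Suc n choose 3 = (n choose 2) + (n choose 3)"
    by (simp_all add: numeral_2_eq_2 numeral_3_eq_3)
  have "(unip ^^ Suc n) v = unip ((unip ^^ n) v)" by (simp only: funpow.simps o_apply)
  also have "\<dots> = (unip ^^ n) v + nilp ((unip ^^ n) v)" by (rule unip_def)
  finally show ?case
    unfolding Suc.IH nilp_add nilp_scale nilp4 c by (simp add: fun_eq_iff fscale_apply algebra_simps)
qed

text \<open>
  Since \<open>t\<^sup>4 = 0\<close>, the binomial expansion of \<open>(1 + t)\<^sup>p\<close> stops at \<open>t\<^sup>3\<close>, and for \<open>p \<ge> 5\<close> the coefficients of
  \<open>t, t\<^sup>2, t\<^sup>3\<close> are all divisible by \<open>p\<close>.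
\<close>

lemma unip_pow_char:
  fixes v :: "nat \<Rightarrow> 'k::field"
  assumes p: "Factorial_Ring.prime p" "p \<ge> 5" "of_nat p = (0 :: 'k)"
  shows "(unip ^^ p) v = v"
proof -
  have "of_nat (p choose j) = (0 :: 'k)" if "0 < j" "j < p" for j
  proof -
    have "p dvd p choose j" by (rule dvd_choose_prime) (use that p in simp_all)
    then obtain k where "p choose j = p * k" by blast
    then show ?thesis using p(3) by simp
  qed
  from this[of 2] this[of 3] p show ?thesis by (simp add: unip_pow)
qed

context poset_with_action
begin

text \<open>
  The first module sits at \<open>x\<close>, the second at \<open>y\<close>, and all other values are zero.
\<close>

definition pair_core :: "'x \<Rightarrow> 'x \<Rightarrow> 'k::field \<Rightarrow> 'x \<times> 'x \<Rightarrow> (nat \<Rightarrow> 'k) \<Rightarrow> (nat \<Rightarrow> 'k)" where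
  "pair_core x y l = (\<lambda>(z, w) v i. if z = w then (if (if i < 6 then x else y) = z then v i else 0)
     else if z = x \<and> w = y then link l v i else 0)"

text \<open>
  The group element \<open>h = g\<^bsup>e h\<^esup>\<close> acts as \<open>(1 + t)\<^bsup>e h\<^esup>\<close>.
\<close>

definition pair_rep :: "'x \<Rightarrow> 'x \<Rightarrow> ('g \<Rightarrow> nat) \<Rightarrow> 'k::field \<Rightarrow> ('x \<times> 'x) \<times> 'g \<Rightarrow> (nat \<Rightarrow> 'k) \<Rightarrow> (nat \<Rightarrow> 'k)" where
  "pair_rep x y e l = (\<lambda>(\<alpha>, h) v. (unip ^^ e h) (pair_core x y l \<alpha> v))"

lemma cat_rep_pair_core:
  assumes xy: "(x, y) \<in> r" "x \<noteq> y" and cover: "\<And>w. (x, w) \<in> r \<Longrightarrow> (w, y) \<in> r \<Longrightarrow> w = x \<or> w = y"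
  shows "cat_rep (poset_category P r) (supported {..<12}) (pair_core x y (l :: 'k::field))"
proof (rule cat_rep_posetI[where col = "\<lambda>i. if i < 6 then x else y"])
  show "(if i < 6 then x else y) \<in> P" for i :: nat using r_P[OF xy(1)] by simp
  show "pair_core x y l (z, z) v = (\<lambda>i. if (if i < 6 then x else y) = z then v i else 0)" for z v
    by (auto simp: pair_core_def)
  show "lin_on (supported {..<12}) (pair_core x y l (z, w))" for z w
    by (auto simp: lin_on_def pair_core_def fscale_apply fun_eq_iff link_add link_scale)
  show "pair_core x y l (z, w) v i = 0" if "v \<in> supported {..<12}" "i \<notin> {..<12} \<or> (if i < 6 then x else y) \<noteq> w" for z w v i
    using that xy by (auto simp: pair_core_def supported_def link_def)
  show "pair_core x y l (z, w) v = 0" if "\<And>i. (if i < 6 then x else y) = z \<Longrightarrow> v i = 0" for z w v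
    using that that[of 0] that[of 1] that[of 2] that[of 4] that[of 5]
    by (auto simp: pair_core_def fun_eq_iff link_def)
  show "pair_core x y l (b, c) (pair_core x y l (a, b) v) = pair_core x y l (a, c) v"
    if "(a, b) \<in> r" "(b, c) \<in> r" "a \<noteq> b" "b \<noteq> c" for a b c v
  proof -
    have "a \<noteq> c" using that r_antisym by blast
    moreover have "\<not> (a = x \<and> c = y)" using cover[of b] that by auto
    moreover have "\<not> (a = x \<and> b = y \<and> b = x)" using xy by auto
    ultimately show ?thesis using that by (auto simp: pair_core_def link_def fun_eq_iff)
  qed
qed

lemma pair_core_nilp: "pair_core x y l \<alpha> (nilp v) = nilp (pair_core x y l \<alpha> v)"
proof (cases \<alpha>)
  case (Pair z w)
  consider "z = w" | "z \<noteq> w" "z = x \<and> w = y" | "z \<noteq> w" "\<not> (z = x \<and> w = y)" by blast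
  then show ?thesis
  proof cases
    case 1
    then show ?thesis unfolding Pair by (auto simp: pair_core_def nilp_def fun_eq_iff)
  next
    case 2
    then have "pair_core x y l \<alpha> = link l" unfolding Pair by (auto simp: pair_core_def fun_eq_iff)
    then show ?thesis by (simp only: link_nilp)
  next
    case 3
    then show ?thesis unfolding Pair by (auto simp: pair_core_def nilp_def fun_eq_iff)
  qed
qed

lemma pair_core_add: "pair_core x y l \<alpha> (u + v) = pair_core x y l \<alpha> u + pair_core x y l \<alpha> v"
  by (cases \<alpha>) (auto simp: pair_core_def fun_eq_iff link_add)

lemma pair_core_unip: "pair_core x y l \<alpha> ((unip ^^ n) v) = (unip ^^ n) (pair_core x y l \<alpha> v)"
proof (induction n)
  case (Suc n)
  have "pair_core x y l \<alpha> (unip v) = unip (pair_core x y l \<alpha> v)" for v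
    unfolding unip_def pair_core_add pair_core_nilp ..
  then show ?case using Suc by simp
qed simp

text \<open>
  The elements of \<open>H\<close> fix \<open>x\<close> and \<open>y\<close> and act by automorphisms of both modules that commute with the
  map between them, so the two actions combine to one of the subcategory.
\<close>

lemma cat_rep_pair_rep:
  assumes xy: "(x, y) \<in> r" "x \<noteq> y" and cover: "\<And>w. (x, w) \<in> r \<Longrightarrow> (w, y) \<in> r \<Longrightarrow> w = x \<or> w = y"
    and H: "subgroup H G" and fixed: "\<And>h. h \<in> H \<Longrightarrow> \<phi> h x = x \<and> \<phi> h y = y"
    and e: "\<And>h h' v. h \<in> H \<Longrightarrow> h' \<in> H \<Longrightarrow> (unip ^^ e (h \<otimes> h')) v = (unip ^^ e h) ((unip ^^ e h') (v :: nat \<Rightarrow> 'k::field))"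
      "\<And>v. (unip ^^ e \<one>) v = (v :: nat \<Rightarrow> 'k)"
  shows "cat_rep (TH H) (supported {..<12}) (pair_rep x y e (l :: 'k))"
proof -
  let ?c = "pair_core x y l"
  have c: "cat_rep (poset_category P r) (supported {..<12}) ?c" by (rule cat_rep_pair_core[OF xy]) (rule cover)
  note cD = cat_repD[OF c] and oc = op_repD[OF cat_repD(1)[OF c]]
  have HG: "h \<in> carrier G" if "h \<in> H" for h using subgroup.subset[OF H] that by blast
  have mem: "?c \<alpha> v \<in> supported {..<12}" if "\<alpha> \<in> r" "v \<in> supported {..<12}" for \<alpha> v
    using oc(2)[of \<alpha> v] that by simp
  have inv: "?c (\<phi> h a, \<phi> h b) = ?c (a, b)" if h: "h \<in> H" and ab: "a \<in> P" "b \<in> P" for h a b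
  proof -
    have z: "\<phi> h z = x \<longleftrightarrow> z = x" "\<phi> h z = y \<longleftrightarrow> z = y" if "z \<in> P" for z
      using phi_inj[OF HG[OF h] that, of x] phi_inj[OF HG[OF h] that, of y] fixed[OF h] r_P[OF xy(1)] by simp_all
    have "(if i < 6 then x else y) = \<phi> h a \<longleftrightarrow> (if i < 6 then x else y) = a" for i :: nat
      using z[OF ab(1)] by auto
    then show ?thesis
      unfolding pair_core_def prod.case by (simp only: z[OF ab(1)] z[OF ab(2)] phi_inj[OF HG[OF h] ab])
  qed
  have main: "pair_rep x y e l (\<alpha>, g) (pair_rep x y e l (\<beta>, h) v) =
      (if \<phi> (inv g) (fst \<alpha>) = snd \<beta> then pair_rep x y e l ((\<phi> g (fst \<beta>), snd \<alpha>), g \<otimes> h) v else 0)"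
    if ab: "\<alpha> \<in> r" "\<beta> \<in> r" "g \<in> H" "h \<in> H" and v: "v \<in> supported {..<12}" for \<alpha> \<beta> g h v
  proof -
    note P\<alpha> = r_PD[OF ab(1)] and P\<beta> = r_PD[OF ab(2)]
    have "pair_rep x y e l (\<alpha>, g) (pair_rep x y e l (\<beta>, h) v) = (unip ^^ e (g \<otimes> h)) (?c \<alpha> (?c \<beta> v))"
      unfolding pair_rep_def prod.case pair_core_unip e(1)[OF ab(3,4)] ..
    also have "?c \<beta> = ?c (act_arrow g \<beta>)"
      using inv[OF ab(3) P\<beta>] by (simp add: act_arrow_def)
    also have "?c \<alpha> (?c (act_arrow g \<beta>) v) = (if fst \<alpha> = \<phi> g (snd \<beta>) then ?c (\<phi> g (fst \<beta>), snd \<alpha>) v else 0)"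
      using cD(2)[of \<alpha> "act_arrow g \<beta>" v] ab HG[OF ab(3)] v by simp
    also have "fst \<alpha> = \<phi> g (snd \<beta>) \<longleftrightarrow> \<phi> (inv g) (fst \<alpha>) = snd \<beta>"
      using phi_eq_iff[OF HG[OF ab(3)] P\<alpha>(1) P\<beta>(2)] by simp
    also have "(unip ^^ e (g \<otimes> h)) (if \<phi> (inv g) (fst \<alpha>) = snd \<beta> then ?c (\<phi> g (fst \<beta>), snd \<alpha>) v else 0) =
        (if \<phi> (inv g) (fst \<alpha>) = snd \<beta> then pair_rep x y e l ((\<phi> g (fst \<beta>), snd \<alpha>), g \<otimes> h) v else 0)"
      using unip_pow_scale[of "e (g \<otimes> h)" 0 "0 :: nat \<Rightarrow> 'k"] by (simp add: pair_rep_def)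
    finally show ?thesis .
  qed
  have I: "Ident (TH H) ` Obj (TH H) = (\<lambda>z. ((z, z), \<one>)) ` P"
    by (intro image_cong) simp_all
  have I': "Ident (poset_category P r) ` Obj (poset_category P r) = (\<lambda>z. (z, z)) ` P"
    by (intro image_cong) simp_all
  have unit: "(\<Sum>a\<in>(\<lambda>z. ((z, z), \<one>)) ` P. pair_rep x y e l a v) = v" if v: "v \<in> supported {..<12}" for v
  proof -
    have "(\<Sum>a\<in>(\<lambda>z. ((z, z), \<one>)) ` P. pair_rep x y e l a v) = (\<Sum>z\<in>P. ?c (z, z) v)"
      by (subst sum.reindex) (auto simp: inj_on_def pair_rep_def e(2))
    also have "\<dots> = (\<Sum>a\<in>(\<lambda>z. (z, z)) ` P. ?c a v)"
      by (subst sum.reindex) (auto simp: inj_on_def)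
    also have "\<dots> = v" using cD(3)[OF v] unfolding I' .
    finally show ?thesis .
  qed
  have "op_rep (r \<times> H) (supported {..<12}) (pair_rep x y e l)"
    unfolding op_rep_def
  proof (intro conjI ballI supported_subspace)
    fix a assume "a \<in> r \<times> H"
    then obtain \<alpha> h where a: "a = (\<alpha>, h)" "\<alpha> \<in> r" "h \<in> H" by auto
    show "pair_rep x y e l a ` supported {..<12} \<subseteq> supported {..<12}"
      unfolding a(1) pair_rep_def prod.case using unip_pow_supported mem[OF a(2)] by auto
    have "lin_on (supported {..<12}) (?c \<alpha>)" using oc(3)[of \<alpha>] a(2) by simp
    then show "lin_on (supported {..<12}) (pair_rep x y e l a)"
      unfolding a(1) pair_rep_def prod.case lin_on_def unip_pow_add[symmetric] unip_pow_scale[symmetric]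
      by (intro conjI allI ballI arg_cong[of _ _ "unip ^^ e h"]) blast+
  qed
  then show ?thesis
    unfolding cat_rep_def I using main unit by simp
qed

text \<open>
  An isomorphism commutes with \<open>t\<close> on both modules. Compare leading coefficients, writing \<open>a, s, b, q\<close> for
  the images of the generators and \<open>a 0\<close> for the coefficient of \<open>a\<close> in the image of \<open>a\<close>, and so on. The
  coefficients of \<open>tb\<close> and \<open>q\<close> in the image of \<open>q + l tb\<close> give \<open>m a\<^sub>0 = l b\<^sub>6\<close> and \<open>a\<^sub>0 = q\<^sub>1\<^sub>0\<close>; those of \<open>t\<^sup>2b\<close> and \<open>tq\<close> in the
  image of \<open>tq + t\<^sup>2b\<close> give \<open>s\<^sub>4 = b\<^sub>6\<close> and \<open>s\<^sub>4 = q\<^sub>1\<^sub>0\<close>. So all four coefficients agree, and they are nonzero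
  because \<open>t\<^sup>3b\<close> is.
\<close>

lemma pair_rep_not_iso:
  assumes xy: "(x, y) \<in> r" "x \<noteq> y" and H: "\<one> \<in> H" "g \<in> H"
    and e: "\<And>v. (unip ^^ e \<one>) v = (v :: nat \<Rightarrow> 'k::field)" "\<And>v. (unip ^^ e g) v = unip (v :: nat \<Rightarrow> 'k)"
    and iso: "op_iso (r \<times> H) (supported {..<12}) (pair_rep x y e l) (supported {..<12}) (pair_rep x y e (m :: 'k))"
  shows "l = m"
proof -
  let ?V = "supported {..<12 :: nat} :: (nat \<Rightarrow> 'k) set"
  obtain f where f: "op_hom (r \<times> H) ?V (pair_rep x y e l) ?V (pair_rep x y e m) f" and bij: "bij_betw f ?V ?V"
    using iso unfolding op_iso_def by blast
  note fD = op_homD[OF f]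
  have xP: "x \<in> P" "y \<in> P" using r_P[OF xy(1)] by auto
  define lower where "lower = {v \<in> ?V. \<forall>i\<ge>6. v i = 0}"
  define upper where "upper = {v \<in> ?V. \<forall>i<6. v i = 0}"
  have core: "pair_core x y c (x, x) v = v" if "v \<in> lower" for v c
    using that xy by (auto simp: pair_core_def lower_def fun_eq_iff)
  have core': "pair_core x y c (y, y) v = v" if "v \<in> upper" for v c
    using that xy by (auto simp: pair_core_def upper_def fun_eq_iff)
  have nV: "nilp v \<in> ?V" if "v \<in> ?V" for v using that by (auto simp: supported_def nilp_def)
  have LV: "v \<in> ?V" if "v \<in> lower" for v using that by (simp add: lower_def)
  have UV: "v \<in> ?V" if "v \<in> upper" for v using that by (simp add: upper_def)
  have f_lower: "f v \<in> lower" if v: "v \<in> lower" for v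
  proof -
    have eq: "f v = pair_core x y m (x, x) (f v)"
      using fD(3)[of "((x, x), \<one>)" v] LV[OF v] r_refl xP H core[OF v] by (simp add: pair_rep_def e)
    have "f v i = 0" if "i \<ge> 6" for i
      using that xy by (subst eq) (simp add: pair_core_def)
    then show ?thesis using fD(2)[OF LV[OF v]] by (simp add: lower_def)
  qed
  have f_upper: "f v \<in> upper" if v: "v \<in> upper" for v
  proof -
    have eq: "f v = pair_core x y m (y, y) (f v)"
      using fD(3)[of "((y, y), \<one>)" v] UV[OF v] r_refl xP H core'[OF v] by (simp add: pair_rep_def e)
    have "f v i = 0" if "i < 6" for i
      using that xy by (subst eq) (simp add: pair_core_def)
    then show ?thesis using fD(2)[OF UV[OF v]] by (simp add: upper_def)
  qed
  have f_nilp: "f (nilp v) = nilp (f v)" if v: "v \<in> lower \<or> v \<in> upper" for v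
  proof -
    have vV: "v \<in> ?V" using v LV UV by blast
    have "f (unip v) = unip (f v)"
      using v
    proof
      assume "v \<in> lower"
      then show ?thesis
        using fD(3)[of "((x, x), g)" v] vV r_refl xP H core core f_lower by (simp add: pair_rep_def e)
    next
      assume "v \<in> upper"
      then show ?thesis
        using fD(3)[of "((y, y), g)" v] vV r_refl xP H core' core' f_upper by (simp add: pair_rep_def e)
    qed
    moreover have "f (unip v) = f v + f (nilp v)"
      unfolding unip_def[of v] by (rule lin_onD(1)[OF fD(1) vV nV[OF vV]])
    ultimately have "f v + f (nilp v) = f v + nilp (f v)" by (simp only: unip_def[of "f v"])
    then show ?thesis by (rule add_left_imp_eq)
  qed
  have f_link: "f (link l v) = link m (f v)" if v: "v \<in> lower" for v
    using fD(3)[of "((x, y), \<one>)" v] LV[OF v] xy H by (simp add: pair_rep_def pair_core_def e)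
  have f0: "f 0 = 0" by (rule lin_on_zero[OF fD(1) supported_subspace])
  \<comment> \<open>the coordinates 0, 4, 6 and 10 are those of the four generators\<close>
  have gens: "unit_vec 0 \<in> lower" "unit_vec 4 \<in> lower" "unit_vec 6 \<in> upper" "unit_vec 10 \<in> upper"
    by (auto simp: lower_def upper_def supported_def unit_vec_def)
  define a s b q where "a = f (unit_vec 0)" and "s = f (unit_vec 4)" and "b = f (unit_vec 6)" and "q = f (unit_vec 10)"
  have n_upper: "nilp v \<in> upper" if "v \<in> upper" for v
    using that nV by (auto simp: upper_def nilp_def)
  have n_lower: "nilp v \<in> lower" if "v \<in> lower" for v
    using that nV by (auto simp: lower_def nilp_def)
  have z: "nilp (nilp (unit_vec 4)) = (0 :: nat \<Rightarrow> 'k)" "nilp (nilp (unit_vec 10)) = (0 :: nat \<Rightarrow> 'k)"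
    by (auto simp: fun_eq_iff nilp2 unit_vec_def)
  have "nilp (nilp s) = 0" "nilp (nilp q) = 0"
    using z f0 f_nilp gens n_upper n_lower unfolding s_def q_def by metis+
  \<comment> \<open>multiplication by the square of t kills s and q, so their components of lowest order in the large summands vanish\<close>
  then have sq: "s 1 = 0" "q 7 = 0"
    using nilp2[of s 3] nilp2[of q 9] by simp_all
  have up: "b i = 0" "q i = 0" if "i < 6" for i
    using that f_upper gens unfolding b_def q_def by (auto simp: upper_def)
  have lA: "link l (unit_vec 0) = unit_vec 10 + fscale l (nilp (unit_vec 6))"
    by (auto simp: fun_eq_iff link_def nilp_def unit_vec_def fscale_apply)
  have lS: "link l (unit_vec 4) = nilp (unit_vec 10) + nilp (nilp (unit_vec 6))"
    by (auto simp: fun_eq_iff link_def nilp_def unit_vec_def)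
  have "link m a = q + fscale l (nilp b)"
    unfolding a_def b_def q_def f_link[OF gens(1), symmetric] lA
    using UV[OF gens(4)] UV[OF n_upper[OF gens(3)]] f_nilp[of "unit_vec 6"] gens
    by (simp add: lin_onD[OF fD(1)] fs.subspace_scale[OF supported_subspace])
  from fun_cong[OF this, of 7] fun_cong[OF this, of 10]
  have r1: "m * a 0 = l * b 6" "a 0 = q 10"
    using sq by (simp_all add: link_def nilp_def fscale_apply)
  have "link m s = nilp q + nilp (nilp b)"
    unfolding s_def b_def q_def f_link[OF gens(2), symmetric] lS
    using UV[OF n_upper[OF gens(4)]] UV[OF n_upper[OF n_upper[OF gens(3)]]] f_nilp n_upper gens
    by (simp add: lin_onD[OF fD(1)])
  from fun_cong[OF this, of 8] fun_cong[OF this, of 11]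
  have r2: "s 4 = b 6" "s 4 = q 10"
    using sq by (simp_all add: link_def nilp_def)
  have "b 6 \<noteq> 0"
  proof
    assume "b 6 = 0"
    then have "nilp (nilp (nilp b)) = 0" using up(1)[of 0] by (auto simp: fun_eq_iff nilp3)
    moreover have "nilp (nilp (nilp b)) = f (nilp (nilp (nilp (unit_vec 6))))"
      unfolding b_def using f_nilp n_upper gens by simp
    ultimately have "f (nilp (nilp (nilp (unit_vec 6)))) = 0" by (simp only:)
    then have "nilp (nilp (nilp (unit_vec 6 :: nat \<Rightarrow> 'k))) = 0"
      by (rule bij_hom_eq_zero[OF f bij supported_subspace UV[OF n_upper[OF n_upper[OF n_upper[OF gens(3)]]]]])
    then have "nilp (nilp (nilp (unit_vec 6 :: nat \<Rightarrow> 'k))) 9 = 0" by simp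
    then show False by (simp add: nilp3 unit_vec_def)
  qed
  then show ?thesis using r1 r2 by simp
qed

theorem infinite_type_pair:
  assumes inf: "infinite (UNIV :: 'k::field set)" and p: "Factorial_Ring.prime p" "p \<ge> 5" "of_nat p = (0 :: 'k)"
    and g: "g \<in> carrier G" "g [^] p = \<one>" "g \<noteq> \<one>" and H: "subgroup H G" "g \<in> H" "\<And>h. h \<in> H \<Longrightarrow> \<exists>n :: nat. h = g [^] n"
    and xy: "(x, y) \<in> r" "x \<noteq> y" and cover: "\<And>w. (x, w) \<in> r \<Longrightarrow> (w, y) \<in> r \<Longrightarrow> w = x \<or> w = y"
    and fixed: "\<phi> g x = x" "\<phi> g y = y"
  shows "\<not> fin_type TYPE(nat) TYPE('k) (TH H)"
proof
  assume fin: "fin_type TYPE(nat) TYPE('k) (TH H)"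
  have "\<forall>h\<in>H. \<exists>n :: nat. h = g [^] n" using H(3) by blast
  then obtain e where e: "\<And>h. h \<in> H \<Longrightarrow> h = g [^] (e h :: nat)" by metis
  have per: "(unip ^^ (a + p * n)) v = (unip ^^ a) (v :: nat \<Rightarrow> 'k)" for a n v
  proof (induction n)
    case (Suc n)
    have "(unip ^^ (a + p * Suc n)) v = (unip ^^ (a + p * n)) ((unip ^^ p) v)"
      by (simp add: funpow_add[symmetric] ac_simps flip: comp_apply[of "unip ^^ _" "unip ^^ _"])
    then show ?case using Suc unip_pow_char[OF p] by simp
  qed simp
  \<comment> \<open>the exponent of g is determined modulo p, and the action depends on it only modulo p\<close>
  have ord: "p dvd n" if "g [^] n = \<one>" for n :: nat
  proof -
    have "ord g dvd p" using pow_eq_id[OF g(1)] g(2) by simp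
    moreover have "ord g \<noteq> 1" using pow_eq_id[OF g(1), of 1] g(1,3) by auto
    ultimately have "ord g = p" using p(1) by (auto simp: prime_nat_iff)
    then show ?thesis using pow_eq_id[OF g(1), of n] that by simp
  qed
  have same: "(unip ^^ a) v = (unip ^^ b) (v :: nat \<Rightarrow> 'k)" if "g [^] a = g [^] b" for a b :: nat and v
  proof -
    have *: "(unip ^^ b) v = (unip ^^ a) (v :: nat \<Rightarrow> 'k)" if ab: "a \<le> b" "g [^] a = g [^] b" for a b :: nat and v
    proof -
      have "g [^] a \<otimes> g [^] (b - a) = g [^] (a + (b - a))" by (rule nat_pow_mult[OF g(1)])
      also have "\<dots> = g [^] a \<otimes> \<one>" using ab(1) ab(2)[symmetric] g(1) by simp
      finally have "g [^] a \<otimes> g [^] (b - a) = g [^] a \<otimes> \<one>" .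
      then have "g [^] (b - a) = \<one>" using g(1) by (subst (asm) l_cancel) auto
      then obtain n where "b - a = p * n" using ord by blast
      then have "b = a + p * n" using ab(1) by simp
      then show ?thesis using per by simp
    qed
    show ?thesis
    proof (cases "a \<le> b")
      case True
      then show ?thesis by (rule *[OF _ that, symmetric])
    next
      case False
      then show ?thesis by (intro *[OF _ that[symmetric]]) simp
    qed
  qed
  have e_mult: "(unip ^^ e (h \<otimes> h')) v = (unip ^^ e h) ((unip ^^ e h') (v :: nat \<Rightarrow> 'k))" if h: "h \<in> H" "h' \<in> H" for h h' v
  proof -
    have "g [^] e (h \<otimes> h') = h \<otimes> h'" using e[OF subgroup.m_closed[OF H(1) h]] by simp
    also have "\<dots> = g [^] (e h + e h')" using e[OF h(1)] e[OF h(2)] g(1) by (simp add: nat_pow_mult[symmetric])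
    finally have "(unip ^^ e (h \<otimes> h')) v = (unip ^^ (e h + e h')) v" by (rule same)
    then show ?thesis by (simp only: funpow_add o_apply)
  qed
  have one: "\<one> \<in> H" by (rule subgroup.one_closed[OF H(1)])
  have e_one: "(unip ^^ e \<one>) v = (v :: nat \<Rightarrow> 'k)" for v
    using same[of "e \<one>" 0 v] e[OF one] by simp
  have e_g: "(unip ^^ e g) v = unip (v :: nat \<Rightarrow> 'k)" for v
    using same[of "e g" 1 v] e[OF H(2)] g(1) by simp
  have pw: "\<phi> (g [^] n) z = z" if "\<phi> g z = z" "z \<in> P" for z and n :: nat
    using that g(1) by (induction n) (simp_all add: phi_one phi_mult)
  have fix_H: "\<phi> h x = x \<and> \<phi> h y = y" if "h \<in> H" for h
    using pw[OF fixed(1)] pw[OF fixed(2)] r_P[OF xy(1)] e[OF that] by metis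
  have "cat_rep (TH H) (supported {..<12}) (pair_rep x y e (l :: 'k))" for l
    by (rule cat_rep_pair_rep[OF xy _ H(1) fix_H e_mult e_one]) (use cover in blast)+
  then obtain l m :: 'k where lm: "l \<noteq> m"
    "op_iso (r \<times> H) (supported {..<12}) (pair_rep x y e l) (supported {..<12}) (pair_rep x y e m)"
    using fin_type_family[OF fin inf, of "supported {..<12}" "pair_rep x y e"] supported_fin_support[of "{..<12 :: nat}"] by auto
  then show False using pair_rep_not_iso[OF xy one H(2) e_one e_g lm(2)] by blast
qed

end

section \<open>Actions without fixed points\<close>

text \<open>
  Two equal terms would give a period \<open>d < p\<close>, which is prime to the period \<open>p\<close>, hence the period one.
\<close>

lemma prime_period_inj:
  assumes p: "Factorial_Ring.prime p" and f: "(f ^^ p) s = s" "f s \<noteq> s"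
  shows "inj_on (\<lambda>i. (f ^^ i) s) {..<p}"
proof (rule linorder_inj_onI)
  fix i j assume ij: "i < j" "i \<in> {..<p}" "j \<in> {..<p}"
  show "(f ^^ i) s \<noteq> (f ^^ j) s"
  proof
    assume eq: "(f ^^ i) s = (f ^^ j) s"
    define d where "d = p - j + i"
    have d: "0 < d" "d < p" using ij by (auto simp: d_def)
    have "(f ^^ d) s = (f ^^ (p - j)) ((f ^^ j) s)" by (simp add: d_def funpow_add eq)
    also have "\<dots> = s" using ij f(1) funpow_add[of "p - j" j f] by simp
    finally have per: "(f ^^ d) s = s" .
    have "coprime d p" using p d by (metis coprime_commute nat_dvd_not_less prime_imp_coprime)
    then have "gcd d p = 1" by (simp add: coprime_iff_gcd_eq_1)
    then obtain a b where ab: "d * a = p * b + 1"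
      using bezout_nat[of d p] d(1) by auto
    have "(f ^^ (d * a)) s = s" using per by (induction a) (simp_all add: funpow_add)
    moreover have "(f ^^ (p * b)) s = s" using f(1) by (induction b) (simp_all add: funpow_add)
    ultimately have "f s = s" unfolding ab by (simp add: funpow_swap1)
    then show False using f(2) by simp
  qed
qed auto

text \<open>
  The orbits of \<open>f\<close> partition \<open>S\<close> into classes of size \<open>p\<close>.
\<close>

lemma prime_dvd_card_free:
  assumes fin: "finite S" and f: "\<And>s. s \<in> S \<Longrightarrow> f s \<in> S" "\<And>s. s \<in> S \<Longrightarrow> (f ^^ p) s = s" "\<And>s. s \<in> S \<Longrightarrow> f s \<noteq> s"
    and p: "Factorial_Ring.prime p"
  shows "p dvd card S"
proof -
  define R where "R = {(s, t) \<in> S \<times> S. \<exists>n. t = (f ^^ n) s}"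
  have mem: "(f ^^ n) s \<in> S" if "s \<in> S" for n s using that f(1) by (induction n) auto
  have per: "(f ^^ (p * n)) s = s" if "s \<in> S" for n s
    using that f(2) by (induction n) (simp_all add: funpow_add)
  have p0: "p > 0" using p by (simp add: prime_gt_0_nat)
  have equiv: "equiv S R"
  proof (rule equivI)
    show "refl_on S R" unfolding refl_on_def R_def by (auto intro: exI[of _ 0])
    show "sym R"
    proof (rule symI)
      fix s t assume "(s, t) \<in> R"
      then obtain n where n: "s \<in> S" "t \<in> S" "t = (f ^^ n) s" by (auto simp: R_def)
      have "n \<le> p * n" using p0 by simp
      then have "(f ^^ (p * n - n)) t = (f ^^ (p * n)) s"
        unfolding n(3) by (simp flip: funpow_add comp_apply[of "f ^^ _" "f ^^ _"])
      then show "(t, s) \<in> R" using per[OF n(1), of n] n(1,2) unfolding R_def by force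
    qed
    show "trans R"
    proof (rule transI)
      fix s t u assume "(s, t) \<in> R" "(t, u) \<in> R"
      then obtain m n where "s \<in> S" "u \<in> S" "u = (f ^^ n) ((f ^^ m) s)" by (auto simp: R_def)
      then have "u = (f ^^ (n + m)) s" by (simp add: funpow_add)
      then show "(s, u) \<in> R" using \<open>s \<in> S\<close> \<open>u \<in> S\<close> unfolding R_def by blast
    qed
  qed (auto simp: R_def)
  have "card Q = p" if Q: "Q \<in> S // R" for Q
  proof -
    obtain s where s: "s \<in> S" "Q = R `` {s}" using Q by (rule quotientE)
    have "Q = (\<lambda>i. (f ^^ i) s) ` {..<p}"
    proof (intro equalityI subsetI)
      fix t assume "t \<in> Q"
      then obtain n where "t = (f ^^ n) s" using s by (auto simp: R_def)
      also have "\<dots> = (f ^^ (n mod p)) ((f ^^ (p * (n div p))) s)"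
        by (simp flip: funpow_add comp_apply[of "f ^^ _" "f ^^ _"])
      finally show "t \<in> (\<lambda>i. (f ^^ i) s) ` {..<p}" using per[OF s(1)] p0 by auto
    qed (use s mem in \<open>auto simp: R_def\<close>)
    moreover have "inj_on (\<lambda>i. (f ^^ i) s) {..<p}"
      by (rule prime_period_inj[OF p f(2)[OF s(1)] f(3)[OF s(1)]])
    ultimately show ?thesis by (simp add: card_image)
  qed
  then show ?thesis
    using equiv_imp_dvd_card[OF fin equiv, of p] by (simp add: R_def)
qed

text \<open>
  A spanning tree \<open>F\<close> of a connected graph, where connectedness is stated as the absence of cuts and
  spanning as the property needed later: functions constant along the edges of \<open>F\<close> are constant. The
  tree grows by one vertex and one edge at a time.
\<close>

lemma spanning_edges:
  fixes V :: "'x set" and E :: "('x \<times> 'x) set"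
  assumes fin: "finite V" and v0: "v0 \<in> V" and E: "E \<subseteq> V \<times> V"
    and cut: "\<And>S. S \<subseteq> V \<Longrightarrow> v0 \<in> S \<Longrightarrow> S \<noteq> V \<Longrightarrow> \<exists>(a, b)\<in>E. (a \<in> S) \<noteq> (b \<in> S)"
  shows "\<exists>F\<subseteq>E. card F + 1 = card V \<and> (\<forall>c :: 'x \<Rightarrow> 'k. (\<forall>(a, b)\<in>F. c a = c b) \<longrightarrow> (\<forall>v\<in>V. c v = c v0))"
proof -
  have grow: "\<exists>S F. S \<subseteq> V \<and> v0 \<in> S \<and> card S = Suc n \<and> F \<subseteq> E \<inter> S \<times> S \<and> card F = n \<and>
      (\<forall>c :: 'x \<Rightarrow> 'k. (\<forall>(a, b)\<in>F. c a = c b) \<longrightarrow> (\<forall>v\<in>S. c v = c v0))" if "n < card V" for n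
    using that
  proof (induction n)
    case 0
    show ?case using v0 by (intro exI[of _ "{v0}"] exI[of _ "{}"]) auto
  next
    case (Suc n)
    then obtain S F where S: "S \<subseteq> V" "v0 \<in> S" "card S = Suc n" and F: "F \<subseteq> E \<inter> S \<times> S" "card F = n"
      and con: "\<And>c :: 'x \<Rightarrow> 'k. (\<forall>(a, b)\<in>F. c a = c b) \<Longrightarrow> \<forall>v\<in>S. c v = c v0"
      by auto
    have "S \<noteq> V" using S(3) Suc.prems by auto
    then obtain a b where ab: "(a, b) \<in> E" "(a \<in> S) \<noteq> (b \<in> S)" using cut[OF S(1,2)] by blast
    define w where "w = (if a \<in> S then b else a)"
    have w: "w \<in> V" "w \<notin> S" "{a, b} \<subseteq> insert w S" using ab E by (auto simp: w_def)
    have fS: "finite S" using S(1) fin finite_subset by blast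
    have fF: "finite F" by (rule finite_subset[of _ "S \<times> S"]) (use F(1) fS in auto)
    have new: "\<forall>v\<in>insert w S. c v = c v0" if c: "\<forall>(a, b)\<in>insert (a, b) F. c a = c b" for c :: "'x \<Rightarrow> 'k"
    proof -
      have *: "\<forall>v\<in>S. c v = c v0" by (rule con) (use c in auto)
      have "c a = c b" using c by auto
      then have "c w = c v0" using * ab(2) by (auto simp: w_def)
      then show ?thesis using * by simp
    qed
    have "(a, b) \<notin> F" using ab(2) F(1) by auto
    then have "card (insert (a, b) F) = Suc n" using fF F(2) by simp
    moreover have "insert (a, b) F \<subseteq> E \<inter> insert w S \<times> insert w S" using F(1) w(3) ab(1) by auto
    moreover have "card (insert w S) = Suc (Suc n)" using w(2) fS S(3) by simp
    moreover have "insert w S \<subseteq> V" "v0 \<in> insert w S" using S(1,2) w(1) by auto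
    moreover have "\<forall>c :: 'x \<Rightarrow> 'k. (\<forall>(a, b)\<in>insert (a, b) F. c a = c b) \<longrightarrow> (\<forall>v\<in>insert w S. c v = c v0)"
      by (rule allI, rule impI, rule new)
    ultimately have "insert w S \<subseteq> V \<and> v0 \<in> insert w S \<and> card (insert w S) = Suc (Suc n) \<and>
        insert (a, b) F \<subseteq> E \<inter> insert w S \<times> insert w S \<and> card (insert (a, b) F) = Suc n \<and>
        (\<forall>c :: 'x \<Rightarrow> 'k. (\<forall>(a, b)\<in>insert (a, b) F. c a = c b) \<longrightarrow> (\<forall>v\<in>insert w S. c v = c v0))"
      by (intro conjI)
    then show ?case by - (rule exI, rule exI)
  qed
  have pos: "card V > 0" using fin v0 by (auto simp: card_gt_0_iff)
  then have "card V - 1 < card V" by simp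
  from grow[OF this] obtain S F where S: "S \<subseteq> V" "card S = Suc (card V - 1)" and F: "F \<subseteq> E \<inter> S \<times> S" "card F = card V - 1"
    "\<forall>c :: 'x \<Rightarrow> 'k. (\<forall>(a, b)\<in>F. c a = c b) \<longrightarrow> (\<forall>v\<in>S. c v = c v0)"
    by (elim exE conjE) (rule that)
  have "S = V" by (rule card_subset_eq) (use S pos fin in simp_all)
  then have "F \<subseteq> E \<and> card F + 1 = card V \<and> (\<forall>c :: 'x \<Rightarrow> 'k. (\<forall>(a, b)\<in>F. c a = c b) \<longrightarrow> (\<forall>v\<in>V. c v = c v0))"
    using F(3) F(1,2) pos by (intro conjI) (blast, simp, simp only:)
  then show ?thesis by (rule exI)
qed

context poset_with_action
begin

lemma phi_pow:
  assumes "g \<in> carrier G" "z \<in> P"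
  shows "(\<phi> g ^^ n) z = \<phi> (g [^] n) z"
proof (induction n)
  case 0
  show ?case using phi_one[OF assms(2)] by simp
next
  case (Suc n)
  have "(\<phi> g ^^ Suc n) z = \<phi> g (\<phi> (g [^] n) z)" using Suc by simp
  also have "\<dots> = \<phi> (g \<otimes> g [^] n) z" using assms by (simp add: phi_mult)
  also have "g \<otimes> g [^] n = g [^] Suc n" using assms(1) nat_pow_Suc2 by simp
  finally show ?case .
qed

definition Mins where "Mins = {a \<in> P. \<forall>z. (z, a) \<in> r \<longrightarrow> z = a}"
definition Maxs where "Maxs = {b \<in> P. \<forall>z. (b, z) \<in> r \<longrightarrow> z = b}"
definition mins_below where "mins_below z = {a \<in> Mins. (a, z) \<in> r}"

lemma min_below: "z \<in> P \<Longrightarrow> \<exists>a\<in>Mins. (a, z) \<in> r"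
proof -
  assume z: "z \<in> P"
  obtain a where a: "(a, z) \<in> r" "\<And>b. (b, z) \<in> r \<Longrightarrow> card {c \<in> P. (c, a) \<in> r} \<le> card {c \<in> P. (c, b) \<in> r}"
    using ex_has_least_nat[of "\<lambda>a. (a, z) \<in> r" z "\<lambda>a. card {c \<in> P. (c, a) \<in> r}"] r_refl[OF z] by blast
  have "b = a" if b: "(b, a) \<in> r" for b
  proof (rule ccontr)
    assume "b \<noteq> a"
    then have "{c \<in> P. (c, b) \<in> r} \<subset> {c \<in> P. (c, a) \<in> r}" using b r_trans r_antisym r_refl r_P by blast
    then have "card {c \<in> P. (c, b) \<in> r} < card {c \<in> P. (c, a) \<in> r}" using finite_P by (simp add: psubset_card_mono)
    moreover have "(b, z) \<in> r" by (rule r_trans[OF b a(1)])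
    ultimately show False using a(2)[of b] by simp
  qed
  then show ?thesis using a(1) r_P[OF a(1)] by (auto simp: Mins_def)
qed

lemma max_above: "z \<in> P \<Longrightarrow> \<exists>b\<in>Maxs. (z, b) \<in> r"
proof -
  assume z: "z \<in> P"
  obtain a where a: "(z, a) \<in> r" "\<And>b. (z, b) \<in> r \<Longrightarrow> card {c \<in> P. (a, c) \<in> r} \<le> card {c \<in> P. (b, c) \<in> r}"
    using ex_has_least_nat[of "\<lambda>a. (z, a) \<in> r" z "\<lambda>a. card {c \<in> P. (a, c) \<in> r}"] r_refl[OF z] by blast
  have "b = a" if b: "(a, b) \<in> r" for b
  proof (rule ccontr)
    assume "b \<noteq> a"
    then have "{c \<in> P. (b, c) \<in> r} \<subset> {c \<in> P. (a, c) \<in> r}" using b r_trans r_antisym r_refl r_P by blast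
    then have "card {c \<in> P. (b, c) \<in> r} < card {c \<in> P. (a, c) \<in> r}" using finite_P by (simp add: psubset_card_mono)
    moreover have "(z, b) \<in> r" by (rule r_trans[OF a(1) b])
    ultimately show False using a(2)[of b] by simp
  qed
  then show ?thesis using a(1) r_P[OF a(1)] by (auto simp: Maxs_def)
qed

text \<open>
  The bipartite graph whose connectedness is inherited from the poset; the condition \<open>a \<noteq> b\<close> excludes
  elements that are both minimal and maximal.
\<close>

definition edges where "edges = {(a, b). a \<in> Mins \<and> b \<in> Maxs \<and> (a, b) \<in> r \<and> a \<noteq> b}"

text \<open>
  Suppose no edge crosses \<open>S\<close>. Call an element good if some maximal element above it lies in \<open>S\<close>. All
  maximal elements above an element \<open>z\<close> share a minimal element below \<open>z\<close>, so they lie in \<open>S\<close> together. Goodness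
  therefore passes along comparabilities in both directions, and connectedness makes all elements good.
\<close>

lemma extremal_cut:
  assumes conn: "\<And>x y. x \<in> P \<Longrightarrow> y \<in> P \<Longrightarrow> (x, y) \<in> (r \<union> r\<inverse>)\<^sup>*"
    and S: "S \<subseteq> Mins \<union> Maxs" "v0 \<in> S" "S \<noteq> Mins \<union> Maxs"
  shows "\<exists>(a, b)\<in>edges. (a \<in> S) \<noteq> (b \<in> S)"
proof (rule ccontr)
  assume "\<not> ?thesis"
  then have same: "a \<in> S \<longleftrightarrow> b \<in> S" if "a \<in> Mins" "b \<in> Maxs" "(a, b) \<in> r" for a b
    using that unfolding edges_def by (cases "a = b") auto
  define good where "good z \<longleftrightarrow> (\<exists>b\<in>Maxs. b \<in> S \<and> (z, b) \<in> r)" for z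
  have up: "good w" if zw: "(z, w) \<in> r" and gz: "good z" for z w
  proof -
    obtain b where b: "b \<in> Maxs" "b \<in> S" "(z, b) \<in> r" using gz by (auto simp: good_def)
    obtain a where a: "a \<in> Mins" "(a, z) \<in> r" using min_below r_P[OF zw] by blast
    obtain c where c: "c \<in> Maxs" "(w, c) \<in> r" using max_above r_P[OF zw] by blast
    have "a \<in> S" using same[OF a(1) b(1) r_trans[OF a(2) b(3)]] b(2) by simp
    then have "c \<in> S" using same[OF a(1) c(1) r_trans[OF a(2) r_trans[OF zw c(2)]]] by simp
    then show ?thesis using c by (auto simp: good_def)
  qed
  have down: "good z" if "(z, w) \<in> r" "good w" for z w
    using that r_trans unfolding good_def by blast
  have v0P: "v0 \<in> P" using S(1,2) by (auto simp: Mins_def Maxs_def)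
  have "good v0"
  proof (cases "v0 \<in> Maxs")
    case True
    then show ?thesis using S(2) r_refl[OF v0P] by (auto simp: good_def)
  next
    case False
    then have "v0 \<in> Mins" using S(1,2) by auto
    moreover obtain b where "b \<in> Maxs" "(v0, b) \<in> r" using max_above[OF v0P] by blast
    ultimately show ?thesis using same[of v0 b] S(2) by (auto simp: good_def)
  qed
  have all: "good z" if "z \<in> P" for z
    using conn[OF v0P that] by (induction rule: rtrancl_induct) (use \<open>good v0\<close> up down in auto)
  have "v \<in> S" if v: "v \<in> Mins \<union> Maxs" for v
  proof -
    have "v \<in> P" using v by (auto simp: Mins_def Maxs_def)
    then obtain b where b: "b \<in> Maxs" "b \<in> S" "(v, b) \<in> r" using all by (auto simp: good_def)
    show ?thesis
    proof (cases "v \<in> Maxs")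
      case True
      then have "b = v" using b(3) by (simp add: Maxs_def)
      then show ?thesis using b(2) by simp
    next
      case False
      then show ?thesis using same[of v b] v b by auto
    qed
  qed
  then show False using S(1,3) by blast
qed

text \<open>
  The value at a non-maximal \<open>z\<close> is the space with basis the minimal elements below \<open>z\<close>, and the maps between
  these are inclusions. The value at a maximal \<open>b\<close> is a line with the single coordinate \<open>(b, b)\<close>, and the
  basis vector of the minimal element \<open>d\<close> goes to \<open>c (d, b)\<close> times its generator.
\<close>

definition tree_rep :: "('x \<times> 'x \<Rightarrow> 'k::field) \<Rightarrow> 'x \<times> 'x \<Rightarrow> ('x \<times> 'x \<Rightarrow> 'k) \<Rightarrow> ('x \<times> 'x \<Rightarrow> 'k)" where
  "tree_rep c = (\<lambda>(z, w) v (w', a). if w' \<noteq> w then 0 else if z = w then v (w, a)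
     else if w \<in> Maxs then (if a = w then (\<Sum>d\<in>mins_below z. c (d, w) * v (z, d)) else 0)
     else if a \<in> mins_below z then v (z, a) else 0)"

definition tree_index where
  "tree_index = {(z, a). z \<in> P - Maxs \<and> a \<in> mins_below z} \<union> {(b, b) |b. b \<in> Maxs}"

lemma tree_rep_apply: "tree_rep c (z, w) v (w', a) = (if w' \<noteq> w then 0 else if z = w then v (w, a)
     else if w \<in> Maxs then (if a = w then (\<Sum>d\<in>mins_below z. c (d, w) * v (z, d)) else 0)
     else if a \<in> mins_below z then v (z, a) else 0)"
  by (simp add: tree_rep_def)

lemma finite_mins_below: "finite (mins_below z)"
  using finite_P by (simp add: mins_below_def Mins_def)

lemma finite_tree_index: "finite tree_index"
  by (rule finite_subset[of _ "P \<times> P"]) (use finite_P in \<open>auto simp: tree_index_def mins_below_def Mins_def Maxs_def\<close>)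

lemma mins_below_mono: "(x, y) \<in> r \<Longrightarrow> mins_below x \<subseteq> mins_below y"
  using r_trans by (auto simp: mins_below_def)

lemma cat_rep_tree: "cat_rep (poset_category P r) (supported tree_index) (tree_rep (c :: 'x \<times> 'x \<Rightarrow> 'k::field))"
proof (rule cat_rep_posetI[where col = fst])
  show "fst i \<in> P" if "i \<in> tree_index" for i using that by (auto simp: tree_index_def Maxs_def)
  show "tree_rep c (z, z) v = (\<lambda>i. if fst i = z then v i else 0)" for z v
    by (rule ext) (auto simp: tree_rep_def split: prod.split)
  show "lin_on (supported tree_index) (tree_rep c (z, w))" for z w
    unfolding lin_on_def
    by (auto simp: fun_eq_iff tree_rep_apply fscale_apply algebra_simps sum.distrib sum_distrib_left)
  show "tree_rep c (z, w) v i = 0" if "(z, w) \<in> r" "v \<in> supported tree_index" "i \<notin> tree_index \<or> fst i \<noteq> w" for z w v i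
  proof -
    obtain w' a where i: "i = (w', a)" by (cases i)
    show ?thesis
      using that mins_below_mono[OF that(1)] r_P[OF that(1)] unfolding i tree_rep_apply
      by (auto simp: tree_index_def supported_def)
  qed
  show "tree_rep c (z, w) v = 0" if "\<And>i. fst i = z \<Longrightarrow> v i = 0" for z w v
    using that by (auto simp: fun_eq_iff tree_rep_apply intro!: sum.neutral)
  show "tree_rep c (y, z) (tree_rep c (x, y) v) = tree_rep c (x, z) v"
    if xyz: "(x, y) \<in> r" "(y, z) \<in> r" "x \<noteq> y" "y \<noteq> z" for x y z v
  proof (rule ext)
    fix i :: "'x \<times> 'x"
    obtain w a where i: "i = (w, a)" by (cases i)
    have xz: "x \<noteq> z" using xyz r_antisym by blast
    have y: "y \<notin> Maxs" using xyz by (auto simp: Maxs_def)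
    have sub: "mins_below x \<subseteq> mins_below y" by (rule mins_below_mono[OF xyz(1)])
    have "(\<Sum>d\<in>mins_below y. c (d, z) * (if d \<in> mins_below x then v (x, d) else 0)) = (\<Sum>d\<in>mins_below x. c (d, z) * v (x, d))"
      using sub finite_mins_below by (intro sum.mono_neutral_cong_right) auto
    then show "tree_rep c (y, z) (tree_rep c (x, y) v) i = tree_rep c (x, z) v i"
      using xyz xz y sub unfolding i tree_rep_apply by auto
  qed
qed

text \<open>
  At minimal and maximal elements the values are lines, so an isomorphism acts there by nonzero
  scalars \<open>h v\<close>. Edges of weight one force \<open>h\<close> to agree at their ends, so \<open>h\<close> is constant by the choice
  of \<open>F\<close>; the edge \<open>e\<close> then compares \<open>l\<close> with \<open>m\<close>.
\<close>

lemma tree_rep_not_iso: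
  assumes F: "F \<subseteq> edges" "\<And>h :: 'x \<Rightarrow> 'k::field. (\<forall>(a, b)\<in>F. h a = h b) \<Longrightarrow> \<forall>v\<in>Mins \<union> Maxs. h v = h v0"
    and e: "e \<in> edges" "e \<notin> F"
    and iso: "op_iso r (supported tree_index) (tree_rep (\<lambda>d. if d = e then l else 1)) (supported tree_index) (tree_rep (\<lambda>d. if d = e then m else (1 :: 'k)))"
  shows "l = m"
proof -
  let ?V = "supported tree_index :: ('x \<times> 'x \<Rightarrow> 'k) set"
  let ?c = "\<lambda>l d. if d = e then l else (1 :: 'k)"
  obtain f where f: "op_hom r ?V (tree_rep (?c l)) ?V (tree_rep (?c m)) f" and bij: "bij_betw f ?V ?V"
    using iso unfolding op_iso_def by blast
  note fD = op_homD[OF f]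
  have idx: "(v, v) \<in> tree_index" if "v \<in> Mins \<union> Maxs" for v
    using that r_refl by (auto simp: tree_index_def mins_below_def Mins_def)
  have u: "(unit_vec (v, v) :: 'x \<times> 'x \<Rightarrow> 'k) \<in> ?V" if "v \<in> Mins \<union> Maxs" for v
    by (rule unit_vec_supported[OF idx[OF that]])
  have only: "a = v" if "v \<in> Mins \<union> Maxs" "(v, a) \<in> tree_index" for v a
    using that by (auto simp: tree_index_def mins_below_def Mins_def)
  define h where "h v = f (unit_vec (v, v)) (v, v)" for v
  have fu: "f (unit_vec (v, v)) = fscale (h v) (unit_vec (v, v))" if v: "v \<in> Mins \<union> Maxs" for v
  proof (rule ext)
    fix i :: "'x \<times> 'x"
    obtain w a where i: "i = (w, a)" by (cases i)
    have vv: "(v, v) \<in> r" using v r_refl by (auto simp: Mins_def Maxs_def)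
    have "unit_vec (v, v) = tree_rep (?c l) (v, v) (unit_vec (v, v))"
      by (auto simp: fun_eq_iff tree_rep_apply unit_vec_def)
    then have eq: "f (unit_vec (v, v)) = tree_rep (?c m) (v, v) (f (unit_vec (v, v)))"
      using fD(3)[OF vv u[OF v]] by simp
    show "f (unit_vec (v, v)) i = fscale (h v) (unit_vec (v, v)) i"
    proof (cases "w = v")
      case False
      then have "f (unit_vec (v, v)) i = 0" unfolding i by (subst eq) (simp add: tree_rep_apply)
      then show ?thesis using False by (simp add: i fscale_apply unit_vec_def)
    next
      case True
      then show ?thesis
        using fD(2)[OF u[OF v]] only[OF v, of a]
        by (cases "a = v") (auto simp: i fscale_apply unit_vec_def h_def supported_def)
    qed
  qed
  have rel: "?c l (a, b) * h b = ?c m (a, b) * h a" if ab: "(a, b) \<in> edges" for a b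
  proof -
    have a: "a \<in> Mins" "b \<in> Maxs" "(a, b) \<in> r" "a \<noteq> b" using ab by (auto simp: edges_def)
    then have V: "a \<in> Mins \<union> Maxs" "b \<in> Mins \<union> Maxs" by auto
    have Mna: "mins_below a = {a}" using a r_refl by (auto simp: mins_below_def Mins_def)
    have T: "tree_rep (?c t) (a, b) (unit_vec (a, a)) = fscale (?c t (a, b)) (unit_vec (b, b))" for t
      using a by (auto simp: fun_eq_iff tree_rep_apply unit_vec_def fscale_apply Mna)
    have lin: "lin_on ?V (tree_rep (?c m) (a, b))"
      using op_repD(3)[OF cat_repD(1)[OF cat_rep_tree]] a(3) by simp
    have "f (fscale (?c l (a, b)) (unit_vec (b, b))) = tree_rep (?c m) (a, b) (fscale (h a) (unit_vec (a, a)))"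
      using fD(3)[OF a(3) u[OF V(1)]] unfolding T fu[OF V(1)] .
    then have "fscale (?c l (a, b)) (fscale (h b) (unit_vec (b, b))) = fscale (h a) (fscale (?c m (a, b)) (unit_vec (b, b)))"
      unfolding lin_onD(2)[OF fD(1) u[OF V(2)]] fu[OF V(2)] lin_onD(2)[OF lin u[OF V(1)]] T .
    from fun_cong[OF this, of "(b, b)"] show ?thesis
      by (simp only: fscale_apply) (simp add: unit_vec_def mult.commute)
  qed
  have "\<forall>(a, b)\<in>F. h a = h b"
  proof (clarify)
    fix a b assume ab: "(a, b) \<in> F"
    then have "(a, b) \<noteq> e" using e(2) by blast
    then show "h a = h b" using rel[of a b] ab F(1) by auto
  qed
  note const = F(2)[OF this]
  obtain a b where ab: "e = (a, b)" by (cases e)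
  have V: "a \<in> Mins \<union> Maxs" "b \<in> Mins \<union> Maxs" using e(1) ab by (auto simp: edges_def)
  have "h a \<noteq> 0"
  proof
    assume "h a = 0"
    then have "f (unit_vec (a, a)) = 0" using fu[OF V(1)] by simp
    then have "unit_vec (a, a) = (0 :: 'x \<times> 'x \<Rightarrow> 'k)"
      by (rule bij_hom_eq_zero[OF f bij supported_subspace u[OF V(1)]])
    then show False by (rule notE[OF unit_vec_nonzero])
  qed
  moreover have "h b = h a" using const V by simp
  moreover have "l * h b = m * h a" using rel[of a b] e(1) ab by simp
  ultimately show ?thesis by simp
qed

text \<open>
  The graph on the minimal and maximal elements has a spanning tree with one edge fewer than vertices.
  As \<open>p\<close> divides both the number of vertices and the number of edges, there is an edge outside the
  tree, and its weight is the parameter of the family.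
\<close>

theorem infinite_type_free:
  assumes inf: "infinite (UNIV :: 'k::field set)" and p: "Factorial_Ring.prime (p :: nat)"
    and g: "g \<in> carrier G" "g [^] p = \<one>" and free: "\<And>x. x \<in> P \<Longrightarrow> \<phi> g x \<noteq> x" and ne: "P \<noteq> {}"
    and conn: "\<And>x y. x \<in> P \<Longrightarrow> y \<in> P \<Longrightarrow> (x, y) \<in> (r \<union> r\<inverse>)\<^sup>*"
  shows "\<not> fin_type TYPE('x \<times> 'x) TYPE('k) (poset_category P r)"
proof
  assume fin: "fin_type TYPE('x \<times> 'x) TYPE('k) (poset_category P r)"
  have VP: "Mins \<union> Maxs \<subseteq> P" by (auto simp: Mins_def Maxs_def)
  have fV: "finite (Mins \<union> Maxs)" using finite_subset[OF VP finite_P] .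
  have Vne: "Mins \<union> Maxs \<noteq> {}" using ne min_below by blast
  then obtain v0 where v0: "v0 \<in> Mins \<union> Maxs" by blast
  have EV: "edges \<subseteq> (Mins \<union> Maxs) \<times> (Mins \<union> Maxs)" by (auto simp: edges_def)
  have fE: "finite edges" by (rule finite_subset[OF EV]) (use fV in simp)
  have pre: "z \<in> P \<and> \<phi> g (\<phi> (inv g) z) = z" and preP: "\<phi> (inv g) z \<in> P" if "z \<in> P" for z
    using that g(1) phi_inv phi_P by auto
  have minv: "\<phi> g a \<in> Mins" if "a \<in> Mins" for a
  proof -
    have a: "a \<in> P" using that by (simp add: Mins_def)
    have "z = \<phi> g a" if z: "(z, \<phi> g a) \<in> r" for z
    proof -
      have zP: "z \<in> P" using r_P[OF z] by simp
      then have "(\<phi> (inv g) z, a) \<in> r" using phi_mono[of "inv g", OF _ z] g(1) phi_inv(1)[OF g(1) a] by simp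
      then have "\<phi> (inv g) z = a" using \<open>a \<in> Mins\<close> by (simp add: Mins_def)
      then show ?thesis using pre[OF zP] by simp
    qed
    then show ?thesis using phi_P[OF g(1) a] by (simp add: Mins_def)
  qed
  have maxv: "\<phi> g a \<in> Maxs" if "a \<in> Maxs" for a
  proof -
    have a: "a \<in> P" using that by (simp add: Maxs_def)
    have "z = \<phi> g a" if z: "(\<phi> g a, z) \<in> r" for z
    proof -
      have zP: "z \<in> P" using r_P[OF z] by simp
      then have "(a, \<phi> (inv g) z) \<in> r" using phi_mono[of "inv g", OF _ z] g(1) phi_inv(1)[OF g(1) a] by simp
      then have "\<phi> (inv g) z = a" using \<open>a \<in> Maxs\<close> by (simp add: Maxs_def)
      then show ?thesis using pre[OF zP] by simp
    qed
    then show ?thesis using phi_P[OF g(1) a] by (simp add: Maxs_def)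
  qed
  have per: "(\<phi> g ^^ p) z = z" if "z \<in> P" for z using phi_pow[OF g(1) that] g(2) phi_one[OF that] by simp
  have "p dvd card (Mins \<union> Maxs)"
    by (rule prime_dvd_card_free[OF fV _ _ _ p, of "\<phi> g"]) (use minv maxv per free VP in blast)+
  moreover have "p dvd card edges"
  proof (rule prime_dvd_card_free[OF fE _ _ _ p, of "act_arrow g"])
    fix s assume s: "s \<in> edges"
    obtain a b where ab: "s = (a, b)" by (cases s)
    have m: "a \<in> Mins" "b \<in> Maxs" "(a, b) \<in> r" "a \<noteq> b" using s ab by (auto simp: edges_def)
    have P: "a \<in> P" "b \<in> P" using r_P[OF m(3)] by auto
    show "act_arrow g s \<in> edges"
      using m minv maxv phi_mono[OF g(1) m(3)] phi_inj[OF g(1) P] by (simp add: ab act_arrow_def edges_def)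
    show "act_arrow g s \<noteq> s" using free[OF P(1)] by (simp add: ab act_arrow_def)
    have "(act_arrow g ^^ n) (a, b) = ((\<phi> g ^^ n) a, (\<phi> g ^^ n) b)" for n
      by (induction n) (simp_all add: act_arrow_def)
    then show "(act_arrow g ^^ p) s = s" using per P by (simp add: ab)
  qed
  moreover have "\<exists>F\<subseteq>edges. card F + 1 = card (Mins \<union> Maxs) \<and>
      (\<forall>h :: 'x \<Rightarrow> 'k. (\<forall>(a, b)\<in>F. h a = h b) \<longrightarrow> (\<forall>v\<in>Mins \<union> Maxs. h v = h v0))"
    by (rule spanning_edges[OF fV v0 EV]) (rule extremal_cut[OF conn])
  then obtain F where F: "F \<subseteq> edges" "card F + 1 = card (Mins \<union> Maxs)"
    "\<forall>h :: 'x \<Rightarrow> 'k. (\<forall>(a, b)\<in>F. h a = h b) \<longrightarrow> (\<forall>v\<in>Mins \<union> Maxs. h v = h v0)"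
    by (elim exE conjE) (rule that)
  ultimately have "F \<noteq> edges" using p dvd_add_right_iff[of p "card edges" 1] by auto
  then obtain e where e: "e \<in> edges" "e \<notin> F" using F(1) by blast
  obtain l m :: 'k where lm: "l \<noteq> m"
    "op_iso r (supported tree_index) (tree_rep (\<lambda>d. if d = e then l else 1)) (supported tree_index) (tree_rep (\<lambda>d. if d = e then m else 1))"
    using fin_type_family[OF fin inf, of "supported tree_index" "\<lambda>l. tree_rep (\<lambda>d. if d = e then l else 1)"]
      cat_rep_tree supported_fin_support[OF finite_tree_index] by auto
  show False using tree_rep_not_iso[OF F(1) _ e lm(2), of v0] F(3) lm(1) by blast
qed

end

context poset_with_action
begin

section \<open>Modular actions\<close>

lemma cover_translate:
  assumes g: "g \<in> carrier G" and xy: "(x, y) \<in> r" "x \<noteq> y"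
    and cover: "\<And>w. (x, w) \<in> r \<Longrightarrow> (w, y) \<in> r \<Longrightarrow> w = x \<or> w = y"
  shows "(\<phi> g x, \<phi> g y) \<in> r \<and> \<phi> g x \<noteq> \<phi> g y \<and>
    (\<forall>w. (\<phi> g x, w) \<in> r \<longrightarrow> (w, \<phi> g y) \<in> r \<longrightarrow> w = \<phi> g x \<or> w = \<phi> g y)"
proof (intro conjI allI impI)
  note P = r_P[OF xy(1)]
  show "(\<phi> g x, \<phi> g y) \<in> r" by (rule phi_mono[OF g xy(1)])
  show "\<phi> g x \<noteq> \<phi> g y" using phi_inj[OF g] P xy(2) by simp
  fix w assume w: "(\<phi> g x, w) \<in> r" "(w, \<phi> g y) \<in> r"
  have wP: "w \<in> P" using r_P[OF w(1)] by simp
  have "(x, \<phi> (inv g) w) \<in> r" "(\<phi> (inv g) w, y) \<in> r"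
    using phi_mono[OF inv_closed[OF g] w(1)] phi_mono[OF inv_closed[OF g] w(2)] phi_inv(1)[OF g] P by simp_all
  then have "\<phi> (inv g) w = x \<or> \<phi> (inv g) w = y" by (rule cover)
  then show "w = \<phi> g x \<or> w = \<phi> g y" using phi_inv(2)[OF g wP] by auto
qed

text \<open>
  The translates of \<open>z\<close> under the powers of \<open>g\<close> are distinct neighbours of the fixed element \<open>x\<close>, and
  there are \<open>p \<ge> 4\<close> of them.
\<close>

lemma infinite_type_moved_cover:
  assumes inf: "infinite (UNIV :: 'k::field set)" and p: "Factorial_Ring.prime (p :: nat)" "p \<ge> 5"
    and g: "g \<in> carrier G" "g [^] p = \<one>" and x: "x \<in> P" "\<phi> g x = x" and z: "\<phi> g z \<noteq> z"
    and cover: "(x, z) \<in> r \<and> x \<noteq> z \<and> (\<forall>w. (x, w) \<in> r \<longrightarrow> (w, z) \<in> r \<longrightarrow> w = x \<or> w = z) \<or>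
      (z, x) \<in> r \<and> z \<noteq> x \<and> (\<forall>w. (z, w) \<in> r \<longrightarrow> (w, x) \<in> r \<longrightarrow> w = z \<or> w = x)"
  shows "\<not> fin_type TYPE(nat) TYPE('k) (poset_category P r)"
proof -
  have zP: "z \<in> P" using cover r_P by blast
  \<comment> \<open>shifted by two, as the four neighbours of a star are numbered from 2 to 5\<close>
  define y where "y i = (\<phi> g ^^ (i - 2)) z" for i :: nat
  have y: "y i = \<phi> (g [^] (i - 2)) z" for i unfolding y_def by (rule phi_pow[OF g(1) zP])
  have gc: "g [^] n \<in> carrier G" for n :: nat using g(1) by simp
  have fixed: "\<phi> (g [^] n) x = x" for n :: nat
    unfolding phi_pow[OF g(1) x(1), symmetric] by (induction n) (simp_all add: x(2))
  have "(\<phi> g ^^ p) z = z" using phi_pow[OF g(1) zP] g(2) phi_one[OF zP] by simp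
  from prime_period_inj[of p "\<phi> g", OF p(1) this z]
  have inj: "inj_on (\<lambda>i. (\<phi> g ^^ i) z) {..<p}" .
  have "inj_on y {2..<6}"
  proof (rule inj_onI)
    fix i j assume ij: "i \<in> {2..<6}" "j \<in> {2..<6}" "y i = y j"
    have "i - 2 = j - 2"
      by (rule inj_onD[OF inj]) (use ij p(2) in \<open>auto simp: y_def\<close>)
    then show "i = j" using ij by auto
  qed
  moreover have "(\<forall>i. 2 \<le> i \<and> i < 6 \<longrightarrow> (x, y i) \<in> r \<and> x \<noteq> y i \<and> (\<forall>w. (x, w) \<in> r \<longrightarrow> (w, y i) \<in> r \<longrightarrow> w = x \<or> w = y i)) \<or>
      (\<forall>i. 2 \<le> i \<and> i < 6 \<longrightarrow> (y i, x) \<in> r \<and> x \<noteq> y i \<and> (\<forall>w. (y i, w) \<in> r \<longrightarrow> (w, x) \<in> r \<longrightarrow> w = y i \<or> w = x))"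
    using cover
  proof
    assume c: "(x, z) \<in> r \<and> x \<noteq> z \<and> (\<forall>w. (x, w) \<in> r \<longrightarrow> (w, z) \<in> r \<longrightarrow> w = x \<or> w = z)"
    show ?thesis
      by (rule disjI1) (use cover_translate[OF gc, of x z] c fixed y in simp)
  next
    assume c: "(z, x) \<in> r \<and> z \<noteq> x \<and> (\<forall>w. (z, w) \<in> r \<longrightarrow> (w, x) \<in> r \<longrightarrow> w = z \<or> w = x)"
    show ?thesis
    proof (rule disjI2, intro allI impI)
      fix i
      show "(y i, x) \<in> r \<and> x \<noteq> y i \<and> (\<forall>w. (y i, w) \<in> r \<longrightarrow> (w, x) \<in> r \<longrightarrow> w = y i \<or> w = x)"
        using cover_translate[OF gc, of z x "i - 2"] c fixed y[of i] by auto
    qed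
  qed
  ultimately show ?thesis by (rule infinite_type_star[OF inf _ x(1)])
qed

text \<open>
  Cauchy's theorem, here from the Sylow theorem, provides an element \<open>g\<close> of order \<open>p\<close>. If \<open>g\<close> fixes some \<open>x\<close>,
  connectedness provides a neighbour \<open>z\<close> of \<open>x\<close>, which \<open>g\<close> either moves or fixes.
\<close>

theorem infinite_type_modular:
  assumes inf: "infinite (UNIV :: 'k::field set)" and p: "Factorial_Ring.prime (p :: nat)" "p \<ge> 5" "of_nat p = (0 :: 'k)"
    and dvd: "p dvd card (carrier G)" and conn: "\<And>x y. x \<in> P \<Longrightarrow> y \<in> P \<Longrightarrow> (x, y) \<in> (r \<union> r\<inverse>)\<^sup>*"
    and P: "P \<noteq> {}" "card P \<noteq> 1"
  shows "\<exists>H. subgroup H G \<and> (\<not> fin_type TYPE(nat) TYPE('k) (poset_category P r) \<or>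
    \<not> fin_type TYPE('x \<times> 'x) TYPE('k) (poset_category P r) \<or> \<not> fin_type TYPE(nat) TYPE('k) (TH H))"
proof -
  \<comment> \<open>the exponent one asks for a subgroup of order p rather than for a full Sylow subgroup\<close>
  obtain m where "Coset.order G = p ^ 1 * m" using dvd unfolding Coset.order_def by auto
  then obtain K where K: "subgroup K G" "card K = p ^ 1" using sylow_thm[OF p(1) grp _ finite_G] by blast
  then have "K \<noteq> {\<one>}" using p(2) by auto
  then obtain g where gK: "g \<in> K" "g \<noteq> \<one>" using subgroup.one_closed[OF K(1)] by blast
  have g: "g \<in> carrier G" using gK(1) subgroup.subset[OF K(1)] by blast
  have "g [^]\<^bsub>G\<lparr>carrier := K\<rparr>\<^esub> Coset.order (G\<lparr>carrier := K\<rparr>) = \<one>\<^bsub>G\<lparr>carrier := K\<rparr>\<^esub>"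
    by (rule group.pow_order_eq_1[OF subgroup.subgroup_is_group[OF K(1) grp]]) (use gK(1) in simp)
  then have gp: "g [^] p = \<one>"
    using K(2) nat_pow_consistent[of g p K] by (simp add: Coset.order_def)
  define H where "H = generate G {g}"
  have H: "subgroup H G" unfolding H_def by (rule generate_is_subgroup) (use g in simp)
  have gH: "g \<in> H" unfolding H_def by (rule generate.incl) simp
  have Hpow: "\<exists>n :: nat. h = g [^] n" if "h \<in> H" for h
    using that generate_pow_on_finite_carrier[OF finite_G g] unfolding H_def by blast
  show ?thesis
  proof (cases "\<exists>x\<in>P. \<phi> g x = x")
    case False
    then have "\<not> fin_type TYPE('x \<times> 'x) TYPE('k) (poset_category P r)"
      by (intro infinite_type_free[OF inf p(1) g gp _ P(1) conn]) auto
    then show ?thesis using H by blast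
  next
    case True
    then obtain x where x: "x \<in> P" "\<phi> g x = x" by blast
    have "P \<noteq> {x}" using P(2) by auto
    then obtain v where v: "v \<in> P" "v \<noteq> x" using x(1) by blast
    have "\<exists>u. u \<noteq> x \<and> ((x, u) \<in> r \<or> (u, x) \<in> r)"
    proof (rule ccontr)
      assume "\<not> ?thesis"
      then have none: "u = x" if "(x, u) \<in> r \<union> r\<inverse>" for u using that by blast
      have "v = x" using conn[OF x(1) v(1)] by (induction rule: rtrancl_induct) (use none in auto)
      then show False using v(2) by simp
    qed
    then obtain u where u: "u \<noteq> x" "(x, u) \<in> r \<or> (u, x) \<in> r" by blast
    obtain z where z: "(x, z) \<in> r \<and> x \<noteq> z \<and> (\<forall>w. (x, w) \<in> r \<longrightarrow> (w, z) \<in> r \<longrightarrow> w = x \<or> w = z) \<or>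
      (z, x) \<in> r \<and> z \<noteq> x \<and> (\<forall>w. (z, w) \<in> r \<longrightarrow> (w, x) \<in> r \<longrightarrow> w = z \<or> w = x)"
      using u cover_exists(1)[of x u] cover_exists(2)[of u x] by metis
    show ?thesis
    proof (cases "\<phi> g z = z")
      case False
      show ?thesis using infinite_type_moved_cover[OF inf p(1,2) g gp x False z] H by blast
    next
      case True
      from z have "\<not> fin_type TYPE(nat) TYPE('k) (TH H)"
      proof
        assume c: "(x, z) \<in> r \<and> x \<noteq> z \<and> (\<forall>w. (x, w) \<in> r \<longrightarrow> (w, z) \<in> r \<longrightarrow> w = x \<or> w = z)"
        show ?thesis
          by (rule infinite_type_pair[where x = x and y = z, OF inf p g gp gK(2) H gH Hpow]) (use c x True in blast)+
      next
        assume c: "(z, x) \<in> r \<and> z \<noteq> x \<and> (\<forall>w. (z, w) \<in> r \<longrightarrow> (w, x) \<in> r \<longrightarrow> w = z \<or> w = x)"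
        show ?thesis
          by (rule infinite_type_pair[where x = z and y = x, OF inf p g gp gK(2) H gH Hpow]) (use c x True in blast)+
      qed
      then show ?thesis using H by blast
    qed
  qed
qed

end

section \<open>The characterisation of finite type\<close>

theorem theorem1p2:
  fixes G :: "('g, 's) monoid_scheme"
    and P :: "'x set" and r :: "'x rel"
    and \<phi> :: "'g \<Rightarrow> 'x \<Rightarrow> 'x"
  assumes "CHAR('k::alg_closed_field) \<noteq> 2" and "CHAR('k) \<noteq> 3"
    and "group G" and "finite (carrier G)"
    and "partial_order_on P r" and "finite P" and "connected_category (poset_category P r)"
    and "poset_action G P r \<phi>"
  shows "finite_representation_type (category_algebra TYPE('k) (transporter_category G P r \<phi>)) \<longleftrightarrow>
    ((of_nat (card (carrier G)) :: 'k) dvd 1 \<and> finite_representation_type (incidence_algebra TYPE('k) P r)) \<or>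
    (card P = 1 \<and> finite_representation_type (group_algebra TYPE('k) G))"
proof -
  interpret pa: poset_with_action G P r \<phi>
    by (rule poset_with_action.intro) (fact assms)+
  interpret T: finite_category "transporter_category G P r \<phi>"
    by (rule finite_category_transporter_category[OF assms(8,5,6,4)])
  interpret Q: finite_category "poset_category P r"
    by (rule finite_category_poset_category[OF assms(6,5)])
  interpret A: finite_category "group_category G"
    by (rule finite_category_group_category[OF assms(3,4)])
  have inf: "infinite (UNIV :: 'k set)" by (rule infinite_alg_closed_field)
  have unit: "(of_nat (card (carrier G)) :: 'k) dvd 1 \<longleftrightarrow> of_nat (card (carrier G)) \<noteq> (0 :: 'k)"
    by (simp add: dvd_field_iff)
  have E: "{(Dom (poset_category P r) a, Cod (poset_category P r) a) |a. a \<in> Arr (poset_category P r)} = r"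
    by (auto simp: poset_category_def)
  have conn: "P \<noteq> {}" "\<And>x y. x \<in> P \<Longrightarrow> y \<in> P \<Longrightarrow> (x, y) \<in> (r \<union> r\<inverse>)\<^sup>*"
    using assms(7) unfolding connected_category_def Let_def E by (auto simp: poset_category_def)
  show ?thesis
    unfolding unit incidence_algebra_def group_algebra_def
  proof
    assume fin: "finite_representation_type (category_algebra TYPE('k) (transporter_category G P r \<phi>))"
    show "of_nat (card (carrier G)) \<noteq> (0 :: 'k) \<and> finite_representation_type (category_algebra TYPE('k) (poset_category P r)) \<or>
      card P = 1 \<and> finite_representation_type (category_algebra TYPE('k) (group_category G))"
    proof (cases "card P = 1")
      case True
      then obtain x where "P = {x}" by (auto simp: card_1_singleton_iff)
      then have "fin_type TYPE(nat) TYPE('k) (group_category G)"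
        using pa.fin_type_group_iff T.fin_type_if_finite_representation_type[OF fin] by blast
      then show ?thesis using True A.finite_representation_type_if_fin_type by blast
    next
      case False
      have TH: "fin_type TYPE(nat) TYPE('k) (pa.TH H)" if "subgroup H G" for H
        by (rule pa.fin_type_subgroup[OF T.fin_type_if_finite_representation_type[OF fin] that])
      have Pfin: "fin_type TYPE(nat) TYPE('k) (poset_category P r)"
        unfolding pa.fin_type_TH_one_iff[symmetric] by (rule TH[OF pa.triv_subgroup])
      \<comment> \<open>the family for actions without fixed points is indexed by pairs of elements of the poset\<close>
      have Pfin': "fin_type TYPE('x \<times> 'x) TYPE('k) (poset_category P r)"
        unfolding pa.fin_type_TH_one_iff[symmetric]
        by (rule pa.fin_type_subgroup[OF T.fin_type_if_finite_representation_type[OF fin] pa.triv_subgroup])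
      have "of_nat (card (carrier G)) \<noteq> (0 :: 'k)"
      proof
        assume "of_nat (card (carrier G)) = (0 :: 'k)"
        then have dvd: "CHAR('k) dvd card (carrier G)" by (simp add: of_nat_eq_0_iff_char_dvd)
        have "card (carrier G) > 0" using assms(4) pa.one_closed by (auto simp: card_gt_0_iff)
        then have "CHAR('k) > 0" using dvd by (intro gr0I) auto
        then have p: "Factorial_Ring.prime CHAR('k)" by (rule prime_CHAR_semidom)
        \<comment> \<open>primes other than 2 and 3 are at least 5\<close>
        have "CHAR('k) \<noteq> 4" using p by auto
        then have "CHAR('k) \<ge> 5" using assms(1,2) prime_ge_2_nat[OF p] by linarith
        from pa.infinite_type_modular[OF inf p this of_nat_CHAR dvd conn(2,1) False]
        show False using TH Pfin Pfin' by blast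
      qed
      then show ?thesis using Q.finite_representation_type_if_fin_type[OF Pfin] by blast
    qed
  next
    assume "of_nat (card (carrier G)) \<noteq> (0 :: 'k) \<and> finite_representation_type (category_algebra TYPE('k) (poset_category P r)) \<or>
      card P = 1 \<and> finite_representation_type (category_algebra TYPE('k) (group_category G))"
    then show "finite_representation_type (category_algebra TYPE('k) (transporter_category G P r \<phi>))"
    proof (elim disjE conjE)
      assume inv: "of_nat (card (carrier G)) \<noteq> (0 :: 'k)"
        and fin: "finite_representation_type (category_algebra TYPE('k) (poset_category P r))"
      have "fin_type TYPE(nat) TYPE('k) (pa.TH {\<one>\<^bsub>G\<^esub>})"
        unfolding pa.fin_type_TH_one_iff by (rule Q.fin_type_if_finite_representation_type[OF fin])
      from pa.fin_type_transporter[OF this inv] show ?thesis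
        by (rule T.finite_representation_type_if_fin_type)
    next
      assume P: "card P = 1" and fin: "finite_representation_type (category_algebra TYPE('k) (group_category G))"
      obtain x where "P = {x}" using P by (auto simp: card_1_singleton_iff)
      then have "fin_type TYPE(nat) TYPE('k) (transporter_category G P r \<phi>)"
        using pa.fin_type_group_iff A.fin_type_if_finite_representation_type[OF fin] by blast
      then show ?thesis by (rule T.finite_representation_type_if_fin_type)
    qed
  qed
qed

end
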